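(* Let $X$ and $Y$ be uniformly locally finite metric spaces and assume that $\mathrm{C}^*_u(X)$ embeds into $\mathrm{C}^*_u(Y)$ by a compact preserving map. Then: (1) $\mathrm{asydim}(X)\leq\mathrm{asydim}(Y)$; (2) if $Y$ has property A, so does $X$; and (3) if $Y$ has finite decomposition complexity, then so does $X$.
   Context: A metric space $(X,d)$ is uniformly locally finite (u.l.f.) if $\sup_{x\in X}|B_r(x)|<\infty$ for all $r>0$. An operator $a\in\mathcal{B}(\ell_2(X))$ has finite propagation if there is $r>0$ with $\langle a\delta_x,\delta_y\rangle=0$ whenever $d(x,y)>r$, where $(\delta_x)_{x\in X}$ is the canonical basis. The uniform Roe algebra $\mathrm{C}^*_u(X)$ is the norm closure in $\mathcal{B}(\ell_2(X))$ of the finite propagation operators. An embedding is an injective $^*$-homomorphism (not necessarily unital); $\Phi\colon\mathrm{C}^*_u(X)\to\mathrm{C}^*_u(Y)$ is compact preserving if $\Phi(a)$ is compact for every compact $a\in\mathrm{C}^*_u(X)$. Asymptotic dimension: $\mathrm{asydim}(X)\leq n$ if for all $R>0$ there are families $\mathcal{U}_0,\ldots,\mathcal{U}_n$ of subsets of $X$ such that $X=\bigcup_{i\le n}\bigcup_{U\in\mathcal{U}_i}U$, $d(U,U')>R$ for all $i\leq n$ and distinct $U,U'\in\mathcal{U}_i$, and $\sup_{U\in\mathcal{U}_i}\mathrm{diam}(U)<\infty$ for all $i\leq n$. $\mathrm{asydim}(X)$ is the least such $n$, or $\infty$ if there is none. Property A (Yu): a (discrete) metric space $X$ has property A if for all $r,\varepsilon>0$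 there are $R>0$ and finite sets $A_x\subseteq X\times\mathbb{N}$ ($x\in X$) such that $(x,1)\in A_x$ for all $x$; $|A_x\triangle A_y|/|A_x\cap A_y|<\varepsilon$ whenever $d(x,y)\leq r$; and $d(y,z)\leq R$ whenever $(y,m),(z,n)\in A_x$ for some $x$. Finite decomposition complexity (FDC): a metric family is a set of metric spaces; it is bounded if the diameters of its members are uniformly bounded. For $r>0$, a metric family $\mathcal{X}$ is $r$-decomposable over a metric family $\mathcal{Z}$ if every $X\in\mathcal{X}$ can be written as $X=X_0\cup X_1$, where each $X_i$ is a disjoint union $X_i=\bigsqcup_j X_{ij}$ with $d(X_{ij},X_{ij'})>r$ for $j\neq j'$ and each $X_{ij}$ (with the restricted metric) belongs to $\mathcal{Z}$. The class of metric families with FDC is the smallest class $\mathfrak{D}$ which contains all bounded metric families and is closed under decomposition, i.e. if for every $r>0$ the family $\mathcal{X}$ is $r$-decomposable over some $\mathcal{Z}\in\mathfrak{D}$, then $\mathcal{X}\in\mathfrak{D}$. A metric space $X$ has FDC if the family $\{X\}$ does. *)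

theory Defs
  imports "HOL-Analysis.Analysis"
begin

section \<open>The Hilbert space of square-summable functions\<close>

lemma summable_mult_cnj:
  fixes f g :: "'a \<Rightarrow> complex"
  assumes f: "(\<lambda>x. (cmod (f x))\<^sup>2) summable_on UNIV" and g: "(\<lambda>x. (cmod (g x))\<^sup>2) summable_on UNIV"
  shows "(\<lambda>x. f x * cnj (g x)) summable_on UNIV"
proof (rule abs_summable_summable, rule summable_on_comparison_test)
  show "(\<lambda>x. (cmod (f x))\<^sup>2 + (cmod (g x))\<^sup>2) summable_on UNIV"
    using f g by (rule summable_on_add)
  show "norm (f x * cnj (g x)) \<le> (cmod (f x))\<^sup>2 + (cmod (g x))\<^sup>2" for x
  proof -
    have "0 \<le> (cmod (f x) - cmod (g x))\<^sup>2 + (cmod (f x))\<^sup>2 + (cmod (g x))\<^sup>2" by simp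
    then show ?thesis by (simp add: norm_mult power2_diff)
  qed
qed simp

lemma square_summable_add:
  fixes f g :: "'a \<Rightarrow> complex"
  assumes f: "(\<lambda>x. (cmod (f x))\<^sup>2) summable_on UNIV" and g: "(\<lambda>x. (cmod (g x))\<^sup>2) summable_on UNIV"
  shows "(\<lambda>x. (cmod (f x + g x))\<^sup>2) summable_on UNIV"
proof (rule summable_on_comparison_test)
  show "(\<lambda>x. 2 * ((cmod (f x))\<^sup>2 + (cmod (g x))\<^sup>2)) summable_on UNIV"
    using f g by (intro summable_on_cmult_right summable_on_add)
  show "(cmod (f x + g x))\<^sup>2 \<le> 2 * ((cmod (f x))\<^sup>2 + (cmod (g x))\<^sup>2)" for x
  proof -
    have "(cmod (f x + g x))\<^sup>2 \<le> (cmod (f x) + cmod (g x))\<^sup>2"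
      by (simp add: norm_triangle_ineq power_mono)
    also have "\<dots> \<le> (cmod (f x) + cmod (g x))\<^sup>2 + (cmod (f x) - cmod (g x))\<^sup>2" by simp
    also have "\<dots> = 2 * ((cmod (f x))\<^sup>2 + (cmod (g x))\<^sup>2)" by (simp add: power2_diff power2_sum)
    finally show ?thesis .
  qed
qed simp

lemma square_summable_mult:
  fixes f :: "'a \<Rightarrow> complex"
  assumes "(\<lambda>x. (cmod (f x))\<^sup>2) summable_on UNIV"
  shows "(\<lambda>x. (cmod (c * f x))\<^sup>2) summable_on UNIV"
  using summable_on_cmult_right[OF assms] by (simp add: norm_mult power_mult_distrib)

lemma infsum_mult_cnj_self:
  fixes f :: "'a \<Rightarrow> complex"
  assumes "(\<lambda>x. (cmod (f x))\<^sup>2) summable_on UNIV"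
  shows "(\<Sum>\<^sub>\<infinity>x. f x * cnj (f x)) = of_real (\<Sum>\<^sub>\<infinity>x. (cmod (f x))\<^sup>2)"
  using has_sum_of_real[OF has_sum_infsum[OF assms], where ?'a = complex]
  by (intro infsumI) (simp only: complex_norm_square[symmetric])

typedef 'a ell2 = "{f :: 'a \<Rightarrow> complex. (\<lambda>x. (cmod (f x))\<^sup>2) summable_on UNIV}"
  morphisms ell2_fun Abs_ell2
  by (rule exI[of _ "\<lambda>_. 0"]) simp

setup_lifting type_definition_ell2

lift_definition cinner :: "'a ell2 \<Rightarrow> 'a ell2 \<Rightarrow> complex" is
  "\<lambda>f g. \<Sum>\<^sub>\<infinity>x. f x * cnj (g x)" .

lift_definition cscale :: "complex \<Rightarrow> 'a ell2 \<Rightarrow> 'a ell2" is "\<lambda>c f x. c * f x"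
  by (rule square_summable_mult)

lift_definition delta :: "'a \<Rightarrow> 'a ell2" is "\<lambda>x y. if y = x then 1 else 0"
proof -
  fix x :: 'a
  have "(\<lambda>y. (cmod (if y = x then 1 else 0))\<^sup>2) summable_on {x}" by simp
  then show "(\<lambda>y. (cmod (if y = x then 1 else 0))\<^sup>2) summable_on UNIV"
    by (rule summable_on_cong_neutral[THEN iffD1, rotated -1]) auto
qed

instantiation ell2 :: (type) real_inner
begin

lift_definition zero_ell2 :: "'a ell2" is "\<lambda>_. 0" by simp
lift_definition plus_ell2 :: "'a ell2 \<Rightarrow> 'a ell2 \<Rightarrow> 'a ell2" is "\<lambda>f g x. f x + g x"
  by (rule square_summable_add)
lift_definition uminus_ell2 :: "'a ell2 \<Rightarrow> 'a ell2" is "\<lambda>f x. - f x" by simp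
definition minus_ell2 :: "'a ell2 \<Rightarrow> 'a ell2 \<Rightarrow> 'a ell2" where "f - g = f + (- (g :: 'a ell2))"
definition scaleR_ell2 :: "real \<Rightarrow> 'a ell2 \<Rightarrow> 'a ell2" where "r *\<^sub>R f = cscale (of_real r) (f :: 'a ell2)"
definition inner_ell2 :: "'a ell2 \<Rightarrow> 'a ell2 \<Rightarrow> real" where "f \<bullet> g = Re (cinner f (g :: 'a ell2))"
definition norm_ell2 :: "'a ell2 \<Rightarrow> real" where "norm f = sqrt (Re (cinner f (f :: 'a ell2)))"
definition sgn_ell2 :: "'a ell2 \<Rightarrow> 'a ell2" where "sgn f = inverse (norm f) *\<^sub>R (f :: 'a ell2)"
definition dist_ell2 :: "'a ell2 \<Rightarrow> 'a ell2 \<Rightarrow> real" where "dist f g = norm (f - (g :: 'a ell2))"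
definition uniformity_ell2 :: "('a ell2 \<times> 'a ell2) filter" where
  "uniformity = (INF e\<in>{0<..}. principal {(x :: 'a ell2, y). dist x y < e})"
definition open_ell2 :: "'a ell2 set \<Rightarrow> bool" where
  "open (U :: 'a ell2 set) \<longleftrightarrow> (\<forall>x\<in>U. \<forall>\<^sub>F (x', y) in uniformity. x' = x \<longrightarrow> y \<in> U)"

instance
proof
  fix f g h :: "'a ell2" and r s :: real
  show "f + g + h = f + (g + h)" by transfer (simp add: add.assoc)
  show "f + g = g + f" by transfer (simp add: add.commute)
  show "0 + f = f" by transfer simp
  show "- f + f = 0" by transfer simp
  show "f - g = f + - g" by (rule minus_ell2_def)
  show "r *\<^sub>R (f + g) = r *\<^sub>R f + r *\<^sub>R g"
    unfolding scaleR_ell2_def by transfer (simp add: algebra_simps)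
  show "(r + s) *\<^sub>R f = r *\<^sub>R f + s *\<^sub>R f"
    unfolding scaleR_ell2_def by transfer (simp add: algebra_simps)
  show "r *\<^sub>R s *\<^sub>R f = (r * s) *\<^sub>R f"
    unfolding scaleR_ell2_def by transfer (simp add: algebra_simps)
  show "1 *\<^sub>R f = f" unfolding scaleR_ell2_def by transfer simp
  show "sgn f = inverse (norm f) *\<^sub>R f" by (rule sgn_ell2_def)
  show "dist f g = norm (f - g)" by (rule dist_ell2_def)
  show "uniformity = (INF e\<in>{0<..}. principal {(x, y). dist (x::'a ell2) y < e})"
    by (rule uniformity_ell2_def)
  show "open U \<longleftrightarrow> (\<forall>x\<in>U. \<forall>\<^sub>F (x', y) in uniformity. x' = x \<longrightarrow> y \<in> U)" for U :: "'a ell2 set"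
    by (rule open_ell2_def)
  have "cinner f g = cnj (cinner g f)"
    by transfer (simp flip: infsum_cnj add: mult.commute)
  then show "f \<bullet> g = g \<bullet> f" by (simp add: inner_ell2_def)
  have "cinner (f + g) h = cinner f h + cinner g h"
    by transfer (simp add: distrib_right infsum_add summable_mult_cnj)
  then show "(f + g) \<bullet> h = f \<bullet> h + g \<bullet> h" by (simp add: inner_ell2_def)
  have "cinner (r *\<^sub>R f) g = of_real r * cinner f g"
    unfolding scaleR_ell2_def by transfer (simp add: mult.assoc infsum_cmult_right')
  then show "r *\<^sub>R f \<bullet> g = r * (f \<bullet> g)" by (simp add: inner_ell2_def)
  have sq: "cinner f f = of_real (\<Sum>\<^sub>\<infinity>x. (cmod (ell2_fun f x))\<^sup>2)"
    by transfer (rule infsum_mult_cnj_self)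
  then show "0 \<le> f \<bullet> f" by (simp add: inner_ell2_def infsum_nonneg)
  have sm: "(\<lambda>x. (cmod (ell2_fun f x))\<^sup>2) summable_on UNIV" using ell2_fun[of f] by simp
  show "f \<bullet> f = 0 \<longleftrightarrow> f = 0"
  proof
    assume "f \<bullet> f = 0"
    then have "(\<Sum>\<^sub>\<infinity>x. (cmod (ell2_fun f x))\<^sup>2) = 0" by (simp add: inner_ell2_def sq)
    then have "(cmod (ell2_fun f x))\<^sup>2 = 0" for x
      using nonneg_infsum_le_0D[OF _ sm, of x] by simp
    then show "f = 0" by transfer auto
  next
    show "f = 0 \<Longrightarrow> f \<bullet> f = 0" unfolding inner_ell2_def by transfer simp
  qed
  show "norm f = sqrt (f \<bullet> f)" by (simp add: norm_ell2_def inner_ell2_def)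
qed

end

lemma norm_ell2: "norm f = sqrt (\<Sum>\<^sub>\<infinity>x. (cmod (ell2_fun f x))\<^sup>2)"
proof -
  have "cinner f f = of_real (\<Sum>\<^sub>\<infinity>x. (cmod (ell2_fun f x))\<^sup>2)"
    by transfer (rule infsum_mult_cnj_self)
  then show ?thesis by (simp add: norm_ell2_def)
qed

lemma norm_cscale: "norm (cscale c f) = cmod c * norm f"
  unfolding norm_ell2
  by transfer (simp add: norm_mult power_mult_distrib infsum_cmult_right' real_sqrt_mult)

lemma bounded_linear_cscale: "bounded_linear (cscale c)"
proof
  show "cscale c (f + g) = cscale c f + cscale c g" for f g :: "'a ell2"
    by transfer (simp add: distrib_left)
  show "cscale c (r *\<^sub>R f) = r *\<^sub>R cscale c f" for r and f :: "'a ell2"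
    unfolding scaleR_ell2_def by transfer (simp add: mult.left_commute)
  show "\<exists>K. \<forall>f :: 'a ell2. norm (cscale c f) \<le> norm f * K"
    by (rule exI[of _ "cmod c"]) (simp add: norm_cscale mult.commute)
qed

lemma cinner_add_left: "cinner (f + g) h = cinner f h + cinner g h"
  by transfer (simp add: distrib_right infsum_add summable_mult_cnj)

lemma cinner_cscale_left: "cinner (cscale c f) g = c * cinner f g"
  by transfer (simp add: mult.assoc infsum_cmult_right')

lemma cinner_commute: "cinner f g = cnj (cinner g f)"
  by transfer (simp flip: infsum_cnj add: mult.commute)

lemma cinner_zero_left [simp]: "cinner 0 g = 0"
  by transfer simp

lemma cinner_sum_left: "cinner (\<Sum>x\<in>F. f x) g = (\<Sum>x\<in>F. cinner (f x) g)"
  by (induction F rule: infinite_finite_induct) (simp_all add: cinner_add_left)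

lemma cinner_delta_left: "cinner (delta x) g = cnj (ell2_fun g x)"
proof transfer
  fix x :: 'a and g :: "'a \<Rightarrow> complex"
  have "((\<lambda>y. (if y = x then 1 else 0) * cnj (g y)) has_sum cnj (g x)) UNIV"
    by (rule has_sum_finite_neutralI[of "{x}"]) auto
  then show "(\<Sum>\<^sub>\<infinity>y. (if y = x then 1 else 0) * cnj (g y)) = cnj (g x)"
    by (rule infsumI)
qed

lemma cinner_delta_right: "cinner g (delta x) = ell2_fun g x"
  by (subst cinner_commute) (simp add: cinner_delta_left)

lemma norm_cinner_le: "cmod (cinner f g) \<le> norm f * norm g"
proof (cases "cinner f g = 0")
  case False
  define c where "c = cnj (sgn (cinner f g))"
  have "of_real (cmod (cinner f g)) = c * cinner f g"
    using False unfolding c_def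
    by (simp add: complex_sgn_def sgn_eq complex_norm_square[symmetric] field_simps power2_eq_square
        scaleR_conv_of_real)
  also have "\<dots> = cinner (cscale c f) g" by (simp add: cinner_cscale_left)
  finally have "cmod (cinner f g) = cscale c f \<bullet> g"
    unfolding inner_ell2_def by (metis Re_complex_of_real)
  also have "\<dots> \<le> norm (cscale c f) * norm g" by (rule norm_cauchy_schwarz)
  also have "\<dots> = norm f * norm g" using False by (simp add: norm_cscale c_def norm_sgn)
  finally show ?thesis .
qed simp

lemma bounded_linear_cinner_left: "bounded_linear (\<lambda>f. cinner f g)"
proof
  show "cinner (f + f') g = cinner f g + cinner f' g" for f f' by (rule cinner_add_left)
  show "cinner (r *\<^sub>R f) g = r *\<^sub>R cinner f g" for r f
    by (simp add: scaleR_ell2_def cinner_cscale_left scaleR_conv_of_real)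
  show "\<exists>K. \<forall>f. cmod (cinner f g) \<le> norm f * K" using norm_cinner_le by blast
qed

lemma ell2_fun_sum_delta:
  assumes "finite F"
  shows "ell2_fun (\<Sum>x\<in>F. cscale (h x) (delta x)) y = (if y \<in> F then h y else 0)"
proof -
  have "ell2_fun (\<Sum>x\<in>F. cscale (h x) (delta x)) y
      = (\<Sum>x\<in>F. h x * ell2_fun (delta x) y)"
    by (simp add: cinner_cscale_left cinner_sum_left flip: cinner_delta_right)
  also have "\<dots> = (\<Sum>x\<in>F. if y = x then h x else 0)"
    by (intro sum.cong) (auto simp: delta.rep_eq)
  also have "\<dots> = (if y \<in> F then h y else 0)" using assms by simp
  finally show ?thesis .
qed

lemma norm_sum_delta:
  assumes "finite F"
  shows "(norm (\<Sum>x\<in>F. cscale (h x) (delta x)))\<^sup>2 = (\<Sum>x\<in>F. (cmod (h x))\<^sup>2)"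
proof -
  have "((\<lambda>y. (cmod (if y \<in> F then h y else 0))\<^sup>2) has_sum (\<Sum>x\<in>F. (cmod (h x))\<^sup>2)) UNIV"
    by (rule has_sum_finite_neutralI[of F]) (use assms in auto)
  then have "(\<Sum>\<^sub>\<infinity>y. (cmod (if y \<in> F then h y else 0))\<^sup>2) = (\<Sum>x\<in>F. (cmod (h x))\<^sup>2)"
    by (rule infsumI)
  then show ?thesis by (simp add: norm_ell2 ell2_fun_sum_delta[OF assms] sum_nonneg)
qed

lemma square_summable_ell2_fun: "(\<lambda>x. (cmod (ell2_fun f x))\<^sup>2) summable_on UNIV"
  using ell2_fun[of f] by simp

lemma finite_support_approx:
  "((\<lambda>F. \<Sum>x\<in>F. cscale (ell2_fun f x) (delta x)) \<longlongrightarrow> f) (finite_subsets_at_top UNIV)"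
proof -
  let ?s = "\<lambda>F. \<Sum>x\<in>F. cscale (ell2_fun f x) (delta x)"
  have nf: "(norm f)\<^sup>2 = (\<Sum>\<^sub>\<infinity>x. (cmod (ell2_fun f x))\<^sup>2)"
    by (simp add: norm_ell2 infsum_nonneg)
  have eq: "(norm (?s F - f))\<^sup>2 = (norm f)\<^sup>2 - (\<Sum>x\<in>F. (cmod (ell2_fun f x))\<^sup>2)" if "finite F" for F
  proof -
    have "?s F \<bullet> f = (\<Sum>x\<in>F. (cmod (ell2_fun f x))\<^sup>2)"
      by (simp add: inner_ell2_def cinner_sum_left cinner_cscale_left cinner_delta_left
          flip: complex_norm_square)
    moreover have "(norm (?s F - f))\<^sup>2 = (norm (?s F))\<^sup>2 - 2 * (?s F \<bullet> f) + (norm f)\<^sup>2"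
      by (simp add: power2_norm_eq_inner inner_diff_left inner_diff_right inner_commute)
    ultimately show ?thesis by (simp add: norm_sum_delta[OF that])
  qed
  have "((\<lambda>F. (norm f)\<^sup>2 - (\<Sum>x\<in>F. (cmod (ell2_fun f x))\<^sup>2)) \<longlongrightarrow> (norm f)\<^sup>2 - (norm f)\<^sup>2)
      (finite_subsets_at_top UNIV)"
    unfolding nf by (intro tendsto_diff tendsto_const infsum_tendsto square_summable_ell2_fun)
  then have "((\<lambda>F. (norm (?s F - f))\<^sup>2) \<longlongrightarrow> 0) (finite_subsets_at_top UNIV)"
    unfolding diff_self
    by (rule Lim_transform_eventually)
       (rule eventually_finite_subsets_at_top_weakI, simp only: eq)
  then have "((\<lambda>F. sqrt ((norm (?s F - f))\<^sup>2)) \<longlongrightarrow> sqrt 0) (finite_subsets_at_top UNIV)"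
    by (rule tendsto_real_sqrt)
  then have "((\<lambda>F. norm (?s F - f)) \<longlongrightarrow> 0) (finite_subsets_at_top UNIV)" by simp
  then show ?thesis by (rule LIM_zero_cancel[OF tendsto_norm_zero_cancel])
qed


section \<open>Bounded operators on \<open>\<ell>\<^sub>2(X)\<close> and uniform Roe algebras\<close>

type_synonym 'a op2 = "'a ell2 \<Rightarrow>\<^sub>L 'a ell2"

definition op_cscale :: "complex \<Rightarrow> 'a op2 \<Rightarrow> 'a op2" where
  "op_cscale c a = Blinfun (\<lambda>f. cscale c (blinfun_apply a f))"

lemma blinfun_apply_op_cscale: "blinfun_apply (op_cscale c a) f = cscale c (blinfun_apply a f)"
  unfolding op_cscale_def
  by (simp add: bounded_linear_Blinfun_apply
      bounded_linear_compose[OF bounded_linear_cscale blinfun.bounded_linear_right])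

definition op_adj :: "'a op2 \<Rightarrow> 'a op2" where
  "op_adj a = (THE b. \<forall>f g. cinner (blinfun_apply a f) g = cinner f (blinfun_apply b g))"

text \<open>The description defining \<^const>\<open>op_adj\<close> is proper for every bounded complex-linear operator:\<close>
lemma op_adj_ex1:
  fixes a :: "'a op2"
  assumes lin: "\<And>c f. blinfun_apply a (cscale c f) = cscale c (blinfun_apply a f)"
  shows "\<exists>!b. \<forall>f g. cinner (blinfun_apply a f) g = cinner f (blinfun_apply b g)"
proof -
  have *: "\<exists>k. (\<forall>f. cinner (blinfun_apply a f) g = cinner f k) \<and> norm k \<le> norm g * norm a" for g
  proof -
    define h where "h x = cinner g (blinfun_apply a (delta x))" for x
    have fin: "(\<Sum>x\<in>F. (cmod (h x))\<^sup>2) \<le> (norm g * norm a)\<^sup>2" if "finite F" for F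
    proof -
      define v where "v = (\<Sum>x\<in>F. cscale (h x) (delta x))"
      have nv: "(norm v)\<^sup>2 = (\<Sum>x\<in>F. (cmod (h x))\<^sup>2)"
        unfolding v_def by (rule norm_sum_delta[OF that])
      have "cinner (blinfun_apply a v) g = (\<Sum>x\<in>F. h x * cnj (h x))"
        unfolding v_def h_def
        by (simp add: blinfun.sum_right lin cinner_sum_left cinner_cscale_left flip: cinner_commute)
      also have "\<dots> = of_real ((norm v)\<^sup>2)" by (simp add: nv flip: complex_norm_square)
      finally have "(norm v)\<^sup>2 = cmod (cinner (blinfun_apply a v) g)"
        by (simp only: norm_of_real abs_power2 power2_abs abs_of_nonneg zero_le_power2)
      also have "\<dots> \<le> norm (blinfun_apply a v) * norm g" by (rule norm_cinner_le)
      also have "\<dots> \<le> norm a * norm v * norm g" by (intro mult_right_mono norm_blinfun) simp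
      finally have "norm v * norm v \<le> (norm g * norm a) * norm v"
        by (simp add: power2_eq_square mult_ac)
      then have "norm v \<le> norm g * norm a"
        by (cases "norm v = 0") (auto simp: mult_le_cancel_right)
      then have "(norm v)\<^sup>2 \<le> (norm g * norm a)\<^sup>2" by (simp add: power_mono)
      then show ?thesis by (simp add: nv)
    qed
    have sm: "(\<lambda>x. (cmod (h x))\<^sup>2) summable_on UNIV"
      by (rule nonneg_bdd_above_summable_on) (auto intro!: bdd_aboveI2[of _ _ "(norm g * norm a)\<^sup>2"] fin)
    define k where "k = Abs_ell2 h"
    have k: "ell2_fun k = h" using sm by (simp add: k_def Abs_ell2_inverse)
    have "(\<Sum>\<^sub>\<infinity>x. (cmod (h x))\<^sup>2) \<le> (norm g * norm a)\<^sup>2"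
      by (rule infsum_le_finite_sums[OF sm]) (rule fin)
    then have nk: "norm k \<le> norm g * norm a"
      by (simp add: norm_ell2 k real_le_lsqrt infsum_nonneg)
    have "cinner (blinfun_apply a f) g = cinner f k" for f
    proof -
      let ?s = "\<lambda>F. \<Sum>x\<in>F. cscale (ell2_fun f x) (delta x)"
      have "cinner (blinfun_apply a (?s F)) g = cinner (?s F) k" for F
      proof -
        have "cinner (blinfun_apply a (delta x)) g = cinner (delta x) k" for x
          unfolding cinner_delta_left k h_def by (rule cinner_commute)
        then show ?thesis
          by (simp add: blinfun.sum_right lin cinner_sum_left cinner_cscale_left)
      qed
      moreover have "((\<lambda>F. cinner (blinfun_apply a (?s F)) g) \<longlongrightarrow> cinner (blinfun_apply a f) g)
          (finite_subsets_at_top UNIV)"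
        by (intro bounded_linear.tendsto[OF bounded_linear_cinner_left]
            bounded_linear.tendsto[OF blinfun.bounded_linear_right] finite_support_approx)
      moreover have "((\<lambda>F. cinner (?s F) k) \<longlongrightarrow> cinner f k) (finite_subsets_at_top UNIV)"
        by (intro bounded_linear.tendsto[OF bounded_linear_cinner_left] finite_support_approx)
      ultimately show ?thesis using tendsto_unique[OF finite_subsets_at_top_neq_bot] by auto
    qed
    then show ?thesis using nk by blast
  qed
  then obtain T where T: "\<And>f g. cinner (blinfun_apply a f) g = cinner f (T g)"
    and nT: "\<And>g. norm (T g) \<le> norm g * norm a" by metis
  have T': "ell2_fun (T g) x = cinner g (blinfun_apply a (delta x))" for g x
  proof -
    have "cnj (ell2_fun (T g) x) = cinner (delta x) (T g)" by (simp only: cinner_delta_left)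
    also have "\<dots> = cinner (blinfun_apply a (delta x)) g" by (simp only: T)
    also have "\<dots> = cnj (cinner g (blinfun_apply a (delta x)))" by (rule cinner_commute)
    finally show ?thesis by (simp only: complex_cnj_cancel_iff)
  qed
  have "bounded_linear T"
  proof
    show "T (f + g) = T f + T g" for f g
      by (simp add: ell2_fun_inject[symmetric] fun_eq_iff T' plus_ell2.rep_eq cinner_add_left)
    show "T (r *\<^sub>R f) = r *\<^sub>R T f" for r f
      by (simp add: ell2_fun_inject[symmetric] fun_eq_iff T' scaleR_ell2_def cscale.rep_eq
          cinner_cscale_left)
    show "\<exists>K. \<forall>g. norm (T g) \<le> norm g * K" using nT by blast
  qed
  then have ex: "\<forall>f g. cinner (blinfun_apply a f) g = cinner f (blinfun_apply (Blinfun T) g)"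
    by (simp add: bounded_linear_Blinfun_apply T)
  moreover have "b = Blinfun T"
    if b: "\<forall>f g. cinner (blinfun_apply a f) g = cinner f (blinfun_apply b g)" for b
  proof (rule blinfun_eqI)
    fix g
    have "ell2_fun (blinfun_apply b g) x = ell2_fun (blinfun_apply (Blinfun T) g) x" for x
    proof -
      have "cnj (ell2_fun (blinfun_apply b g) x) = cinner (delta x) (blinfun_apply b g)"
        by (simp only: cinner_delta_left)
      also have "\<dots> = cinner (blinfun_apply a (delta x)) g" using b by simp
      also have "\<dots> = cinner (delta x) (blinfun_apply (Blinfun T) g)" using ex by simp
      also have "\<dots> = cnj (ell2_fun (blinfun_apply (Blinfun T) g) x)"
        by (simp only: cinner_delta_left)
      finally show ?thesis by (simp only: complex_cnj_cancel_iff)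
    qed
    then show "blinfun_apply b g = blinfun_apply (Blinfun T) g"
      by (simp add: ell2_fun_inject[symmetric] fun_eq_iff)
  qed
  ultimately show ?thesis by blast
qed

text \<open>
  A metric space \<open>X\<close> has a carrier \<^term>\<open>mspace X\<close> inside a type \<open>'a\<close>. The algebra of bounded
  complex-linear operators on \<open>\<ell>\<^sub>2(X)\<close> is represented by its copy inside the bounded operators on
  \<open>\<ell>\<^sub>2('a) = \<ell>\<^sub>2(X) \<oplus> \<ell>\<^sub>2('a \<setminus> X)\<close>: the operators that vanish on the second summand and have
  range in the first. Norm, product, adjoint and compactness are unaffected; the identity of
  \<open>\<ell>\<^sub>2(X)\<close> becomes the projection onto \<open>\<ell>\<^sub>2(X)\<close>.
\<close>
definition bounded_ops :: "'a set \<Rightarrow> 'a op2 set" where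
  "bounded_ops S = {a.
     (\<forall>c f. blinfun_apply a (cscale c f) = cscale c (blinfun_apply a f)) \<and>
     (\<forall>f. (\<forall>x\<in>S. ell2_fun f x = 0) \<longrightarrow> blinfun_apply a f = 0) \<and>
     (\<forall>f. \<forall>y. y \<notin> S \<longrightarrow> ell2_fun (blinfun_apply a f) y = 0)}"

definition finite_propagation :: "'a metric \<Rightarrow> 'a op2 \<Rightarrow> bool" where
  "finite_propagation X a \<longleftrightarrow> (\<exists>r>0. \<forall>x\<in>mspace X. \<forall>y\<in>mspace X.
     mdist X x y > r \<longrightarrow> cinner (blinfun_apply a (delta x)) (delta y) = 0)"

definition uniform_roe :: "'a metric \<Rightarrow> 'a op2 set" where
  "uniform_roe X = closure {a \<in> bounded_ops (mspace X). finite_propagation X a}"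

definition compact_op :: "'a op2 \<Rightarrow> bool" where
  "compact_op a \<longleftrightarrow> compact (closure (blinfun_apply a ` cball 0 1))"

definition roe_embedding :: "'a metric \<Rightarrow> 'b metric \<Rightarrow> ('a op2 \<Rightarrow> 'b op2) \<Rightarrow> bool" where
  "roe_embedding X Y \<Phi> \<longleftrightarrow>
     \<Phi> ` uniform_roe X \<subseteq> uniform_roe Y \<and>
     (\<forall>a\<in>uniform_roe X. \<forall>b\<in>uniform_roe X. \<Phi> (a + b) = \<Phi> a + \<Phi> b) \<and>
     (\<forall>c. \<forall>a\<in>uniform_roe X. \<Phi> (op_cscale c a) = op_cscale c (\<Phi> a)) \<and>
     (\<forall>a\<in>uniform_roe X. \<forall>b\<in>uniform_roe X. \<Phi> (a o\<^sub>L b) = \<Phi> a o\<^sub>L \<Phi> b) \<and>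
     (\<forall>a\<in>uniform_roe X. \<Phi> (op_adj a) = op_adj (\<Phi> a)) \<and>
     inj_on \<Phi> (uniform_roe X)"

definition compact_preserving :: "'a metric \<Rightarrow> ('a op2 \<Rightarrow> 'b op2) \<Rightarrow> bool" where
  "compact_preserving X \<Phi> \<longleftrightarrow> (\<forall>a\<in>uniform_roe X. compact_op a \<longrightarrow> compact_op (\<Phi> a))"


section \<open>Large-scale properties of metric spaces\<close>

definition ulf :: "'a metric \<Rightarrow> bool" where
  "ulf X \<longleftrightarrow> (\<forall>r>0. \<exists>N. \<forall>x\<in>mspace X. finite (mball_of X x r) \<and> card (mball_of X x r) \<le> N)"

text \<open>Distances from the empty set are \<open>\<infinity>\<close>, and the empty set has diameter \<open>0\<close>.\<close>
definition set_distance :: "'a metric \<Rightarrow> 'a set \<Rightarrow> 'a set \<Rightarrow> ennreal" where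
  "set_distance X U V = (INF u\<in>U. INF v\<in>V. ennreal (mdist X u v))"

definition set_diameter :: "'a metric \<Rightarrow> 'a set \<Rightarrow> ennreal" where
  "set_diameter X U = (SUP u\<in>U. SUP v\<in>U. ennreal (mdist X u v))"

definition asydim_le :: "'a metric \<Rightarrow> nat \<Rightarrow> bool" where
  "asydim_le X n \<longleftrightarrow> (\<forall>R>0. \<exists>\<U> :: nat \<Rightarrow> 'a set set.
     (\<forall>i\<le>n. \<forall>U\<in>\<U> i. U \<subseteq> mspace X) \<and>
     mspace X = (\<Union>i\<le>n. \<Union>U\<in>\<U> i. U) \<and>
     (\<forall>i\<le>n. \<forall>U\<in>\<U> i. \<forall>V\<in>\<U> i. U \<noteq> V \<longrightarrow> set_distance X U V > ennreal R) \<and>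
     (\<forall>i\<le>n. (SUP U\<in>\<U> i. set_diameter X U) < \<infinity>))"

text \<open>\<open>\<infinity>\<close> if there is no such \<open>n\<close>, as \<^term>\<open>Inf {} = (\<infinity> :: enat)\<close>.\<close>
definition asydim :: "'a metric \<Rightarrow> enat" where
  "asydim X = Inf {enat n | n. asydim_le X n}"

text \<open>
  The quotient \<open>|A \<triangle> B| / |A \<inter> B|\<close> is infinite when \<open>A \<inter> B\<close> is empty, whereas division by zero
  yields \<open>0\<close> here; hence the explicit nonemptiness condition.
\<close>
definition property_A :: "'a metric \<Rightarrow> bool" where
  "property_A X \<longleftrightarrow> (\<forall>r>0. \<forall>\<epsilon>>0. \<exists>R>0. \<exists>A :: 'a \<Rightarrow> ('a \<times> nat) set.
     (\<forall>x\<in>mspace X. finite (A x) \<and> A x \<subseteq> mspace X \<times> UNIV \<and> (x, 1) \<in> A x) \<and>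
     (\<forall>x\<in>mspace X. \<forall>y\<in>mspace X. mdist X x y \<le> r \<longrightarrow>
        A x \<inter> A y \<noteq> {} \<and> real (card (sym_diff (A x) (A y))) / real (card (A x \<inter> A y)) < (\<epsilon>::real)) \<and>
     (\<forall>x\<in>mspace X. \<forall>(y, m)\<in>A x. \<forall>(z, n)\<in>A x. mdist X y z \<le> R))"

definition bounded_family :: "'a metric set \<Rightarrow> bool" where
  "bounded_family \<X> \<longleftrightarrow> (SUP X\<in>\<X>. set_diameter X (mspace X)) < \<infinity>"

definition separated_union_over :: "'a metric \<Rightarrow> real \<Rightarrow> 'a metric set \<Rightarrow> 'a set \<Rightarrow> bool" where
  "separated_union_over X r \<Z> S \<longleftrightarrow> (\<exists>\<U>. S = \<Union>\<U> \<and> disjoint \<U> \<and>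
     (\<forall>U\<in>\<U>. \<forall>V\<in>\<U>. U \<noteq> V \<longrightarrow> set_distance X U V > ennreal r) \<and>
     (\<forall>U\<in>\<U>. submetric X U \<in> \<Z>))"

definition decomposable_over :: "real \<Rightarrow> 'a metric set \<Rightarrow> 'a metric set \<Rightarrow> bool" where
  "decomposable_over r \<X> \<Z> \<longleftrightarrow> (\<forall>X\<in>\<X>. \<exists>X0 X1. mspace X = X0 \<union> X1 \<and>
     separated_union_over X r \<Z> X0 \<and> separated_union_over X r \<Z> X1)"

text \<open>
  Metric families are taken with members carried by subsets of one fixed type. This loses nothing
  for subspaces of a given space: decompositions only produce subspaces of the members, so all
  other members of the families \<open>\<Z>\<close> can be dropped.
\<close>
inductive FDC_family :: "'a metric set \<Rightarrow> bool" where
  bounded: "bounded_family \<X> \<Longrightarrow> FDC_family \<X>"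
| decomposition: "(\<And>r. r > 0 \<Longrightarrow> \<exists>\<Z>. decomposable_over r \<X> \<Z> \<and> FDC_family \<Z>) \<Longrightarrow> FDC_family \<X>"

definition FDC :: "'a metric \<Rightarrow> bool" where
  "FDC X \<longleftrightarrow> FDC_family {X}"

end

theory Submission
  imports Defs
begin

text \<open>
  Let \<open>q\<^sub>x\<close> be the image in the uniform Roe algebra of \<open>Y\<close> of the rank one projection of \<open>X\<close> onto
  \<open>\<delta>\<^sub>x\<close>. The idea is to find, for every \<open>x\<close>, a point \<open>f x\<close> of \<open>Y\<close> at which \<open>q\<^sub>x\<close> is not small, uniformly
  in \<open>x\<close>, and to compare \<open>X\<close> and \<open>Y\<close> along \<open>f\<close>.

  For arbitrary \<open>Y\<close> such points need not exist, since \<open>q\<^sub>x\<close> could spread its mass ever more evenly as \<open>x\<close>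
  varies. Each of the three hypotheses on \<open>Y\<close> excludes this, and they do so through one common
  consequence, metric sparsification: a finite measure keeps a fixed proportion of its mass on a union
  of uniformly bounded, far apart sets (\<open>asydim_le_sparsification\<close>, \<open>FDC_sparsification\<close>,
  \<open>property_A_sparsification\<close>). If \<open>q\<^sub>x\<close> is close to an operator of finite propagation, cutting a unit
  vector in its range into such pieces shows that \<open>q\<^sub>x\<close> is not small on one of them
  (\<open>proj_delta_lower_bound\<close>). The propagation must be bounded uniformly in \<open>x\<close>. This
  follows from the fact that all sums of partial translations, not only finite ones, have images in the
  algebra of \<open>Y\<close>, by a gliding hump argument (\<open>matrix_units_uniformly_approximable\<close>). It is here, and
  in the compactness argument of the next paragraph, that the embedding has to preserve compactness.

  The \<open>q\<^sub>x\<close> are orthogonal, so by Bessel's inequality the fibres of \<open>f\<close> have bounded cardinality. If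
  \<open>q\<^sub>x\<close> has rank at least \<open>2\<close>, then \<open>f\<close> need not be coarse, but it is so on each of finitely many
  pieces that cover \<open>X\<close> (\<open>piecewise_coarse\<close>).

  It remains to transfer the three properties along \<open>f\<close>. Preimages of bounded sets need not be bounded,
  but their cardinality is, and then so are the diameters of their components under chains of steps of
  bounded length (\<open>coarse_finite_to_one_chain_bounded\<close>). Cutting preimages into these components
  transfers each property to a piece, and each property passes to finite unions of subspaces
  (\<open>asydim_le_transfer\<close>, \<open>FDC_transfer\<close>, \<open>property_A_transfer\<close>).
\<close>


section \<open>Chains of small steps\<close>

text \<open>
  A family of bounded sets whose mutual distances exceed \<open>R\<close> is recorded by its union \<open>T\<close> alone: every
  chain of steps of length at most \<open>R\<close> in \<open>T\<close> stays in one member, so \<open>T\<close> is \<open>chain_bounded\<close>.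
  Conversely, the components of a \<open>chain_bounded\<close> set under such chains form a family of this kind.
\<close>

lemma mdist_self: "x \<in> mspace M \<Longrightarrow> mdist M x x = 0"
  by (subst mdist_zero) auto

definition chained :: "'a metric \<Rightarrow> real \<Rightarrow> 'a set \<Rightarrow> ('a \<times> 'a) set" where
  "chained M R T = {(x, y). x \<in> T \<and> y \<in> T \<and> mdist M x y \<le> R}\<^sup>*"

definition chain_bounded :: "'a metric \<Rightarrow> real \<Rightarrow> real \<Rightarrow> 'a set \<Rightarrow> bool" where
  "chain_bounded M R D T \<longleftrightarrow> (\<forall>x\<in>T. \<forall>y. (x, y) \<in> chained M R T \<longrightarrow> mdist M x y \<le> D)"

definition chain_components :: "'a metric \<Rightarrow> real \<Rightarrow> 'a set \<Rightarrow> 'a set set" where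
  "chain_components M R T = (\<lambda>x. chained M R T `` {x}) ` T"

lemma chain_boundedD:
  "chain_bounded M R D T \<Longrightarrow> x \<in> T \<Longrightarrow> (x, y) \<in> chained M R T \<Longrightarrow> mdist M x y \<le> D"
  by (auto simp: chain_bounded_def)

lemma chained_refl [simp]: "(x, x) \<in> chained M R T"
  by (simp add: chained_def)

lemma chained_step: "x \<in> T \<Longrightarrow> y \<in> T \<Longrightarrow> mdist M x y \<le> R \<Longrightarrow> (x, y) \<in> chained M R T"
  unfolding chained_def by (rule r_into_rtrancl) simp

lemma chained_trans: "(x, y) \<in> chained M R T \<Longrightarrow> (y, z) \<in> chained M R T \<Longrightarrow> (x, z) \<in> chained M R T"
  unfolding chained_def by (rule rtrancl_trans)

lemma chained_snoc:
  "(x, y) \<in> chained M R T \<Longrightarrow> y \<in> T \<Longrightarrow> z \<in> T \<Longrightarrow> mdist M y z \<le> R \<Longrightarrow> (x, z) \<in> chained M R T"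
  by (rule chained_trans[OF _ chained_step])

lemma chained_sym: "(x, y) \<in> chained M R T \<Longrightarrow> (y, x) \<in> chained M R T"
proof -
  have "sym {(x, y). x \<in> T \<and> y \<in> T \<and> mdist M x y \<le> R}"
    by (auto simp: sym_def mdist_commute)
  then show "(x, y) \<in> chained M R T \<Longrightarrow> (y, x) \<in> chained M R T"
    unfolding chained_def by (blast dest: sym_rtrancl symD)
qed

lemma chained_induct [consumes 2, case_names base step]:
  assumes "(x, y) \<in> chained M R T" "x \<in> T" "P x"
    and "\<And>y z. (x, y) \<in> chained M R T \<Longrightarrow> y \<in> T \<Longrightarrow> z \<in> T \<Longrightarrow> mdist M y z \<le> R \<Longrightarrow> P y \<Longrightarrow> P z"
  shows "P y"
  using assms(1) unfolding chained_def
  by (induction rule: rtrancl_induct) (use assms(2-4) in \<open>auto simp: chained_def\<close>)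

lemma chained_in: "(x, y) \<in> chained M R T \<Longrightarrow> x \<in> T \<Longrightarrow> y \<in> T"
  by (erule chained_induct) auto

lemma chained_mono: "T \<subseteq> T' \<Longrightarrow> chained M R T \<subseteq> chained M R T'"
  unfolding chained_def by (rule rtrancl_mono) auto

lemma chained_class_eq: "(x, y) \<in> chained M R T \<Longrightarrow> chained M R T `` {x} = chained M R T `` {y}"
  by (auto intro: chained_trans chained_sym)

lemma chained_class:
  assumes "(x, y) \<in> chained M R T" "x \<in> T"
  shows "(x, y) \<in> chained M R (chained M R T `` {x})"
  using assms
proof (induction rule: chained_induct)
  case (step y z)
  have "y \<in> chained M R T `` {x}" using step(1) by simp
  moreover have "z \<in> chained M R T `` {x}" using chained_snoc[OF step(1-4)] by simp
  ultimately show ?case by (rule chained_snoc[OF step(5) _ _ step(4)])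
qed simp

lemma chain_bounded_mono:
  assumes "chain_bounded M R D T" "S \<subseteq> T" shows "chain_bounded M R D S"
  using assms chained_mono[of S T M R] unfolding chain_bounded_def by blast

lemma chain_bounded_diameter:
  assumes "\<And>x y. x \<in> T \<Longrightarrow> y \<in> T \<Longrightarrow> mdist M x y \<le> D" shows "chain_bounded M R D T"
  unfolding chain_bounded_def by (blast intro: assms dest: chained_in)

lemma chain_bounded_separated_Union:
  assumes sep: "\<And>U V u v. U \<in> \<U> \<Longrightarrow> V \<in> \<U> \<Longrightarrow> U \<noteq> V \<Longrightarrow> u \<in> U \<Longrightarrow> v \<in> V \<Longrightarrow> mdist M u v > R"
    and bd: "\<And>U. U \<in> \<U> \<Longrightarrow> chain_bounded M R D U"
  shows "chain_bounded M R D (\<Union>\<U>)"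
  unfolding chain_bounded_def
proof (intro ballI allI impI)
  fix x y assume x: "x \<in> \<Union>\<U>" and xy: "(x, y) \<in> chained M R (\<Union>\<U>)"
  obtain U where U: "U \<in> \<U>" "x \<in> U" using x by blast
  have "y \<in> U \<and> (x, y) \<in> chained M R U"
    using xy x
  proof (induction rule: chained_induct)
    case (step y z)
    then obtain V where V: "V \<in> \<U>" "z \<in> V" by blast
    have "\<not> mdist M y z > R" using step(4) by simp
    then have "V = U" using sep[OF U(1) V(1) _ _ V(2), of y] step by blast
    then have "z \<in> U" using V(2) by simp
    then show ?case using chained_snoc[of x y M R U z] step by blast
  qed (use U in simp)
  then show "mdist M x y \<le> D" using bd[OF U(1)] U(2) by (auto simp: chain_bounded_def)
qed

text \<open>A shortest chain repeats no step, and there are at most \<open>K\<^sup>2\<close> steps between \<open>K\<close> points.\<close>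
lemma chained_card_le:
  assumes M: "T \<subseteq> mspace M" and R: "0 \<le> R" and x: "x \<in> T" and xy: "(x, y) \<in> chained M R T"
    and fin: "finite (chained M R T `` {x})" and K: "card (chained M R T `` {x}) \<le> K"
  shows "mdist M x y \<le> R * real K ^ 2"
proof -
  define C where "C = chained M R T `` {x}"
  define E where "E = {(x, y). x \<in> C \<and> y \<in> C \<and> mdist M x y \<le> R}"
  have CT: "C \<subseteq> T" using x by (auto simp: C_def dest: chained_in)
  have E: "E \<subseteq> C \<times> C" by (auto simp: E_def)
  have finC: "finite C" using fin by (simp add: C_def)
  have "finite E" by (rule finite_subset[OF E finite_cartesian_product[OF finC finC]])
  have "card E \<le> card (C \<times> C)" by (rule card_mono[OF finite_cartesian_product[OF finC finC] E])
  also have "\<dots> = card C * card C" by (rule card_cartesian_product)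
  also have "\<dots> \<le> K * K" using K unfolding C_def by (intro mult_mono) simp_all
  finally have cE: "card E \<le> K ^ 2" by (simp add: power2_eq_square)
  have "(x, y) \<in> E\<^sup>*" using chained_class[OF xy x] by (simp only: C_def[symmetric] E_def chained_def[of M R C])
  then have "(x, y) \<in> (\<Union>n\<in>{n. n \<le> card E}. E ^^ n)"
    by (simp only: rtrancl_finite_eq_relpow[OF \<open>finite E\<close>])
  then obtain n where n: "n \<le> card E" "(x, y) \<in> E ^^ n" by blast
  have xC: "x \<in> C" by (simp add: C_def)
  have *: "(x, y) \<in> E ^^ n \<Longrightarrow> y \<in> C \<and> mdist M x y \<le> R * real n" for n y
  proof (induction n arbitrary: y)
    case 0
    then show ?case using xC CT M by (auto simp: mdist_self)
  next
    case (Suc n)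
    then obtain z where z: "(x, z) \<in> E ^^ n" "(z, y) \<in> E" by (meson relpow_Suc_E)
    have "mdist M x y \<le> mdist M x z + mdist M z y"
      using Suc.IH[OF z(1)] z(2) E xC CT M by (intro mdist_triangle) blast+
    also have "\<dots> \<le> R * real n + R"
      using Suc.IH[OF z(1)] z(2) by (intro add_mono) (simp_all add: E_def)
    also have "\<dots> = R * real (Suc n)" by (simp add: algebra_simps)
    finally have "mdist M x y \<le> R * real (Suc n)" .
    moreover have "y \<in> C" using z(2) E by blast
    ultimately show ?case by blast
  qed
  have "mdist M x y \<le> R * real n" using *[OF n(2)] by blast
  also have "\<dots> \<le> R * real (K ^ 2)"
    using le_trans[OF n(1) cE] R by (intro mult_left_mono of_nat_mono)
  finally show ?thesis by (simp only: of_nat_power)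
qed

lemma Union_chain_components: "\<Union>(chain_components M R T) = T"
  by (auto simp: chain_components_def dest: chained_in)

lemma chain_components_separated:
  assumes "U \<in> chain_components M R T" "V \<in> chain_components M R T" "U \<noteq> V" "u \<in> U" "v \<in> V"
  shows "mdist M u v > R"
proof (rule ccontr)
  assume "\<not> mdist M u v > R"
  moreover obtain x y where xy: "x \<in> T" "U = chained M R T `` {x}" "y \<in> T" "V = chained M R T `` {y}"
    using assms by (auto simp: chain_components_def)
  moreover from xy assms have "u \<in> T" "v \<in> T" by (auto dest: chained_in)
  ultimately have "(u, v) \<in> chained M R T" by (intro chained_step) auto
  then have "chained M R T `` {u} = chained M R T `` {v}" by (rule chained_class_eq)
  moreover have "U = chained M R T `` {u}" "V = chained M R T `` {v}"
    using xy assms by (simp_all add: chained_class_eq)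
  ultimately show False using assms by simp
qed

lemma chain_components_diameter:
  assumes b: "chain_bounded M R D T" and U: "U \<in> chain_components M R T" "u \<in> U" "v \<in> U"
  shows "mdist M u v \<le> D"
proof -
  obtain x where x: "x \<in> T" "U = chained M R T `` {x}" using U by (auto simp: chain_components_def)
  then have "(x, u) \<in> chained M R T" "(x, v) \<in> chained M R T" using U by auto
  then have "(u, v) \<in> chained M R T" using chained_trans chained_sym by metis
  moreover have "u \<in> T" using x U by (auto dest: chained_in)
  ultimately show ?thesis using b by (auto simp: chain_bounded_def)
qed

lemma chain_components_disjoint: "disjoint (chain_components M R T)"
proof (rule disjointI)
  fix U V assume UV: "U \<in> chain_components M R T" "V \<in> chain_components M R T" "U \<noteq> V"
  then obtain x y where xy: "U = chained M R T `` {x}" "V = chained M R T `` {y}"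
    by (auto simp: chain_components_def)
  have False if "z \<in> U" "z \<in> V" for z
    using that UV(3) chained_class_eq[of x z M R T] chained_class_eq[of y z M R T] by (simp add: xy)
  then show "U \<inter> V = {}" by blast
qed

section \<open>Distances and diameters of sets\<close>

lemma set_distanceD:
  assumes "set_distance M U V > ennreal R" "u \<in> U" "v \<in> V"
  shows "mdist M u v > R"
proof -
  have "set_distance M U V \<le> ennreal (mdist M u v)"
    unfolding set_distance_def by (intro INF_lower2[OF assms(2)] INF_lower assms(3))
  then have "ennreal R < ennreal (mdist M u v)" using assms(1) by (rule less_le_trans[rotated])
  then show ?thesis by (meson ennreal_leI leI not_le)
qed

text \<open>
  The margin between \<open>R\<close> and \<open>R'\<close> is there because an infimum of numbers greater than \<open>R\<close> can be
  \<open>R\<close>. So separation by more than \<open>R\<close> is obtained from components at scale \<open>R + 1\<close>.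
\<close>
lemma set_distanceI:
  assumes "\<And>u v. u \<in> U \<Longrightarrow> v \<in> V \<Longrightarrow> mdist M u v \<ge> R'" "R < R'" "0 \<le> R"
  shows "set_distance M U V > ennreal R"
proof -
  have "ennreal R < ennreal R'" using assms by (simp add: ennreal_lessI)
  also have "\<dots> \<le> set_distance M U V"
    unfolding set_distance_def by (intro INF_greatest ennreal_leI assms(1))
  finally show ?thesis .
qed

lemma set_diameter_finiteD:
  assumes "(SUP U\<in>\<U>. set_diameter (M U) (s U)) < \<infinity>"
  shows "\<exists>D>0. \<forall>U\<in>\<U>. \<forall>u\<in>s U. \<forall>v\<in>s U. mdist (M U) u v \<le> D"
proof -
  define D where "D = (SUP U\<in>\<U>. set_diameter (M U) (s U))"
  have "mdist (M U) u v \<le> enn2real D + 1" if "U \<in> \<U>" "u \<in> s U" "v \<in> s U" for U u v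
  proof -
    have "ennreal (mdist (M U) u v) \<le> set_diameter (M U) (s U)"
      unfolding set_diameter_def by (intro SUP_upper2[OF that(2)] SUP_upper that(3))
    also have "\<dots> \<le> D" unfolding D_def by (intro SUP_upper that(1))
    also have "\<dots> = ennreal (enn2real D)" using assms by (simp add: D_def)
    finally show ?thesis by (simp add: ennreal_le_iff)
  qed
  moreover have "enn2real D + 1 > 0" by (simp add: add_nonneg_pos)
  ultimately show ?thesis by blast
qed

lemma set_diameter_finiteI:
  assumes "\<And>U u v. U \<in> \<U> \<Longrightarrow> u \<in> s U \<Longrightarrow> v \<in> s U \<Longrightarrow> mdist (M U) u v \<le> D"
  shows "(SUP U\<in>\<U>. set_diameter (M U) (s U)) < \<infinity>"
proof -
  have "(SUP U\<in>\<U>. set_diameter (M U) (s U)) \<le> ennreal D"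
    unfolding set_diameter_def by (intro SUP_least ennreal_leI assms)
  also have "\<dots> < \<infinity>" by simp
  finally show ?thesis .
qed

lemma ulf_bounded_card:
  assumes "ulf M" "0 \<le> D"
  shows "\<exists>N. \<forall>T\<subseteq>mspace M. (\<forall>x\<in>T. \<forall>y\<in>T. mdist M x y \<le> D) \<longrightarrow> finite T \<and> card T \<le> N"
proof -
  have "D + 1 > 0" using assms(2) by simp
  then obtain N where N: "\<forall>x\<in>mspace M. finite (mball_of M x (D + 1)) \<and> card (mball_of M x (D + 1)) \<le> N"
    using assms(1) unfolding ulf_def by blast
  show ?thesis
  proof (intro exI[of _ N] allI impI)
    fix T assume T: "T \<subseteq> mspace M" "\<forall>x\<in>T. \<forall>y\<in>T. mdist M x y \<le> D"
    show "finite T \<and> card T \<le> N"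
    proof (cases "T = {}")
      case False
      then obtain x where x: "x \<in> T" by blast
      have sub: "T \<subseteq> mball_of M x (D + 1)"
      proof
        fix y assume "y \<in> T"
        then have "mdist M x y \<le> D" "x \<in> mspace M" "y \<in> mspace M" using T x by auto
        then show "y \<in> mball_of M x (D + 1)" by simp
      qed
      have fin: "finite (mball_of M x (D + 1))" "card (mball_of M x (D + 1)) \<le> N" using N x T(1) by blast+
      show ?thesis using finite_subset[OF sub fin(1)] card_mono[OF fin(1) sub] fin(2) by simp
    qed simp
  qed
qed

lemma ulf_ball_card:
  assumes "ulf M" "0 \<le> D"
  shows "\<exists>N. \<forall>x\<in>mspace M. finite {y \<in> mspace M. mdist M x y \<le> D} \<and> card {y \<in> mspace M. mdist M x y \<le> D} \<le> N"
proof -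
  have D2: "0 \<le> 2 * D" using assms(2) by simp
  obtain N where N: "\<forall>T\<subseteq>mspace M. (\<forall>x\<in>T. \<forall>y\<in>T. mdist M x y \<le> 2 * D) \<longrightarrow> finite T \<and> card T \<le> N"
    using ulf_bounded_card[OF assms(1) D2] by blast
  show ?thesis
  proof (intro exI[of _ N] ballI)
    fix x assume x: "x \<in> mspace M"
    show "finite {y \<in> mspace M. mdist M x y \<le> D} \<and> card {y \<in> mspace M. mdist M x y \<le> D} \<le> N"
    proof (rule N[rule_format])
      fix y z assume yz: "y \<in> {y \<in> mspace M. mdist M x y \<le> D}" "z \<in> {y \<in> mspace M. mdist M x y \<le> D}"
      then have "mdist M y z \<le> mdist M y x + mdist M x z" using x by (intro mdist_triangle) auto
      then show "mdist M y z \<le> 2 * D" using yz by (simp add: mdist_commute)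
    qed auto
  qed
qed

section \<open>Metric sparsification\<close>

text \<open>
  The metric sparsification property of Chen, Tessera, Wang and Yu: every finite measure keeps a fixed
  proportion of its mass on a union of uniformly bounded, far apart sets.
\<close>

definition sparsifiable :: "'a metric \<Rightarrow> real \<Rightarrow> real \<Rightarrow> real \<Rightarrow> 'a set \<Rightarrow> bool" where
  "sparsifiable M R D c T \<longleftrightarrow> (\<forall>F \<mu>. finite F \<longrightarrow> F \<subseteq> T \<longrightarrow> (\<forall>x. 0 \<le> \<mu> x) \<longrightarrow>
     (\<exists>\<Omega>\<subseteq>F. chain_bounded M R D \<Omega> \<and> c * sum \<mu> F \<le> sum \<mu> \<Omega>))"

definition metric_sparsification :: "'a metric \<Rightarrow> bool" where
  "metric_sparsification M \<longleftrightarrow> (\<exists>c>0. \<forall>R>0. \<exists>D>0. sparsifiable M R D c (mspace M))"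

lemma sparsifiableD:
  fixes \<mu> :: "'a \<Rightarrow> real"
  assumes "sparsifiable M R D c T" "finite F" "F \<subseteq> T" "\<forall>x. 0 \<le> \<mu> x"
  shows "\<exists>\<Omega>\<subseteq>F. chain_bounded M R D \<Omega> \<and> c * sum \<mu> F \<le> sum \<mu> \<Omega>"
  using assms unfolding sparsifiable_def by blast

lemma chain_bounded_le: "chain_bounded M R D T \<Longrightarrow> D \<le> D' \<Longrightarrow> chain_bounded M R D' T"
  by (fastforce simp: chain_bounded_def)

subsection \<open>Finite asymptotic dimension\<close>

lemma sum_UNION_le:
  fixes f :: "'a \<Rightarrow> real"
  assumes "finite I" "\<And>i. i \<in> I \<Longrightarrow> finite (A i)" "\<And>x. 0 \<le> f x"
  shows "sum f (\<Union>i\<in>I. A i) \<le> (\<Sum>i\<in>I. sum f (A i))"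
  using assms(1,2)
proof (induction I rule: finite_induct)
  case (insert i I)
  have "sum f (A i \<union> (\<Union>i\<in>I. A i)) \<le> sum f (A i) + sum f (\<Union>i\<in>I. A i)"
    using insert assms(3) by (subst sum_Un) (auto intro!: sum_nonneg)
  then show ?case using insert by force
qed simp

lemma asydim_le_chain_bounded:
  assumes "asydim_le M n" "R > 0"
  shows "\<exists>V. \<exists>D>0. mspace M = (\<Union>i\<le>n. V i) \<and> (\<forall>i\<le>n. chain_bounded M R D (V i))"
proof -
  obtain \<U> :: "nat \<Rightarrow> 'a set set" where
    cov: "mspace M = (\<Union>i\<le>n. \<Union>U\<in>\<U> i. U)"
    and sep: "\<And>i U V. i \<le> n \<Longrightarrow> U \<in> \<U> i \<Longrightarrow> V \<in> \<U> i \<Longrightarrow> U \<noteq> V \<Longrightarrow> set_distance M U V > ennreal R"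
    and bd: "\<And>i. i \<le> n \<Longrightarrow> (SUP U\<in>\<U> i. set_diameter M U) < \<infinity>"
    using assms unfolding asydim_le_def by meson
  have "\<exists>D>0. \<forall>U\<in>\<U> i. \<forall>u\<in>U. \<forall>v\<in>U. mdist M u v \<le> D" if "i \<le> n" for i
    by (rule set_diameter_finiteD[of "\<lambda>_. M" "\<lambda>U. U" "\<U> i", OF bd[OF that]])
  then obtain D where D: "\<And>i. i \<le> n \<Longrightarrow> D i > 0"
      "\<And>i U u v. i \<le> n \<Longrightarrow> U \<in> \<U> i \<Longrightarrow> u \<in> U \<Longrightarrow> v \<in> U \<Longrightarrow> mdist M u v \<le> D i" by metis
  show ?thesis
  proof (intro exI conjI allI impI)
    show "sum D {..n} > 0" using D(1) by (intro sum_pos) auto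
    show "mspace M = (\<Union>i\<le>n. \<Union>(\<U> i))" using cov by simp
    fix i assume i: "i \<le> n"
    have "D i \<le> sum D {..n}" using i D(1) by (intro member_le_sum) (auto simp: less_imp_le)
    moreover have "chain_bounded M R (D i) (\<Union>(\<U> i))"
    proof (rule chain_bounded_separated_Union)
      fix U V u v assume "U \<in> \<U> i" "V \<in> \<U> i" "U \<noteq> V" "u \<in> U" "v \<in> V"
      then show "mdist M u v > R" using sep[OF i] set_distanceD by metis
    qed (rule chain_bounded_diameter, rule D(2)[OF i])
    ultimately show "chain_bounded M R (sum D {..n}) (\<Union>(\<U> i))" by (rule chain_bounded_le[rotated])
  qed
qed

text \<open>Among the \<open>n + 1\<close> colours of a cover one carries at least the average mass.\<close>
lemma asydim_le_sparsification:
  assumes "asydim_le M n"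
  shows "metric_sparsification M"
  unfolding metric_sparsification_def
proof (rule exI[of _ "1 / real (n + 1)"], intro conjI allI impI)
  show "0 < 1 / real (n + 1)" by simp
  fix R :: real assume "R > 0"
  obtain V D where VD: "D > 0" "mspace M = (\<Union>i\<le>n. V i)" "\<And>i. i \<le> n \<Longrightarrow> chain_bounded M R D (V i)"
    using asydim_le_chain_bounded[OF assms \<open>R > 0\<close>] by metis
  show "\<exists>D>0. sparsifiable M R D (1 / real (n + 1)) (mspace M)"
    unfolding sparsifiable_def
  proof (intro exI[of _ D] conjI allI impI VD(1))
    fix F and \<mu> :: "'a \<Rightarrow> real" assume F: "finite F" "F \<subseteq> mspace M" and \<mu>: "\<forall>x. 0 \<le> \<mu> x"
    have "\<exists>i\<le>n. sum \<mu> F / real (n + 1) \<le> sum \<mu> (F \<inter> V i)"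
    proof (rule ccontr)
      assume "\<not> ?thesis"
      then have "(\<Sum>i\<le>n. sum \<mu> (F \<inter> V i)) < (\<Sum>i\<le>n. sum \<mu> F / real (n + 1))"
        by (intro sum_strict_mono) auto
      moreover have "sum \<mu> F \<le> (\<Sum>i\<le>n. sum \<mu> (F \<inter> V i))"
      proof -
        have "sum \<mu> F = sum \<mu> (\<Union>i\<le>n. F \<inter> V i)" using F VD(2) by (intro sum.cong) auto
        also have "\<dots> \<le> (\<Sum>i\<le>n. sum \<mu> (F \<inter> V i))" using F \<mu> by (intro sum_UNION_le) auto
        finally show ?thesis .
      qed
      ultimately show False by simp
    qed
    then obtain i where i: "i \<le> n" "sum \<mu> F / real (n + 1) \<le> sum \<mu> (F \<inter> V i)" by blast
    then show "\<exists>\<Omega>\<subseteq>F. chain_bounded M R D \<Omega> \<and> 1 / real (n + 1) * sum \<mu> F \<le> sum \<mu> \<Omega>"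
      using VD(3)[OF i(1)] by (intro exI[of _ "F \<inter> V i"]) (auto intro: chain_bounded_mono)
  qed
qed

subsection \<open>Finite decomposition complexity\<close>

lemma sparsifiable_separated_Union:
  assumes R: "0 \<le> R"
    and sp: "\<And>U. U \<in> \<U> \<Longrightarrow> sparsifiable M R D c U"
    and sep: "\<And>U V u v. U \<in> \<U> \<Longrightarrow> V \<in> \<U> \<Longrightarrow> U \<noteq> V \<Longrightarrow> u \<in> U \<Longrightarrow> v \<in> V \<Longrightarrow> mdist M u v > R"
    and T: "\<Union>\<U> \<subseteq> mspace M"
  shows "sparsifiable M R D c (\<Union>\<U>)"
  unfolding sparsifiable_def
proof (intro allI impI)
  fix F and \<mu> :: "'a \<Rightarrow> real" assume F: "finite F" "F \<subseteq> \<Union>\<U>" and \<mu>: "\<forall>x. 0 \<le> \<mu> x"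
  have disj: "U = V" if "U \<in> \<U>" "V \<in> \<U>" "x \<in> U" "x \<in> V" for U V x
    using sep[OF that(1,2) _ that(3,4)] T R that(1,3) mdist_self[of x M] by fastforce
  have "\<exists>\<Omega>\<subseteq>F \<inter> U. chain_bounded M R D \<Omega> \<and> c * sum \<mu> (F \<inter> U) \<le> sum \<mu> \<Omega>" if "U \<in> \<U>" for U
  proof -
    have "finite (F \<inter> U)" "F \<inter> U \<subseteq> U" using F by auto
    then show ?thesis using sparsifiableD[OF sp[OF that] _ _ \<mu>] by blast
  qed
  then obtain W where W: "\<And>U. U \<in> \<U> \<Longrightarrow> W U \<subseteq> F \<inter> U" "\<And>U. U \<in> \<U> \<Longrightarrow> chain_bounded M R D (W U)"
      "\<And>U. U \<in> \<U> \<Longrightarrow> c * sum \<mu> (F \<inter> U) \<le> sum \<mu> (W U)" by metis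
  define \<V> where "\<V> = {U \<in> \<U>. F \<inter> U \<noteq> {}}"
  have "finite \<V>"
  proof (rule inj_on_finite[OF _ _ finite_Pow_iff[THEN iffD2, OF F(1)]])
    show "inj_on (\<lambda>U. F \<inter> U) \<V>"
      unfolding inj_on_def \<V>_def using disj by blast
  qed (auto simp: \<V>_def)
  have \<V>: "\<V> \<subseteq> \<U>" by (auto simp: \<V>_def)
  have "c * sum \<mu> F = c * sum \<mu> (\<Union>U\<in>\<V>. F \<inter> U)"
    using F(2) by (intro arg_cong[where f = "\<lambda>A. c * sum \<mu> A"]) (auto simp: \<V>_def)
  also have "sum \<mu> (\<Union>U\<in>\<V>. F \<inter> U) = (\<Sum>U\<in>\<V>. sum \<mu> (F \<inter> U))"
  proof (rule sum.UNION_disjoint)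
    show "\<forall>U\<in>\<V>. finite (F \<inter> U)" using F(1) by simp
    show "\<forall>U\<in>\<V>. \<forall>V\<in>\<V>. U \<noteq> V \<longrightarrow> (F \<inter> U) \<inter> (F \<inter> V) = {}" using disj \<V> by blast
  qed fact
  also have "c * \<dots> \<le> (\<Sum>U\<in>\<V>. sum \<mu> (W U))"
    using W(3) \<V> by (subst sum_distrib_left) (auto intro!: sum_mono)
  also have "\<dots> = sum \<mu> (\<Union>U\<in>\<V>. W U)"
  proof (rule sum.UNION_disjoint[symmetric])
    show "\<forall>U\<in>\<V>. finite (W U)"
      using W(1) F(1) \<V> by (blast intro: finite_subset[OF _ F(1)])
    show "\<forall>U\<in>\<V>. \<forall>V\<in>\<V>. U \<noteq> V \<longrightarrow> W U \<inter> W V = {}" using W(1) disj \<V> by blast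
  qed fact
  finally have "c * sum \<mu> F \<le> sum \<mu> (\<Union>U\<in>\<V>. W U)" .
  moreover have "chain_bounded M R D (\<Union>(W ` \<V>))"
  proof (rule chain_bounded_separated_Union)
    fix A B u v assume *: "A \<in> W ` \<V>" "B \<in> W ` \<V>" "A \<noteq> B" "u \<in> A" "v \<in> B"
    then obtain U V where UV: "U \<in> \<V>" "A = W U" "V \<in> \<V>" "B = W V" by auto
    then have "U \<in> \<U>" "V \<in> \<U>" using \<V> by auto
    then have "u \<in> U" "v \<in> V" "U \<noteq> V" using * W(1) UV by auto
    then show "mdist M u v > R" by (rule sep[OF \<open>U \<in> \<U>\<close> \<open>V \<in> \<U>\<close>, rotated])
  next
    fix A assume "A \<in> W ` \<V>"
    then show "chain_bounded M R D A" using W(2) \<V> by auto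
  qed
  moreover have "(\<Union>U\<in>\<V>. W U) \<subseteq> F" using W(1) \<V> by blast
  ultimately show "\<exists>\<Omega>\<subseteq>F. chain_bounded M R D \<Omega> \<and> c * sum \<mu> F \<le> sum \<mu> \<Omega>" by blast
qed

text \<open>Push the measure forward along a map that moves points by at most \<open>t\<close>.\<close>
lemma sparsifiable_neighbourhood:
  assumes sp: "sparsifiable M (R + 2 * t) D c S" and S: "S \<subseteq> mspace M" and T: "T \<subseteq> mspace M"
    and near: "\<And>x. x \<in> T \<Longrightarrow> \<exists>s\<in>S. mdist M x s \<le> t"
  shows "sparsifiable M R (D + 2 * t) c T"
  unfolding sparsifiable_def
proof (intro allI impI)
  fix F and \<mu> :: "'a \<Rightarrow> real" assume F: "finite F" "F \<subseteq> T" and \<mu>: "\<forall>x. 0 \<le> \<mu> x"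
  obtain p where p: "\<And>x. x \<in> T \<Longrightarrow> p x \<in> S" "\<And>x. x \<in> T \<Longrightarrow> mdist M x (p x) \<le> t" using near by metis
  define \<nu> where "\<nu> y = sum \<mu> {x \<in> F. p x = y}" for y
  have \<nu>: "sum \<nu> W = sum \<mu> {x \<in> F. p x \<in> W}" if "W \<subseteq> p ` F" for W
  proof -
    have "finite W" using that F(1) by (auto intro: finite_subset)
    then have "sum \<mu> {x \<in> F. p x \<in> W} = (\<Sum>y\<in>W. sum \<mu> {x \<in> {x \<in> F. p x \<in> W}. p x = y})"
      using F(1) by (intro sum.group[symmetric]) auto
    also have "\<dots> = sum \<nu> W" unfolding \<nu>_def by (intro sum.cong arg_cong[where f = "sum \<mu>"]) auto
    finally show ?thesis by simp
  qed
  have "finite (p ` F)" "p ` F \<subseteq> S" "\<forall>y. 0 \<le> \<nu> y" using F p \<mu> by (auto simp: \<nu>_def intro!: sum_nonneg)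
  then obtain W where W: "W \<subseteq> p ` F" "chain_bounded M (R + 2 * t) D W" "c * sum \<nu> (p ` F) \<le> sum \<nu> W"
    using sparsifiableD[OF sp] by meson
  define \<Omega> where "\<Omega> = {x \<in> F. p x \<in> W}"
  have "sum \<nu> (p ` F) = sum \<mu> F"
    by (subst \<nu>) (auto intro: arg_cong[where f = "sum \<mu>"])
  then have "c * sum \<mu> F \<le> sum \<mu> \<Omega>" using W(3) by (simp add: \<Omega>_def \<nu>[OF W(1)])
  moreover have "chain_bounded M R (D + 2 * t) \<Omega>"
    unfolding chain_bounded_def
  proof (intro ballI allI impI)
    fix x y assume x: "x \<in> \<Omega>" and xy: "(x, y) \<in> chained M R \<Omega>"
    have \<Omega>T: "u \<in> T \<and> u \<in> mspace M \<and> p u \<in> mspace M \<and> p u \<in> W \<and> mdist M u (p u) \<le> t" if "u \<in> \<Omega>" for u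
      using that F p S T by (auto simp: \<Omega>_def)
    have "(p x, p y) \<in> chained M (R + 2 * t) W"
      using xy x
    proof (induction rule: chained_induct)
      case (step y z)
      have "mdist M (p y) (p z) \<le> mdist M (p y) y + mdist M y (p z)"
        using \<Omega>T step by (intro mdist_triangle) auto
      also have "mdist M y (p z) \<le> mdist M y z + mdist M z (p z)"
        using \<Omega>T step by (intro mdist_triangle) auto
      finally have "mdist M (p y) (p z) \<le> R + 2 * t"
        using \<Omega>T[OF step.hyps(2)] \<Omega>T[OF step.hyps(3)] step.hyps(4) by (simp add: mdist_commute)
      then show ?case using step \<Omega>T by (intro chained_snoc[OF step.IH]) auto
    qed simp
    then have d: "mdist M (p x) (p y) \<le> D" using W(2) \<Omega>T[OF x] by (blast dest: chain_boundedD)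
    have y: "y \<in> \<Omega>" using xy x by (rule chained_in)
    have "mdist M x y \<le> mdist M x (p x) + mdist M (p x) y"
      using \<Omega>T[OF x] \<Omega>T[OF y] by (intro mdist_triangle) auto
    also have "mdist M (p x) y \<le> mdist M (p x) (p y) + mdist M (p y) y"
      using \<Omega>T[OF x] \<Omega>T[OF y] by (intro mdist_triangle) auto
    finally show "mdist M x y \<le> D + 2 * t"
      using d \<Omega>T[OF x] \<Omega>T[OF y] by (simp add: mdist_commute)
  qed
  ultimately show "\<exists>\<Omega>\<subseteq>F. chain_bounded M R (D + 2 * t) \<Omega> \<and> c * sum \<mu> F \<le> sum \<mu> \<Omega>"
    by (intro exI[of _ \<Omega>]) (auto simp: \<Omega>_def)
qed

lemma chain_bounded_scale: "chain_bounded M R D T \<Longrightarrow> R' \<le> R \<Longrightarrow> chain_bounded M R' D T"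
proof -
  assume "R' \<le> R"
  then have "chained M R' T \<subseteq> chained M R T"
    unfolding chained_def by (intro rtrancl_mono) auto
  then show "chain_bounded M R D T \<Longrightarrow> chain_bounded M R' D T"
    unfolding chain_bounded_def by blast
qed

lemma sparsifiable_mono:
  assumes "sparsifiable M R D c T" "S \<subseteq> T" "R' \<le> R"
  shows "sparsifiable M R' D c S"
  unfolding sparsifiable_def
proof (intro allI impI)
  fix F and \<mu> :: "'a \<Rightarrow> real" assume "finite F" "F \<subseteq> S" "\<forall>x. 0 \<le> \<mu> x"
  then show "\<exists>\<Omega>\<subseteq>F. chain_bounded M R' D \<Omega> \<and> c * sum \<mu> F \<le> sum \<mu> \<Omega>"
    using sparsifiableD[OF assms(1) _ subset_trans[OF _ assms(2)]] chain_bounded_scale[OF _ assms(3)] by meson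
qed

text \<open>
  The set \<open>S\<close> is surrounded by \<open>L\<close> disjoint annuli of width \<open>R\<close>. One of them carries at most
  \<open>1 / L\<close> of the mass; removing it separates a neighbourhood of \<open>S\<close> from the rest of \<open>T\<close>.
\<close>
lemma sparsifiable_Un:
  assumes S: "sparsifiable M ((2 * real L + 1) * R) D c S" and T: "sparsifiable M R D c T"
    and sub: "S \<subseteq> mspace M" "T \<subseteq> mspace M"
    and R: "R > 0" and L: "L > 0" and c: "0 \<le> c" "c \<le> 1" and D: "0 \<le> D"
  shows "sparsifiable M R (D + 2 * real L * R) (c * (1 - 1 / real L)) (S \<union> T)"
  unfolding sparsifiable_def
proof (intro allI impI)
  fix F and \<mu> :: "'a \<Rightarrow> real" assume F: "finite F" "F \<subseteq> S \<union> T" and \<mu>: "\<forall>x. 0 \<le> \<mu> x"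
  define N where "N l = {x \<in> F. \<exists>s\<in>S. mdist M x s \<le> real l * R}" for l :: nat
  have N_mono: "N l \<subseteq> N l'" if "l \<le> l'" for l l'
    using that R unfolding N_def by (fastforce intro: order_trans mult_right_mono)
  have "\<exists>l<L. sum \<mu> (N (Suc l) - N l) \<le> sum \<mu> F / real L"
  proof (rule ccontr)
    assume "\<not> ?thesis"
    then have "(\<Sum>l<L. sum \<mu> F / real L) < (\<Sum>l<L. sum \<mu> (N (Suc l) - N l))"
      using L by (intro sum_strict_mono) auto
    also have "\<dots> = sum \<mu> (\<Union>l<L. N (Suc l) - N l)"
    proof (rule sum.UNION_disjoint[symmetric])
      show "\<forall>i\<in>{..<L}. \<forall>j\<in>{..<L}. i \<noteq> j \<longrightarrow> (N (Suc i) - N i) \<inter> (N (Suc j) - N j) = {}"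
      proof (intro ballI impI)
        fix i j :: nat assume "i \<noteq> j"
        then consider "Suc i \<le> j" | "Suc j \<le> i" by linarith
        then show "(N (Suc i) - N i) \<inter> (N (Suc j) - N j) = {}" by cases (use N_mono in blast)+
      qed
    qed (use F in \<open>auto simp: N_def\<close>)
    also have "\<dots> \<le> sum \<mu> F" using F(1) \<mu> by (intro sum_mono2) (auto simp: N_def)
    finally show False using L by simp
  qed
  then obtain l where l: "l < L" "sum \<mu> (N (Suc l) - N l) \<le> sum \<mu> F / real L" by blast
  define A where "A = N l"
  define B where "B = F - N (Suc l)"
  have lR: "real l * R + R \<le> real L * R"
    using l(1) R mult_right_mono[of "real (Suc l)" "real L" R] by (simp add: algebra_simps)
  have "sparsifiable M R (D + 2 * (real l * R)) c A"
  proof (rule sparsifiable_neighbourhood[OF _ sub(1)])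
    show "sparsifiable M (R + 2 * (real l * R)) D c S"

      using l(1) R by (intro sparsifiable_mono[OF S]) (simp_all add: algebra_simps)
  qed (use F sub in \<open>auto simp: A_def N_def\<close>)
  moreover have "finite A" "finite B" "A \<subseteq> A" using F(1) by (auto simp: A_def B_def N_def)
  ultimately obtain V where V: "V \<subseteq> A" "chain_bounded M R (D + 2 * (real l * R)) V" "c * sum \<mu> A \<le> sum \<mu> V"
    using sparsifiableD[of M R _ c A A \<mu>] \<mu> by meson
  have "B \<subseteq> T"
  proof
    fix x assume x: "x \<in> B"
    have "x \<notin> S"
    proof
      assume "x \<in> S"
      then have "mdist M x x \<le> real (Suc l) * R" using sub R by (auto simp: mdist_self)
      then show False using x \<open>x \<in> S\<close> by (auto simp: B_def N_def)
    qed
    then show "x \<in> T" using x F(2) by (auto simp: B_def)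
  qed
  then obtain W where W: "W \<subseteq> B" "chain_bounded M R D W" "c * sum \<mu> B \<le> sum \<mu> W"
    using sparsifiableD[OF T \<open>finite B\<close> _ \<mu>] by meson
  have sep: "mdist M u v > R" if "u \<in> A" "v \<in> B" for u v
  proof (rule ccontr)
    assume *: "\<not> mdist M u v > R"
    obtain s where s: "s \<in> S" "mdist M u s \<le> real l * R" using \<open>u \<in> A\<close> by (auto simp: A_def N_def)
    have "mdist M v s \<le> mdist M v u + mdist M u s"
      using that F sub s by (intro mdist_triangle) (auto simp: A_def B_def N_def)
    also have "\<dots> \<le> real (Suc l) * R" using * s by (simp add: mdist_commute algebra_simps)
    finally show False using that(2) s(1) by (auto simp: B_def N_def)
  qed
  have cb: "chain_bounded M R (D + 2 * real L * R) (\<Union>{V, W})"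
  proof (rule chain_bounded_separated_Union)
    fix U U' u v assume "U \<in> {V, W}" "U' \<in> {V, W}" "U \<noteq> U'" "u \<in> U" "v \<in> U'"
    then show "mdist M u v > R" using sep V(1) W(1) mdist_commute by (metis insertE singletonD subsetD)
  next
    fix U assume "U \<in> {V, W}"
    moreover have "D \<le> D + 2 * real L * R" using R by simp
    moreover have "D + 2 * (real l * R) \<le> D + 2 * real L * R" using lR R unfolding mult.assoc by linarith
    ultimately show "chain_bounded M R (D + 2 * real L * R) U"
      using V(2) W(2) chain_bounded_le by blast
  qed
  have AB: "A \<inter> B = {}" using N_mono[of l "Suc l"] by (auto simp: A_def B_def)
  have "sum \<mu> F = sum \<mu> (A \<union> B \<union> (N (Suc l) - N l))"
    using N_mono[of l "Suc l"] by (intro arg_cong[where f = "sum \<mu>"]) (auto simp: A_def B_def N_def)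
  also have "\<dots> = sum \<mu> A + sum \<mu> B + sum \<mu> (N (Suc l) - N l)"
    using F(1) AB by (subst sum.union_disjoint, auto simp: A_def B_def N_def sum.union_disjoint)
  finally have "sum \<mu> F - sum \<mu> F / real L \<le> sum \<mu> A + sum \<mu> B" using l(2) by simp
  then have "c * (sum \<mu> F - sum \<mu> F / real L) \<le> c * (sum \<mu> A + sum \<mu> B)" using c(1) by (rule mult_left_mono)
  also have "\<dots> \<le> sum \<mu> V + sum \<mu> W" using V(3) W(3) by (simp add: distrib_left)
  also have "\<dots> = sum \<mu> (V \<union> W)"
    using V(1) W(1) AB \<open>finite A\<close> \<open>finite B\<close>
    by (intro sum.union_disjoint[symmetric]) (auto intro: finite_subset)
  finally have "c * (1 - 1 / real L) * sum \<mu> F \<le> sum \<mu> (V \<union> W)" by (simp add: algebra_simps)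
  moreover have "V \<union> W \<subseteq> F" using V(1) W(1) by (auto simp: A_def B_def N_def)
  ultimately show "\<exists>\<Omega>\<subseteq>F. chain_bounded M R (D + 2 * real L * R) \<Omega>
      \<and> c * (1 - 1 / real L) * sum \<mu> F \<le> sum \<mu> \<Omega>"
    using cb by (intro exI[of _ "V \<union> W"]) auto
qed

lemma sparsifiable_submetric: "sparsifiable (submetric M U) R D c T = sparsifiable M R D c T"
  by (simp add: sparsifiable_def chain_bounded_def chained_def)

lemma sparsifiable_weaken:
  assumes "sparsifiable M R D c T" "c' \<le> c"
  shows "sparsifiable M R D c' T"
  unfolding sparsifiable_def
proof (intro allI impI)
  fix F and \<mu> :: "'a \<Rightarrow> real" assume F: "finite F" "F \<subseteq> T" "\<forall>x. 0 \<le> \<mu> x"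
  then obtain \<Omega> where \<Omega>: "\<Omega> \<subseteq> F" "chain_bounded M R D \<Omega>" "c * sum \<mu> F \<le> sum \<mu> \<Omega>"
    using sparsifiableD[OF assms(1)] by meson
  have "c' * sum \<mu> F \<le> c * sum \<mu> F" using F(3) assms(2) by (intro mult_right_mono sum_nonneg) auto
  then have "c' * sum \<mu> F \<le> sum \<mu> \<Omega>" using \<Omega>(3) by linarith
  then show "\<exists>\<Omega>\<subseteq>F. chain_bounded M R D \<Omega> \<and> c' * sum \<mu> F \<le> sum \<mu> \<Omega>" using \<Omega>(1,2) by blast
qed

lemma separated_union_over_sparsifiable:
  assumes "separated_union_over X r \<Z> S" "S \<subseteq> mspace X" "0 \<le> r"
    and sp: "\<And>Z. Z \<in> \<Z> \<Longrightarrow> sparsifiable Z r D c (mspace Z)"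
  shows "sparsifiable X r D c S"
proof -
  obtain \<U> where \<U>: "S = \<Union>\<U>"
      "\<forall>U\<in>\<U>. \<forall>V\<in>\<U>. U \<noteq> V \<longrightarrow> set_distance X U V > ennreal r" "\<forall>U\<in>\<U>. submetric X U \<in> \<Z>"
    using assms(1) unfolding separated_union_over_def by blast
  show ?thesis
    unfolding \<U>(1)
  proof (rule sparsifiable_separated_Union[OF \<open>0 \<le> r\<close>])
    fix U assume U: "U \<in> \<U>"
    then have "sparsifiable (submetric X U) r D c (mspace (submetric X U))" using \<U>(3) sp by blast
    moreover have "mspace (submetric X U) = U" using U \<U>(1) assms(2) by auto
    ultimately show "sparsifiable X r D c U" by (simp add: sparsifiable_submetric del: mspace_submetric)
  next
    fix U V u v assume UV: "U \<in> \<U>" "V \<in> \<U>" "U \<noteq> V" "u \<in> U" "v \<in> V"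
    then have "set_distance X U V > ennreal r" using \<U>(2) by blast
    then show "mdist X u v > r" using UV(4,5) by (rule set_distanceD)
  qed (use \<U>(1) assms(2) in simp)
qed

text \<open>
  Every decomposition step costs some mass. To keep the total loss under control along an induction
  of unbounded length, the statement is proved for every proportion \<open>c < 1\<close>: a step at scale
  \<open>(2 L + 1) R\<close> loses only the fraction \<open>1 / L\<close>.
\<close>
lemma FDC_family_sparsifiable:
  assumes "FDC_family \<X>" "R > 0" "0 < c" "c < 1"
  shows "\<exists>D\<ge>0. \<forall>X\<in>\<X>. sparsifiable X R D c (mspace X)"
  using assms
proof (induction arbitrary: R c rule: FDC_family.induct)
  case (bounded \<X>)
  obtain D where D: "D > 0" "\<forall>X\<in>\<X>. \<forall>u\<in>mspace X. \<forall>v\<in>mspace X. mdist X u v \<le> D"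
    using set_diameter_finiteD[of "\<lambda>X. X" mspace \<X>] bounded.hyps unfolding bounded_family_def by blast
  have "sparsifiable X R D c (mspace X)" if X: "X \<in> \<X>" for X
    unfolding sparsifiable_def
  proof (intro allI impI)
    fix F and \<mu> :: "'a \<Rightarrow> real" assume F: "finite F" "F \<subseteq> mspace X" "\<forall>x. 0 \<le> \<mu> x"
    have "chain_bounded X R D F" using D(2) X F(2) by (intro chain_bounded_diameter) auto
    moreover have "c * sum \<mu> F \<le> sum \<mu> F"
      using F(3) bounded.prems by (intro mult_left_le_one_le sum_nonneg) auto
    ultimately show "\<exists>\<Omega>\<subseteq>F. chain_bounded X R D \<Omega> \<and> c * sum \<mu> F \<le> sum \<mu> \<Omega>" by blast
  qed
  then show ?case using D(1) by (intro exI[of _ D]) auto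
next
  case (decomposition \<X>)
  note R = \<open>R > 0\<close>
  define c' where "c' = (1 + c) / 2"
  have c': "0 < c'" "c' < 1" using decomposition.prems by (auto simp: c'_def)
  obtain L :: nat where L: "L > 0" "1 / real L \<le> (1 - c) / 2"
  proof -
    obtain n where "inverse (real (Suc n)) < (1 - c) / 2"
      using reals_Archimedean[of "(1 - c) / 2"] decomposition.prems by auto
    then show thesis using that[of "Suc n"] by (simp add: inverse_eq_divide)
  qed
  (* the inequality of the arithmetic and the geometric mean for 1 and c *)
  have "c \<le> c' * c'"
    using zero_le_power2[of "1 - c"] by (simp add: c'_def power2_eq_square field_simps)
  also have "\<dots> \<le> c' * (1 - 1 / real L)" using L(2) c' by (intro mult_left_mono) (auto simp: c'_def field_simps)
  finally have cc: "c \<le> c' * (1 - 1 / real L)" .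
  define r where "r = (2 * real L + 1) * R"
  have r: "R \<le> r" using R mult_right_mono[of 1 "2 * real L + 1" R] by (simp add: r_def)
  have r0: "0 < r" using r R by linarith
  obtain \<Z> where \<Z>: "decomposable_over r \<X> \<Z>"
      "\<And>R c. 0 < R \<Longrightarrow> 0 < c \<Longrightarrow> c < 1 \<Longrightarrow> \<exists>D\<ge>0. \<forall>X\<in>\<Z>. sparsifiable X R D c (mspace X)"
    using decomposition.IH[OF r0] by blast
  obtain D where D: "D \<ge> 0" "\<And>Z. Z \<in> \<Z> \<Longrightarrow> sparsifiable Z r D c' (mspace Z)"
    using \<Z>(2)[OF r0 c'] by blast
  have "sparsifiable X R (D + 2 * real L * R) c (mspace X)" if X: "X \<in> \<X>" for X
  proof -
    obtain X0 X1 where X01: "mspace X = X0 \<union> X1" "separated_union_over X r \<Z> X0" "separated_union_over X r \<Z> X1"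
      using \<Z>(1) X unfolding decomposable_over_def by blast
    have sub: "X0 \<subseteq> mspace X" "X1 \<subseteq> mspace X" using X01(1) by auto
    have "sparsifiable X r D c' X0"
      by (rule separated_union_over_sparsifiable[OF X01(2) sub(1) less_imp_le[OF r0] D(2)])
    moreover have "sparsifiable X r D c' X1"
      by (rule separated_union_over_sparsifiable[OF X01(3) sub(2) less_imp_le[OF r0] D(2)])
    then have "sparsifiable X R D c' X1" using r by (rule sparsifiable_mono[OF _ order_refl])
    ultimately have "sparsifiable X R (D + 2 * real L * R) (c' * (1 - 1 / real L)) (X0 \<union> X1)"
      using R L(1) c' D(1) X01(1) by (intro sparsifiable_Un) (auto simp: r_def)
    then show ?thesis unfolding X01(1) using cc by (rule sparsifiable_weaken)
  qed
  moreover have "D + 2 * real L * R \<ge> 0" using D(1) R by simp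
  ultimately show ?case by blast
qed

lemma FDC_sparsification:
  assumes "FDC M"
  shows "metric_sparsification M"
  unfolding metric_sparsification_def
proof (rule exI[of _ "1 / 2"], intro conjI allI impI)
  fix R :: real assume "R > 0"
  then obtain D where D: "D \<ge> 0" "sparsifiable M R D (1 / 2) (mspace M)"
    using FDC_family_sparsifiable[of "{M}" R "1 / 2"] assms unfolding FDC_def by auto
  have "sparsifiable M R (D + 1) (1 / 2) (mspace M)"
    unfolding sparsifiable_def
  proof (intro allI impI)
    fix F and \<mu> :: "'a \<Rightarrow> real" assume F: "finite F" "F \<subseteq> mspace M" "\<forall>x. 0 \<le> \<mu> x"
    obtain \<Omega> where "\<Omega> \<subseteq> F" "chain_bounded M R D \<Omega>" "1 / 2 * sum \<mu> F \<le> sum \<mu> \<Omega>"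
      using sparsifiableD[OF D(2) F] by meson
    then show "\<exists>\<Omega>\<subseteq>F. chain_bounded M R (D + 1) \<Omega> \<and> 1 / 2 * sum \<mu> F \<le> sum \<mu> \<Omega>"
      using chain_bounded_le[of M R D \<Omega> "D + 1"] by auto
  qed
  then show "\<exists>D>0. sparsifiable M R D (1 / 2) (mspace M)" using D(1) by (intro exI[of _ "D + 1"]) auto
qed simp

subsection \<open>Property A\<close>

text \<open>
  The sets \<open>E p = {x. p \<in> A x}\<close> are uniformly bounded and cover \<open>x\<close> exactly \<open>card (A x)\<close> times, while
  \<open>x\<close> lies in at most \<open>\<epsilon> * card (A x)\<close> of their boundaries. So on average over \<open>p\<close> the
  boundary of \<open>E p\<close> has small mass compared to \<open>E p\<close>.
\<close>
lemma property_A_small_boundary: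
  assumes A: "property_A M" and ulf: "ulf M" and R: "R > 0" and \<epsilon>: "\<epsilon> > 0"
  shows "\<exists>D>0. \<forall>F \<nu>. finite F \<longrightarrow> F \<subseteq> mspace M \<longrightarrow> (\<forall>x. 0 \<le> \<nu> x) \<longrightarrow> sum \<nu> F > 0 \<longrightarrow>
    (\<exists>E\<subseteq>F. (\<forall>x\<in>E. \<forall>y\<in>E. mdist M x y \<le> D) \<and> sum \<nu> E > (0 :: real) \<and>
       sum \<nu> {x \<in> F - E. \<exists>e\<in>E. mdist M x e \<le> R} \<le> \<epsilon> * sum \<nu> E)"
proof -
  obtain N where N: "\<forall>x\<in>mspace M. finite {y \<in> mspace M. mdist M x y \<le> R} \<and> card {y \<in> mspace M. mdist M x y \<le> R} \<le> N"
    using ulf_ball_card[OF ulf less_imp_le[OF R]] by blast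
  define \<epsilon>' where "\<epsilon>' = \<epsilon> / (real N + 1)"
  have \<epsilon>': "\<epsilon>' > 0" "real N * \<epsilon>' \<le> \<epsilon>" using \<epsilon> by (auto simp: \<epsilon>'_def field_simps)
  obtain S and A :: "'a \<Rightarrow> ('a \<times> nat) set" where S: "S > 0"
    and A: "\<forall>x\<in>mspace M. finite (A x) \<and> A x \<subseteq> mspace M \<times> UNIV \<and> (x, 1) \<in> A x"
    and AA: "\<forall>x\<in>mspace M. \<forall>y\<in>mspace M. mdist M x y \<le> R \<longrightarrow>
        A x \<inter> A y \<noteq> {} \<and> real (card (sym_diff (A x) (A y))) / real (card (A x \<inter> A y)) < \<epsilon>'"
    and AS: "\<forall>x\<in>mspace M. \<forall>(y, m)\<in>A x. \<forall>(z, n)\<in>A x. mdist M y z \<le> S"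
    using A[unfolded property_A_def, THEN spec, THEN mp, OF R, THEN spec, THEN mp, OF \<epsilon>'(1)] by blast
  have diff: "real (card (A y - A x)) \<le> \<epsilon>' * real (card (A x))"
    if "x \<in> mspace M" "y \<in> mspace M" "mdist M x y \<le> R" for x y
  proof -
    have fin: "finite (A x)" "finite (A y)" using A that by auto
    then have pos: "card (A x \<inter> A y) > 0" using AA that by (simp add: card_gt_0_iff)
    have "real (card (A y - A x)) \<le> real (card (sym_diff (A x) (A y)))"
      using fin by (intro of_nat_mono card_mono) auto
    also have "\<dots> \<le> \<epsilon>' * real (card (A x \<inter> A y))"
    proof -
      have "real (card (sym_diff (A x) (A y))) / real (card (A x \<inter> A y)) < \<epsilon>'" using AA that by blast
      then show ?thesis using pos by (simp add: pos_divide_less_eq)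
    qed
    also have "\<dots> \<le> \<epsilon>' * real (card (A x))"
      using fin \<epsilon>' by (intro mult_left_mono of_nat_mono card_mono) auto
    finally show ?thesis .
  qed
  show ?thesis
  proof (rule exI[of _ "2 * S"], intro conjI allI impI)
    fix F and \<nu> :: "'a \<Rightarrow> real"
    assume F: "finite F" "F \<subseteq> mspace M" and \<nu>: "\<forall>x. 0 \<le> \<nu> x" and pos: "sum \<nu> F > 0"
    define I where "I = (\<Union>x\<in>F. A x)"
    define E where "E p = {x \<in> F. p \<in> A x}" for p
    define B where "B p = {x \<in> F - E p. \<exists>e\<in>E p. mdist M x e \<le> R}" for p
    have finI: "finite I" using F A by (auto simp: I_def)
    have swap: "(\<Sum>p\<in>I. sum \<nu> {x \<in> F. P p x}) = (\<Sum>x\<in>F. \<nu> x * real (card {p \<in> I. P p x}))" for P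
    proof -
      have "(\<Sum>p\<in>I. sum \<nu> {x \<in> F. P p x}) = (\<Sum>x\<in>F. \<Sum>p | p \<in> I \<and> P p x. \<nu> x)"
        by (rule sum.swap_restrict[OF finI F(1)])
      then show ?thesis by (simp add: mult.commute)
    qed
    have sumE: "(\<Sum>p\<in>I. sum \<nu> (E p)) = (\<Sum>x\<in>F. \<nu> x * real (card (A x)))"
      unfolding E_def swap by (intro sum.cong arg_cong2[where f = times] arg_cong[where f = "\<lambda>A. real (card A)"])
        (auto simp: I_def)
    have "(\<Sum>p\<in>I. sum \<nu> (B p)) = (\<Sum>p\<in>I. sum \<nu> {x \<in> F. x \<in> B p})"
      by (intro sum.cong arg_cong[where f = "sum \<nu>"]) (auto simp: B_def)
    also have "\<dots> = (\<Sum>x\<in>F. \<nu> x * real (card {p \<in> I. x \<in> B p}))" by (rule swap)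
    also have "\<dots> \<le> (\<Sum>x\<in>F. \<nu> x * (\<epsilon> * real (card (A x))))"
    proof (intro sum_mono mult_left_mono)
      fix x assume x: "x \<in> F"
      define G where "G = {y \<in> F. mdist M x y \<le> R}"
      have finA: "finite (A y)" if "y \<in> F" for y using A F(2) that by auto
      have xM: "x \<in> mspace M" using x F(2) by auto
      have "card G \<le> card {y \<in> mspace M. mdist M x y \<le> R}"
        using F(2) N xM by (intro card_mono) (auto simp: G_def)
      then have cG: "card G \<le> N" using N xM by (meson le_trans)
      have "{p \<in> I. x \<in> B p} \<subseteq> (\<Union>y\<in>G. A y - A x)"
        using x by (auto simp: B_def E_def G_def)
      then have "card {p \<in> I. x \<in> B p} \<le> card (\<Union>y\<in>G. A y - A x)"
        using F(1) finA by (intro card_mono) (auto simp: G_def)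
      also have "\<dots> \<le> (\<Sum>y\<in>G. card (A y - A x))" using F(1) by (intro card_UN_le) (simp add: G_def)
      finally have "real (card {p \<in> I. x \<in> B p}) \<le> real (\<Sum>y\<in>G. card (A y - A x))" by (rule of_nat_mono)
      also have "\<dots> = (\<Sum>y\<in>G. real (card (A y - A x)))" by (rule of_nat_sum)
      also have "\<dots> \<le> (\<Sum>y\<in>G. \<epsilon>' * real (card (A x)))"
        using diff[OF xM] F(2) by (intro sum_mono) (auto simp: G_def)
      also have "\<dots> \<le> real N * \<epsilon>' * real (card (A x))"
        using cG \<epsilon>'(1) by (simp add: mult_right_mono)
      also have "\<dots> \<le> \<epsilon> * real (card (A x))" using \<epsilon>'(2) by (intro mult_right_mono) auto
      finally show "real (card {p \<in> I. x \<in> B p}) \<le> \<epsilon> * real (card (A x))" .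
    qed (use \<nu> in auto)
    also have "\<dots> = \<epsilon> * (\<Sum>p\<in>I. sum \<nu> (E p))" by (simp add: sumE sum_distrib_left mult_ac)
    finally have sumB: "(\<Sum>p\<in>I. sum \<nu> (B p)) \<le> \<epsilon> * (\<Sum>p\<in>I. sum \<nu> (E p))" .
    have "sum \<nu> F \<le> (\<Sum>x\<in>F. \<nu> x * real (card (A x)))"
    proof (intro sum_mono)
      fix x assume "x \<in> F"
      then have "finite (A x)" "(x, 1) \<in> A x" using A F(2) by auto
      then have "card (A x) > 0" using card_gt_0_iff by blast
      then have "1 \<le> real (card (A x))" by linarith
      then show "\<nu> x \<le> \<nu> x * real (card (A x))" using mult_left_mono[of 1 "real (card (A x))" "\<nu> x"] \<nu> by simp
    qed
    then have "(\<Sum>p\<in>I. sum \<nu> (E p)) > 0" using pos sumE by simp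
    moreover have E0: "sum \<nu> (E p) \<ge> 0" for p using \<nu> by (intro sum_nonneg) auto
    ultimately have "\<exists>p\<in>I. sum \<nu> (E p) > 0"
      using sum_nonpos[of I "\<lambda>p. sum \<nu> (E p)"] by (meson linorder_not_le)
    then obtain p0 where p0: "p0 \<in> I" "sum \<nu> (E p0) > 0" by blast
    have "\<exists>p\<in>I. sum \<nu> (E p) > 0 \<and> sum \<nu> (B p) \<le> \<epsilon> * sum \<nu> (E p)"
    proof (rule ccontr)
      assume neg: "\<not> ?thesis"
      have B0: "sum \<nu> (B p) \<ge> 0" for p using \<nu> by (intro sum_nonneg) auto
      have "(\<Sum>p\<in>I. \<epsilon> * sum \<nu> (E p)) < (\<Sum>p\<in>I. sum \<nu> (B p))"
      proof (rule sum_strict_mono_ex1[OF finI])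
        show "\<forall>p\<in>I. \<epsilon> * sum \<nu> (E p) \<le> sum \<nu> (B p)"
        proof
          fix p assume "p \<in> I"
          then show "\<epsilon> * sum \<nu> (E p) \<le> sum \<nu> (B p)"
            using neg E0[of p] B0[of p] by (cases "sum \<nu> (E p) = 0") (auto simp: not_le less_le)
        qed
        show "\<exists>p\<in>I. \<epsilon> * sum \<nu> (E p) < sum \<nu> (B p)" using neg p0 by (meson not_le)
      qed
      then show False using sumB by (simp add: sum_distrib_left)
    qed
    then obtain p where p: "sum \<nu> (E p) > 0" "sum \<nu> (B p) \<le> \<epsilon> * sum \<nu> (E p)" by blast
    have "mdist M x y \<le> 2 * S" if "x \<in> E p" "y \<in> E p" for x y
    proof -
      obtain z n where zn: "p = (z, n)" by (cases p)
      have x: "x \<in> mspace M" "y \<in> mspace M" "(z, n) \<in> A x" "(z, n) \<in> A y"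
        using that F(2) by (auto simp: E_def zn)
      then have "(x, 1) \<in> A x" "(y, 1) \<in> A y" "z \<in> mspace M" using A by blast+
      then have "mdist M x z \<le> S" "mdist M z y \<le> S" using AS x by blast+
      then show ?thesis using mdist_triangle[OF x(1) \<open>z \<in> mspace M\<close> x(2)] by linarith
    qed
    then show "\<exists>E\<subseteq>F. (\<forall>x\<in>E. \<forall>y\<in>E. mdist M x y \<le> 2 * S) \<and> sum \<nu> E > 0 \<and>
       sum \<nu> {x \<in> F - E. \<exists>e\<in>E. mdist M x e \<le> R} \<le> \<epsilon> * sum \<nu> E"
      using p by (intro exI[of _ "E p"]) (auto simp: B_def E_def)
  qed (use S in simp)
qed

text \<open>Greedy exhaustion: remove a set with small boundary together with its boundary, and repeat.\<close>
lemma property_A_sparsification: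
  assumes A: "property_A M" and ulf: "ulf M"
  shows "metric_sparsification M"
  unfolding metric_sparsification_def
proof (rule exI[of _ "1 / 2"], intro conjI allI impI)
  fix R :: real assume R: "R > 0"
  obtain D where D: "D > 0" and small: "\<forall>F \<nu>. finite F \<longrightarrow> F \<subseteq> mspace M \<longrightarrow> (\<forall>x. 0 \<le> \<nu> x) \<longrightarrow> sum \<nu> F > 0 \<longrightarrow>
    (\<exists>E\<subseteq>F. (\<forall>x\<in>E. \<forall>y\<in>E. mdist M x y \<le> D) \<and> sum \<nu> E > (0 :: real) \<and>
       sum \<nu> {x \<in> F - E. \<exists>e\<in>E. mdist M x e \<le> R} \<le> 1 * sum \<nu> E)"
    using property_A_small_boundary[OF A ulf R zero_less_one] by (elim exE conjE)
  have "\<exists>\<Omega>\<subseteq>F. chain_bounded M R D \<Omega> \<and> 1 / 2 * sum \<mu> F \<le> sum \<mu> \<Omega>"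
    if "finite F" "F \<subseteq> mspace M" and \<mu>: "\<forall>x. 0 \<le> \<mu> x" for F and \<mu> :: "'a \<Rightarrow> real"
    using that(1,2)
  proof (induction F rule: finite_psubset_induct)
    case (psubset F)
    show ?case
    proof (cases "sum \<mu> F > 0")
      case False
      then show ?thesis by (intro exI[of _ "{}"]) (auto simp: chain_bounded_def)
    next
      case True
      obtain E where E: "E \<subseteq> F" "\<forall>x\<in>E. \<forall>y\<in>E. mdist M x y \<le> D" "sum \<mu> E > 0"
          "sum \<mu> {x \<in> F - E. \<exists>e\<in>E. mdist M x e \<le> R} \<le> 1 * sum \<mu> E"
        using small[THEN spec, THEN spec, THEN mp, OF psubset.hyps, THEN mp, OF psubset.prems, THEN mp, OF \<mu>, THEN mp, OF True]
        by (elim exE conjE)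
      define B where "B = {x \<in> F - E. \<exists>e\<in>E. mdist M x e \<le> R}"
      have fin: "finite E" "finite B" using psubset.hyps E(1) by (auto simp: B_def intro: finite_subset)
      have "E \<noteq> {}" using E(3) by auto
      then have "F - E - B \<subset> F" using E(1) by blast
      moreover have "F - E - B \<subseteq> mspace M" using psubset.prems by auto
      ultimately obtain \<Omega> where \<Omega>: "\<Omega> \<subseteq> F - E - B" "chain_bounded M R D \<Omega>"
          "1 / 2 * sum \<mu> (F - E - B) \<le> sum \<mu> \<Omega>"
        using psubset.IH by meson
      have "sum \<mu> F = sum \<mu> (E \<union> B \<union> (F - E - B))"
        using E(1) by (intro arg_cong[where f = "sum \<mu>"]) (auto simp: B_def)
      also have "\<dots> = sum \<mu> (E \<union> B) + sum \<mu> (F - E - B)"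
        using fin psubset.hyps by (intro sum.union_disjoint) auto
      also have "sum \<mu> (E \<union> B) = sum \<mu> E + sum \<mu> B"
        using fin by (intro sum.union_disjoint) (auto simp: B_def)
      finally have "1 / 2 * sum \<mu> F \<le> sum \<mu> E + sum \<mu> \<Omega>" using E(4) \<Omega>(3) by (simp add: B_def)
      also have "\<dots> = sum \<mu> (E \<union> \<Omega>)"
        using fin \<Omega>(1) psubset.hyps by (intro sum.union_disjoint[symmetric]) (auto intro: finite_subset)
      finally have "1 / 2 * sum \<mu> F \<le> sum \<mu> (E \<union> \<Omega>)" .
      moreover have "chain_bounded M R D (\<Union>{E, \<Omega>})"
      proof (rule chain_bounded_separated_Union)
        have sep: "mdist M u v > R" if "u \<in> \<Omega>" "v \<in> E" for u v
          using that \<Omega>(1) by (force simp: B_def)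
        fix U V u v assume "U \<in> {E, \<Omega>}" "V \<in> {E, \<Omega>}" "U \<noteq> V" "u \<in> U" "v \<in> V"
        then consider "u \<in> \<Omega>" "v \<in> E" | "u \<in> E" "v \<in> \<Omega>" by auto
        then show "mdist M u v > R" by cases (use sep mdist_commute in metis)+
      next
        fix U assume "U \<in> {E, \<Omega>}"
        then show "chain_bounded M R D U" using \<Omega>(2) E(2) chain_bounded_diameter[of E M D R] by auto
      qed
      moreover have "E \<union> \<Omega> \<subseteq> F" using E(1) \<Omega>(1) by blast
      ultimately show ?thesis by (intro exI[of _ "E \<union> \<Omega>"]) auto
    qed
  qed
  then have "sparsifiable M R D (1 / 2) (mspace M)" unfolding sparsifiable_def by blast
  then show "\<exists>D>0. sparsifiable M R D (1 / 2) (mspace M)" using D by blast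
qed simp

section \<open>Coarse maps with uniformly finite fibres\<close>

definition coarse_finite_to_one :: "'a metric \<Rightarrow> 'b metric \<Rightarrow> 'a set \<Rightarrow> ('a \<Rightarrow> 'b) \<Rightarrow> bool" where
  "coarse_finite_to_one X Y S f \<longleftrightarrow> S \<subseteq> mspace X \<and> f ` S \<subseteq> mspace Y \<and>
     (\<forall>r>0. \<exists>s>0. \<forall>x\<in>S. \<forall>y\<in>S. mdist X x y \<le> r \<longrightarrow> mdist Y (f x) (f y) \<le> s) \<and>
     (\<exists>K. \<forall>z. finite {x \<in> S. f x = z} \<and> card {x \<in> S. f x = z} \<le> K)"

lemma coarse_finite_to_one_preimage_card:
  assumes f: "coarse_finite_to_one X Y S f" and ulf: "ulf Y" and D: "0 \<le> D"
  shows "\<exists>K. \<forall>T\<subseteq>mspace Y. (\<forall>u\<in>T. \<forall>v\<in>T. mdist Y u v \<le> D) \<longrightarrow>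
    finite {x \<in> S. f x \<in> T} \<and> card {x \<in> S. f x \<in> T} \<le> K"
proof -
  obtain K where K: "\<forall>z. finite {x \<in> S. f x = z} \<and> card {x \<in> S. f x = z} \<le> K"
    using f unfolding coarse_finite_to_one_def by blast
  obtain N where N: "\<forall>T\<subseteq>mspace Y. (\<forall>u\<in>T. \<forall>v\<in>T. mdist Y u v \<le> D) \<longrightarrow> finite T \<and> card T \<le> N"
    using ulf_bounded_card[OF ulf D] by blast
  show ?thesis
  proof (intro exI[of _ "N * K"] allI impI)
    fix T assume T: "T \<subseteq> mspace Y" "\<forall>u\<in>T. \<forall>v\<in>T. mdist Y u v \<le> D"
    then have fin: "finite T" "card T \<le> N" using N by blast+
    have eq: "{x \<in> S. f x \<in> T} = (\<Union>z\<in>T. {x \<in> S. f x = z})" by blast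
    have "card (\<Union>z\<in>T. {x \<in> S. f x = z}) \<le> (\<Sum>z\<in>T. card {x \<in> S. f x = z})"
      by (rule card_UN_le[OF fin(1)])
    also have "\<dots> \<le> card T * K" using K sum_bounded_above[of T "\<lambda>z. card {x \<in> S. f x = z}" K] by simp
    also have "\<dots> \<le> N * K" using fin(2) by simp
    finally show "finite {x \<in> S. f x \<in> T} \<and> card {x \<in> S. f x \<in> T} \<le> N * K"
      unfolding eq using fin(1) K by simp
  qed
qed

text \<open>
  A chain in \<open>P\<close> whose image is bounded runs inside a set of bounded cardinality. Such a chain cannot
  lead far away, although \<open>f\<close> need not be a coarse embedding.
\<close>
lemma coarse_finite_to_one_chain_bounded:
  assumes f: "coarse_finite_to_one X Y S f" and ulf: "ulf Y" and D: "0 \<le> D" and r: "0 \<le> r"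
  shows "\<exists>D'>0. \<forall>P\<subseteq>S. (\<forall>x\<in>P. \<forall>y. (x, y) \<in> chained X r P \<longrightarrow> mdist Y (f x) (f y) \<le> D)
    \<longrightarrow> chain_bounded X r D' P"
proof -
  obtain K where K: "\<forall>T\<subseteq>mspace Y. (\<forall>u\<in>T. \<forall>v\<in>T. mdist Y u v \<le> D) \<longrightarrow>
      finite {x \<in> S. f x \<in> T} \<and> card {x \<in> S. f x \<in> T} \<le> K"
    using coarse_finite_to_one_preimage_card[OF f ulf D] by blast
  have S: "S \<subseteq> mspace X" "f ` S \<subseteq> mspace Y" using f unfolding coarse_finite_to_one_def by blast+
  show ?thesis
  proof (rule exI[of _ "r * real K ^ 2 + 1"], intro conjI allI impI)
    fix P assume P: "P \<subseteq> S" and *: "\<forall>x\<in>P. \<forall>y. (x, y) \<in> chained X r P \<longrightarrow> mdist Y (f x) (f y) \<le> D"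
    show "chain_bounded X r (r * real K ^ 2 + 1) P"
      unfolding chain_bounded_def
    proof (intro ballI allI impI)
      fix x y assume x: "x \<in> P" and xy: "(x, y) \<in> chained X r P"
      define C where "C = chained X r P `` {x}"
      have CP: "C \<subseteq> P" using x by (auto simp: C_def dest: chained_in)
      have "mdist Y (f u) (f v) \<le> D" if "u \<in> C" "v \<in> C" for u v
      proof -
        have "(x, u) \<in> chained X r P" "(x, v) \<in> chained X r P" using that by (auto simp: C_def)
        then have "(u, v) \<in> chained X r P" by (blast intro: chained_trans chained_sym)
        then show ?thesis using * that CP by blast
      qed
      moreover have "f ` C \<subseteq> mspace Y" using CP P S by blast
      ultimately have fin: "finite {x \<in> S. f x \<in> f ` C}" "card {x \<in> S. f x \<in> f ` C} \<le> K" using K by blast+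
      have sub: "C \<subseteq> {x \<in> S. f x \<in> f ` C}" using CP P by blast
      have "mdist X x y \<le> r * real K ^ 2"
      proof (rule chained_card_le[OF _ r x xy])
        show "P \<subseteq> mspace X" using P S by blast
        show "finite (chained X r P `` {x})" using finite_subset[OF sub fin(1)] by (simp add: C_def)
        show "card (chained X r P `` {x}) \<le> K"
          using card_mono[OF fin(1) sub] fin(2) by (simp add: C_def)
      qed
      then show "mdist X x y \<le> r * real K ^ 2 + 1" by simp
    qed
  next
    have "0 \<le> r * real K ^ 2" using r by simp
    then show "0 < r * real K ^ 2 + 1" by linarith
  qed
qed

lemma UN_lessThan_induct:
  fixes m :: nat
  assumes "P {}" "\<And>A B. P A \<Longrightarrow> P B \<Longrightarrow> P (A \<union> B)" "\<And>i. i < m \<Longrightarrow> P (S i)"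
  shows "P (\<Union>i<m. S i)"
  using assms(3)
proof (induction m)
  case (Suc m)
  have "P ((\<Union>i<m. S i) \<union> S m)" using Suc assms(2) by simp
  then show ?case by (simp add: lessThan_Suc Un_commute)
qed (simp add: assms(1))

section \<open>Asymptotic dimension\<close>

text \<open>
  Asymptotic dimension with the members of a colour replaced by its components under \<open>R\<close>-chains.
  In this form a colour is one set, and preimages and unions need no bookkeeping of families.
\<close>
definition asydim_on_le :: "'a metric \<Rightarrow> 'a set \<Rightarrow> nat \<Rightarrow> bool" where
  "asydim_on_le X T n \<longleftrightarrow> (\<forall>R>0. \<exists>V. \<exists>D>0. T = (\<Union>i\<le>n. V i) \<and> (\<forall>i\<le>n. chain_bounded X R D (V i)))"

lemma asydim_on_leD:
  assumes "asydim_on_le X T n" "R > 0"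
  shows "\<exists>V. \<exists>D>0. T = (\<Union>i\<le>n. V i) \<and> (\<forall>i\<le>n. chain_bounded X R D (V i))"
  using assms unfolding asydim_on_le_def by blast

lemma asydim_le_of_asydim_on_le:
  assumes "asydim_on_le X (mspace X) n"
  shows "asydim_le X n"
  unfolding asydim_le_def
proof (intro allI impI)
  fix R :: real assume R: "R > 0"
  obtain V D where VD: "D > 0" "mspace X = (\<Union>i\<le>n. V i)" "\<forall>i\<le>n. chain_bounded X (R + 1) D (V i)"
    using asydim_on_leD[OF assms, of "R + 1"] R by auto
  define \<U> where "\<U> i = chain_components X (R + 1) (V i)" for i
  have Un: "\<Union>(\<U> i) = V i" for i unfolding \<U>_def by (rule Union_chain_components)
  show "\<exists>\<U> :: nat \<Rightarrow> 'a set set.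
     (\<forall>i\<le>n. \<forall>U\<in>\<U> i. U \<subseteq> mspace X) \<and>
     mspace X = (\<Union>i\<le>n. \<Union>U\<in>\<U> i. U) \<and>
     (\<forall>i\<le>n. \<forall>U\<in>\<U> i. \<forall>V\<in>\<U> i. U \<noteq> V \<longrightarrow> set_distance X U V > ennreal R) \<and>
     (\<forall>i\<le>n. (SUP U\<in>\<U> i. set_diameter X U) < \<infinity>)"
  proof (intro exI[of _ \<U>] conjI allI impI ballI)
    show "mspace X = (\<Union>i\<le>n. \<Union>U\<in>\<U> i. U)" using VD(2) Un by simp
  next
    fix i U assume "i \<le> n" "U \<in> \<U> i"
    then show "U \<subseteq> mspace X" using VD(2) Un[of i] by blast
  next
    fix i U W assume "i \<le> n" and UW: "U \<in> \<U> i" "W \<in> \<U> i" "U \<noteq> W"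
    show "set_distance X U W > ennreal R"
    proof (rule set_distanceI)
      fix u w assume "u \<in> U" "w \<in> W"
      then show "R + 1 \<le> mdist X u w"
        using chain_components_separated[OF UW[unfolded \<U>_def]] by (simp add: less_imp_le)
    qed (use R in auto)
  next
    fix i assume i: "i \<le> n"
    show "(SUP U\<in>\<U> i. set_diameter X U) < \<infinity>"
    proof (rule set_diameter_finiteI[where M = "\<lambda>_. X" and s = "\<lambda>U. U"])
      fix U u v assume "U \<in> \<U> i" "u \<in> U" "v \<in> U"
      then show "mdist X u v \<le> D"
        using VD(3) i chain_components_diameter[of X "R + 1" D "V i" U u v] unfolding \<U>_def by blast
    qed
  qed
qed

lemma asydim_on_le_preimage:
  assumes f: "coarse_finite_to_one X Y S f" and ulf: "ulf Y" and Y: "asydim_le Y n"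
  shows "asydim_on_le X S n"
  unfolding asydim_on_le_def
proof (intro allI impI)
  fix R :: real assume R: "R > 0"
  have S: "S \<subseteq> mspace X" "f ` S \<subseteq> mspace Y" using f unfolding coarse_finite_to_one_def by blast+
  obtain s where s: "s > 0" "\<forall>x\<in>S. \<forall>y\<in>S. mdist X x y \<le> R \<longrightarrow> mdist Y (f x) (f y) \<le> s"
    using f R unfolding coarse_finite_to_one_def by blast
  obtain V D where VD: "D > 0" "mspace Y = (\<Union>i\<le>n. V i)" "\<forall>i\<le>n. chain_bounded Y s D (V i)"
    using asydim_le_chain_bounded[OF Y s(1)] by blast
  obtain D' where D': "D' > 0" "\<forall>P\<subseteq>S. (\<forall>x\<in>P. \<forall>y. (x, y) \<in> chained X R P \<longrightarrow> mdist Y (f x) (f y) \<le> D)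
      \<longrightarrow> chain_bounded X R D' P"
    using coarse_finite_to_one_chain_bounded[OF f ulf less_imp_le[OF VD(1)] less_imp_le[OF R]] by blast
  define W where "W i = {x \<in> S. f x \<in> V i}" for i
  have "chain_bounded X R D' (W i)" if i: "i \<le> n" for i
  proof -
    have "mdist Y (f x) (f y) \<le> D" if x: "x \<in> W i" and xy: "(x, y) \<in> chained X R (W i)" for x y
    proof -
      have "(f x, f y) \<in> chained Y s (V i)"
        using xy x
      proof (induction rule: chained_induct)
        case (step y z)
        then show ?case using s(2) by (intro chained_snoc[OF step(5)]) (auto simp: W_def)
      qed simp
      moreover have "f x \<in> V i" using x by (simp add: W_def)
      ultimately show ?thesis using chain_boundedD[of Y s D "V i" "f x" "f y"] VD(3) i by blast
    qed
    moreover have "W i \<subseteq> S" by (auto simp: W_def)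
    ultimately show ?thesis using D'(2) by blast
  qed
  moreover have "S = (\<Union>i\<le>n. W i)" using S VD(2) by (auto simp: W_def)
  ultimately show "\<exists>V. \<exists>D>0. S = (\<Union>i\<le>n. V i) \<and> (\<forall>i\<le>n. chain_bounded X R D (V i))"
    using D'(1) by blast
qed

text \<open>
  A chain in \<open>A \<union> B\<close> visits \<open>B\<close> in a coarser chain: between two visits it stays in one component
  of \<open>A\<close>. So it is enough to choose \<open>B\<close> bounded at a scale beyond the diameters occurring in \<open>A\<close>.
\<close>
lemma chain_bounded_Un:
  assumes A: "chain_bounded X R D A" and B: "chain_bounded X (D + 2 * R) D' B"
    and sub: "A \<subseteq> mspace X" "B \<subseteq> mspace X" and pos: "0 \<le> R" "0 \<le> D" "0 \<le> D'"
  shows "chain_bounded X R (D' + 2 * (D + R)) (A \<union> B)"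
  unfolding chain_bounded_def
proof (intro ballI allI impI)
  fix x y assume x: "x \<in> A \<union> B" and xy: "(x, y) \<in> chained X R (A \<union> B)"
  have M: "A \<union> B \<subseteq> mspace X" using sub by blast
  define near where "near b y \<longleftrightarrow> y = b \<or> (\<exists>a\<in>A. mdist X b a \<le> R \<and> (a, y) \<in> chained X R A)" for b y
  have near: "mdist X b y \<le> D + R \<and> y \<in> A \<union> B" if "near b y" "b \<in> B" for b y
  proof (cases "y = b")
    case False
    then obtain a where a: "a \<in> A" "mdist X b a \<le> R" "(a, y) \<in> chained X R A"
      using \<open>near b y\<close> near_def by blast
    have y: "y \<in> A" using chained_in[OF a(3,1)] .
    have "mdist X a y \<le> D" using chain_boundedD[OF A a(1,3)] .
    moreover have "mdist X b y \<le> mdist X b a + mdist X a y"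
      using sub a(1) y that(2) by (intro mdist_triangle) auto
    ultimately show ?thesis using a(2) y by auto
  next
    case True
    have "mdist X b b = 0" using that(2) sub by (intro mdist_self) blast
    then show ?thesis using True that(2) pos by simp
  qed
  have near_self: "near b b" for b by (simp add: near_def)
  define via where "via y \<longleftrightarrow>
    (\<exists>b\<in>B. \<exists>b'\<in>B. mdist X x b \<le> D + R \<and> (b, b') \<in> chained X (D + 2 * R) B \<and> near b' y)" for y
  have viaI: "via y" if "b \<in> B" "b' \<in> B" "mdist X x b \<le> D + R" "(b, b') \<in> chained X (D + 2 * R) B" "near b' y"
    for b b' y using that unfolding via_def by blast
  have "(x \<in> A \<and> (x, y) \<in> chained X R A) \<or> via y"
    using xy x
  proof (induction rule: chained_induct)
    case base
    show ?case
    proof (cases "x \<in> A")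
      case False
      have "mdist X x x = 0" using x M by (intro mdist_self) blast
      then have "x \<in> B" "mdist X x x \<le> D + R" using False x pos by auto
      then show ?thesis using viaI[OF _ _ _ chained_refl near_self] by blast
    qed simp
  next
    case (step y z)
    from step(5) show ?case
    proof (elim disjE conjE)
      assume xA: "x \<in> A" and y: "(x, y) \<in> chained X R A"
      have yA: "y \<in> A" using chained_in[OF y xA] .
      show ?thesis
      proof (cases "z \<in> A")
        case True
        then show ?thesis using xA chained_snoc[OF y yA True step(4)] by blast
      next
        case False
        then have z: "z \<in> B" using step(3) by blast
        have "mdist X x z \<le> mdist X x y + mdist X y z"
          using sub xA yA z by (intro mdist_triangle) auto
        also have "\<dots> \<le> D + R" using chain_boundedD[OF A xA y] step(4) by (rule add_mono)
        finally show ?thesis using viaI[OF z z _ chained_refl near_self] by blast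
      qed
    next
      assume "via y"
      then obtain b b' where b: "b \<in> B" "b' \<in> B" "mdist X x b \<le> D + R"
          "(b, b') \<in> chained X (D + 2 * R) B" "near b' y"
        unfolding via_def by blast
      show ?thesis
      proof (cases "z \<in> B")
        case True
        have "mdist X b' z \<le> mdist X b' y + mdist X y z"
          using M near[OF b(5,2)] b(2) True sub by (intro mdist_triangle) auto
        also have "\<dots> \<le> D + 2 * R" using near[OF b(5,2)] step(4) by auto
        finally have "(b, z) \<in> chained X (D + 2 * R) B" by (rule chained_snoc[OF b(4,2) True])
        then show ?thesis using viaI[OF b(1) True b(3) _ near_self] by blast
      next
        case False
        then have z: "z \<in> A" using step(3) by blast
        have "near b' z"
        proof (cases "y = b'")
          case True
          then show ?thesis using z step(4) unfolding near_def by auto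
        next
          case False
          then obtain a where a: "a \<in> A" "mdist X b' a \<le> R" "(a, y) \<in> chained X R A"
            using b(5) near_def by blast
          then show ?thesis
            using chained_snoc[OF a(3) chained_in[OF a(3,1)] z step(4)] unfolding near_def by blast
        qed
        then show ?thesis using viaI[OF b(1-4)] by blast
      qed
    qed
  qed
  then show "mdist X x y \<le> D' + 2 * (D + R)"
  proof (elim disjE conjE)
    assume "x \<in> A" "(x, y) \<in> chained X R A"
    then have "mdist X x y \<le> D" using chain_boundedD[OF A] by blast
    then show ?thesis using pos by simp
  next
    assume "via y"
    then obtain b b' where b: "b \<in> B" "b' \<in> B" "mdist X x b \<le> D + R"
        "(b, b') \<in> chained X (D + 2 * R) B" "near b' y"
      unfolding via_def by blast
    have y: "mdist X b' y \<le> D + R" "y \<in> mspace X" using near[OF b(5,2)] M by auto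
    have "mdist X x y \<le> mdist X x b + mdist X b y" using M x b(1) sub y by (intro mdist_triangle) auto
    also have "mdist X b y \<le> mdist X b b' + mdist X b' y" using b sub y by (intro mdist_triangle) auto
    finally show ?thesis using b(3) y(1) chain_boundedD[OF B b(1,4)] by simp
  qed
qed

lemma asydim_on_le_Un:
  assumes S: "asydim_on_le X S n" "S \<subseteq> mspace X" and T: "asydim_on_le X T n" "T \<subseteq> mspace X"
  shows "asydim_on_le X (S \<union> T) n"
  unfolding asydim_on_le_def
proof (intro allI impI)
  fix R :: real assume R: "R > 0"
  obtain V D where V: "D > 0" "S = (\<Union>i\<le>n. V i)" "\<forall>i\<le>n. chain_bounded X R D (V i)"
    using asydim_on_leD[OF S(1) R] by blast
  have "D + 2 * R > 0" using R V(1) by simp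
  then obtain W D' where W: "D' > 0" "T = (\<Union>i\<le>n. W i)" "\<forall>i\<le>n. chain_bounded X (D + 2 * R) D' (W i)"
    using asydim_on_leD[OF T(1)] by blast
  have "chain_bounded X R (D' + 2 * (D + R)) (V i \<union> W i)" if "i \<le> n" for i
  proof (rule chain_bounded_Un)
    show "V i \<subseteq> mspace X" "W i \<subseteq> mspace X" using that V(2) W(2) S(2) T(2) by blast+
  qed (use that V W R in auto)
  moreover have "S \<union> T = (\<Union>i\<le>n. V i \<union> W i)" using V(2) W(2) by blast
  moreover have "D' + 2 * (D + R) > 0" using V W R by simp
  ultimately show "\<exists>V. \<exists>D>0. S \<union> T = (\<Union>i\<le>n. V i) \<and> (\<forall>i\<le>n. chain_bounded X R D (V i))"
    by (intro exI[of _ "\<lambda>i. V i \<union> W i"] exI[of _ "D' + 2 * (D + R)"] conjI allI impI)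
qed

lemma asydim_on_le_empty: "asydim_on_le X {} n"
  unfolding asydim_on_le_def by (auto intro!: exI[of _ "\<lambda>_. {}"] exI[of _ 1] simp: chain_bounded_def)

text \<open>Nothing relates the values of \<open>f\<close> at nearby points of different pieces, so \<open>f\<close> need not be coarse.\<close>
definition piecewise_coarse_finite_to_one :: "'a metric \<Rightarrow> 'b metric \<Rightarrow> bool" where
  "piecewise_coarse_finite_to_one X Y \<longleftrightarrow> (\<exists>(m::nat) S f. mspace X = (\<Union>i<m. S i) \<and>
     (\<forall>i<m. coarse_finite_to_one X Y (S i) f))"

lemma piecewise_induct:
  assumes "piecewise_coarse_finite_to_one X Y" "P {}"
    and Un: "\<And>A B. A \<subseteq> mspace X \<Longrightarrow> B \<subseteq> mspace X \<Longrightarrow> P A \<Longrightarrow> P B \<Longrightarrow> P (A \<union> B)"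
    and P: "\<And>S f. coarse_finite_to_one X Y S f \<Longrightarrow> P S"
  shows "P (mspace X)"
proof -
  obtain m :: nat and S f where S: "mspace X = (\<Union>i<m. S i)" "\<And>i. i < m \<Longrightarrow> coarse_finite_to_one X Y (S i) f"
    using assms(1) unfolding piecewise_coarse_finite_to_one_def by blast
  have "(\<Union>i<m. S i) \<subseteq> mspace X \<and> P (\<Union>i<m. S i)"
  proof (rule UN_lessThan_induct[where P = "\<lambda>A. A \<subseteq> mspace X \<and> P A"])
    fix i assume "i < m"
    then show "S i \<subseteq> mspace X \<and> P (S i)" using S by auto (metis P)
  qed (use assms(2) Un in auto)
  then show ?thesis using S(1) by simp
qed

lemma asydim_le_transfer:
  assumes "piecewise_coarse_finite_to_one X Y" "ulf Y" "asydim_le Y n"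
  shows "asydim_le X n"
proof (rule asydim_le_of_asydim_on_le, rule piecewise_induct[OF assms(1)])
  show "asydim_on_le X S n" if "coarse_finite_to_one X Y S f" for S f
    using asydim_on_le_preimage[OF that assms(2,3)] .
qed (auto intro: asydim_on_le_Un asydim_on_le_empty)

section \<open>Finite decomposition complexity\<close>

lemma separated_union_over_mono:
  assumes "separated_union_over X r \<Z> S" "\<Z> \<subseteq> \<W>"
  shows "separated_union_over X r \<W> S"
proof -
  obtain \<U> where \<U>: "S = \<Union>\<U>" "disjoint \<U>"
      "\<forall>U\<in>\<U>. \<forall>V\<in>\<U>. U \<noteq> V \<longrightarrow> set_distance X U V > ennreal r" "\<forall>U\<in>\<U>. submetric X U \<in> \<Z>"
    using assms(1) unfolding separated_union_over_def by (elim exE conjE)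
  have "\<forall>U\<in>\<U>. submetric X U \<in> \<W>" using \<U>(4) assms(2) by blast
  then show ?thesis
    unfolding separated_union_over_def using \<U>(1-3) by (intro exI[of _ \<U>] conjI)
qed

lemma separated_union_over_empty: "separated_union_over X r \<Z> {}"
  unfolding separated_union_over_def by (rule exI[of _ "{}"]) simp

lemma separated_union_over_single: "submetric X S \<in> \<Z> \<Longrightarrow> separated_union_over X r \<Z> S"
  unfolding separated_union_over_def by (rule exI[of _ "{S}"]) simp

lemma decomposable_over_self: "decomposable_over r \<X> \<X>"
  unfolding decomposable_over_def
proof
  fix X assume "X \<in> \<X>"
  then have "separated_union_over X r \<X> (mspace X)" by (intro separated_union_over_single) simp
  then show "\<exists>X0 X1. mspace X = X0 \<union> X1 \<and> separated_union_over X r \<X> X0 \<and> separated_union_over X r \<X> X1"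
    by (intro exI[of _ "mspace X"] exI[of _ "{}"]) (simp add: separated_union_over_empty)
qed

lemma decomposable_over_mono:
  assumes "decomposable_over r \<X> \<Z>" "\<Z> \<subseteq> \<W>" "X \<in> \<X>"
  shows "\<exists>X0 X1. mspace X = X0 \<union> X1 \<and> separated_union_over X r \<W> X0 \<and> separated_union_over X r \<W> X1"
proof -
  obtain X0 X1 where "mspace X = X0 \<union> X1" "separated_union_over X r \<Z> X0" "separated_union_over X r \<Z> X1"
    using assms(1,3) unfolding decomposable_over_def by (elim ballE exE conjE) auto
  then show ?thesis
    using separated_union_over_mono[OF _ assms(2)] by (intro exI[of _ X0] exI[of _ X1] conjI)
qed

lemma decomposable_over_Un:
  assumes "decomposable_over r \<X> \<Z>" "decomposable_over r \<Y> \<W>"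
  shows "decomposable_over r (\<X> \<union> \<Y>) (\<Z> \<union> \<W>)"
  unfolding decomposable_over_def
proof
  fix X assume "X \<in> \<X> \<union> \<Y>"
  then show "\<exists>X0 X1. mspace X = X0 \<union> X1 \<and> separated_union_over X r (\<Z> \<union> \<W>) X0 \<and> separated_union_over X r (\<Z> \<union> \<W>) X1"
    using decomposable_over_mono[OF assms(1) Un_upper1] decomposable_over_mono[OF assms(2) Un_upper2]
    by (elim UnE)
qed

lemma bounded_family_Un: "bounded_family \<X> \<Longrightarrow> bounded_family \<Y> \<Longrightarrow> bounded_family (\<X> \<union> \<Y>)"
  by (simp add: bounded_family_def SUP_union sup_max)

text \<open>Decompose one family while the other one, decomposed trivially over itself, waits.\<close>
lemma FDC_family_Un:
  assumes "FDC_family \<X>" "FDC_family \<Y>"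
  shows "FDC_family (\<X> \<union> \<Y>)"
  using assms(1)
proof induction
  case (bounded \<X>)
  show ?case
    using assms(2)
  proof induction
    case (bounded \<Y>)
    then show ?case using \<open>bounded_family \<X>\<close> by (intro FDC_family.bounded bounded_family_Un)
  next
    case (decomposition \<Y>)
    show ?case
    proof (rule FDC_family.decomposition)
      fix r :: real assume "r > 0"
      then obtain \<Z> where "decomposable_over r \<Y> \<Z>" "FDC_family (\<X> \<union> \<Z>)"
        using decomposition.IH by blast
      then show "\<exists>\<Z>. decomposable_over r (\<X> \<union> \<Y>) \<Z> \<and> FDC_family \<Z>"
        using decomposable_over_Un[OF decomposable_over_self] by blast
    qed
  qed
next
  case (decomposition \<X>)
  show ?case
  proof (rule FDC_family.decomposition)
    fix r :: real assume "r > 0"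
    then obtain \<Z> where "decomposable_over r \<X> \<Z>" "FDC_family (\<Z> \<union> \<Y>)"
      using decomposition.IH by blast
    then show "\<exists>\<Z>. decomposable_over r (\<X> \<union> \<Y>) \<Z> \<and> FDC_family \<Z>"
      using decomposable_over_Un[OF _ decomposable_over_self] by blast
  qed
qed

lemma FDC_submetric_Un:
  assumes "S \<subseteq> mspace X" "T \<subseteq> mspace X" "FDC (submetric X S)" "FDC (submetric X T)"
  shows "FDC (submetric X (S \<union> T))"
  unfolding FDC_def
proof (rule FDC_family.decomposition)
  fix r :: real
  let ?Z = "{submetric X S} \<union> {submetric X T}"
  have "decomposable_over r {submetric X (S \<union> T)} ?Z"
    unfolding decomposable_over_def
  proof
    fix M assume "M \<in> {submetric X (S \<union> T)}"
    then have M: "M = submetric X (S \<union> T)" by simp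
    have "(S \<union> T) \<inter> S = S" "(S \<union> T) \<inter> T = T" by auto
    then have "separated_union_over M r ?Z S" "separated_union_over M r ?Z T"
      unfolding M by (auto intro!: separated_union_over_single)
    moreover have "mspace M = S \<union> T" using assms(1,2) by (auto simp: M)
    ultimately show "\<exists>X0 X1. mspace M = X0 \<union> X1 \<and> separated_union_over M r ?Z X0 \<and> separated_union_over M r ?Z X1"
      by blast
  qed
  moreover have "FDC_family ?Z" using assms(3,4) unfolding FDC_def by (rule FDC_family_Un)
  ultimately show "\<exists>\<Z>. decomposable_over r {submetric X (S \<union> T)} \<Z> \<and> FDC_family \<Z>" by blast
qed

definition preimage_family ::
    "'a metric \<Rightarrow> 'b metric \<Rightarrow> 'a set \<Rightarrow> ('a \<Rightarrow> 'b) \<Rightarrow> 'b metric set \<Rightarrow> 'a metric set" where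
  "preimage_family X Y S f \<Z> = {submetric X (S \<inter> f -` T) | T. T \<subseteq> mspace Y \<and> submetric Y T \<in> \<Z>}"

lemma separated_union_over_preimage:
  assumes S: "S \<subseteq> mspace X" "f ` S \<subseteq> mspace Y" and T: "T \<subseteq> mspace Y" "T0 \<subseteq> T"
    and s: "\<forall>x\<in>S. \<forall>y\<in>S. mdist X x y \<le> r + 1 \<longrightarrow> mdist Y (f x) (f y) \<le> s" and r: "0 \<le> r"
    and sep: "separated_union_over (submetric Y T) s \<W> T0"
  shows "separated_union_over (submetric X (S \<inter> f -` T)) r (preimage_family X Y S f \<W>) (S \<inter> f -` T0)"
proof -
  obtain \<U> where \<U>: "T0 = \<Union>\<U>" "disjoint \<U>"
      "\<forall>U\<in>\<U>. \<forall>V\<in>\<U>. U \<noteq> V \<longrightarrow> set_distance (submetric Y T) U V > ennreal s"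
      "\<forall>U\<in>\<U>. submetric (submetric Y T) U \<in> \<W>"
    using sep unfolding separated_union_over_def by blast
  define pre where "pre U = S \<inter> f -` U" for U
  show ?thesis
    unfolding separated_union_over_def
  proof (intro exI[of _ "pre ` \<U>"] conjI ballI impI)
    show "S \<inter> f -` T0 = \<Union> (pre ` \<U>)" by (auto simp: \<U>(1) pre_def)
    show "disjoint (pre ` \<U>)"
    proof (rule disjointI)
      fix A B assume "A \<in> pre ` \<U>" "B \<in> pre ` \<U>" "A \<noteq> B"
      then obtain U V where UV: "U \<in> \<U>" "V \<in> \<U>" "U \<noteq> V" "A = pre U" "B = pre V" by auto
      then have "U \<inter> V = {}" using \<U>(2) by (simp add: disjointD)
      then show "A \<inter> B = {}" unfolding UV(4,5) pre_def by blast
    qed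
  next
    fix A B assume "A \<in> pre ` \<U>" "B \<in> pre ` \<U>" "A \<noteq> B"
    then obtain U V where UV: "U \<in> \<U>" "V \<in> \<U>" "U \<noteq> V" "A = pre U" "B = pre V" by auto
    show "set_distance (submetric X (S \<inter> f -` T)) A B > ennreal r"
    proof (rule set_distanceI)
      fix a b assume ab: "a \<in> A" "b \<in> B"
      have sd: "set_distance (submetric Y T) U V > ennreal s" using \<U>(3) UV(1-3) by blast
      have "mdist (submetric Y T) (f a) (f b) > s"
        using ab by (intro set_distanceD[OF sd]) (auto simp: UV pre_def)
      then have "\<not> mdist X a b \<le> r + 1" using s ab by (force simp: UV pre_def)
      then show "r + 1 \<le> mdist (submetric X (S \<inter> f -` T)) a b" by simp
    qed (use r in auto)
  next
    fix A assume "A \<in> pre ` \<U>"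
    then obtain U where U: "U \<in> \<U>" "A = pre U" by auto
    then have "U \<subseteq> T" using \<U>(1) T(2) by auto
    then have "T \<inter> U = U" "S \<inter> f -` T \<inter> A = S \<inter> f -` U" by (auto simp: U(2) pre_def)
    moreover have "submetric Y U \<in> \<W>" using \<U>(4) U(1) \<open>T \<inter> U = U\<close> by force
    ultimately show "submetric (submetric X (S \<inter> f -` T)) A \<in> preimage_family X Y S f \<W>"
      using subset_trans[OF \<open>U \<subseteq> T\<close> T(1)] unfolding preimage_family_def submetric_submetric
      by (intro CollectI exI[of _ U]) simp
  qed
qed

text \<open>
  Decompositions pull back along \<open>f\<close> at adjusted scales. The preimages of a bounded family need not
  be bounded; but for every \<open>r\<close> their components under chains are, so one more decomposition
  step finishes the proof.
\<close>
lemma FDC_family_preimage: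
  assumes f: "coarse_finite_to_one X Y S f" and ulf: "ulf Y" and Z: "FDC_family \<Z>"
  shows "FDC_family (preimage_family X Y S f \<Z>)"
  using Z
proof induction
  case (bounded \<Z>)
  have S: "S \<subseteq> mspace X" "f ` S \<subseteq> mspace Y" using f unfolding coarse_finite_to_one_def by blast+
  obtain D where D: "D > 0" "\<forall>Z\<in>\<Z>. \<forall>u\<in>mspace Z. \<forall>v\<in>mspace Z. mdist Z u v \<le> D"
    using set_diameter_finiteD[of "\<lambda>Z. Z" mspace \<Z>] bounded unfolding bounded_family_def by blast
  show ?case
  proof (rule FDC_family.decomposition)
    fix r :: real assume "r > 0"
    then have r: "0 \<le> r" "0 \<le> r + 1" by auto
    obtain D' where D': "D' > 0" "\<forall>P\<subseteq>S. (\<forall>x\<in>P. \<forall>y. (x, y) \<in> chained X (r + 1) P \<longrightarrow> mdist Y (f x) (f y) \<le> D)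
        \<longrightarrow> chain_bounded X (r + 1) D' P"
      using coarse_finite_to_one_chain_bounded[OF f ulf less_imp_le[OF D(1)] r(2)] by blast
    define \<W> where "\<W> = {submetric X C | C. \<forall>u\<in>C. \<forall>v\<in>C. mdist X u v \<le> D'}"
    have "decomposable_over r (preimage_family X Y S f \<Z>) \<W>"
      unfolding decomposable_over_def
    proof
      fix M assume "M \<in> preimage_family X Y S f \<Z>"
      then obtain T where T: "M = submetric X (S \<inter> f -` T)" "T \<subseteq> mspace Y" "submetric Y T \<in> \<Z>"
        unfolding preimage_family_def by blast
      define P where "P = S \<inter> f -` T"
      have Tb: "mdist Y u v \<le> D" if "u \<in> T" "v \<in> T" for u v
        using D(2)[THEN bspec, OF T(3)] that T(2) by auto
      have PS: "P \<subseteq> S" by (auto simp: P_def)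
      have "mdist Y (f x) (f y) \<le> D" if "x \<in> P" "(x, y) \<in> chained X (r + 1) P" for x y
        using chained_in[OF that(2,1)] that(1) by (intro Tb) (auto simp: P_def)
      then have "chain_bounded X (r + 1) D' P" using D'(2) PS by blast
      then have cb: "\<And>U u v. U \<in> chain_components X (r + 1) P \<Longrightarrow> u \<in> U \<Longrightarrow> v \<in> U \<Longrightarrow> mdist X u v \<le> D'"
        by (rule chain_components_diameter)
      have "separated_union_over M r \<W> P"
        unfolding separated_union_over_def
      proof (intro exI[of _ "chain_components X (r + 1) P"] conjI ballI impI)
        show "P = \<Union> (chain_components X (r + 1) P)" by (rule Union_chain_components[symmetric])
        show "disjoint (chain_components X (r + 1) P)" by (rule chain_components_disjoint)
      next
        fix U V assume UV: "U \<in> chain_components X (r + 1) P" "V \<in> chain_components X (r + 1) P" "U \<noteq> V"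
        show "set_distance M U V > ennreal r"
        proof (rule set_distanceI)
          fix u v assume "u \<in> U" "v \<in> V"
          then show "r + 1 \<le> mdist M u v"
            using chain_components_separated[OF UV] by (simp add: T(1) less_imp_le)
        qed (use r in auto)
      next
        fix U assume U: "U \<in> chain_components X (r + 1) P"
        then have "U \<subseteq> P" using Union_chain_components[of X "r + 1" P] by blast
        then have "submetric M U = submetric X U" unfolding T(1) P_def by (simp add: Int_absorb1)
        then show "submetric M U \<in> \<W>" using cb[OF U] unfolding \<W>_def by blast
      qed
      moreover have "mspace M = P \<union> {}" using S by (auto simp: T(1) P_def)
      ultimately show "\<exists>X0 X1. mspace M = X0 \<union> X1 \<and> separated_union_over M r \<W> X0 \<and> separated_union_over M r \<W> X1"
        using separated_union_over_empty by blast
    qed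
    moreover have "bounded_family \<W>"
      unfolding bounded_family_def by (rule set_diameter_finiteI[where D = D']) (auto simp: \<W>_def)
    ultimately show "\<exists>\<W>. decomposable_over r (preimage_family X Y S f \<Z>) \<W> \<and> FDC_family \<W>"
      using FDC_family.bounded by blast
  qed
next
  case (decomposition \<Z>)
  have S: "S \<subseteq> mspace X" "f ` S \<subseteq> mspace Y" using f unfolding coarse_finite_to_one_def by blast+
  show ?case
  proof (rule FDC_family.decomposition)
    fix r :: real assume r: "r > 0"
    then have "r + 1 > 0" by simp
    then obtain s where s: "s > 0" "\<forall>x\<in>S. \<forall>y\<in>S. mdist X x y \<le> r + 1 \<longrightarrow> mdist Y (f x) (f y) \<le> s"
      using f unfolding coarse_finite_to_one_def by blast
    obtain \<W> where \<W>: "decomposable_over s \<Z> \<W>" "FDC_family (preimage_family X Y S f \<W>)"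
      using decomposition.IH[OF s(1)] by blast
    have "decomposable_over r (preimage_family X Y S f \<Z>) (preimage_family X Y S f \<W>)"
      unfolding decomposable_over_def
    proof
      fix M assume "M \<in> preimage_family X Y S f \<Z>"
      then obtain T where T: "M = submetric X (S \<inter> f -` T)" "T \<subseteq> mspace Y" "submetric Y T \<in> \<Z>"
        unfolding preimage_family_def by blast
      obtain T0 T1 where T01: "mspace (submetric Y T) = T0 \<union> T1"
          "separated_union_over (submetric Y T) s \<W> T0" "separated_union_over (submetric Y T) s \<W> T1"
        using \<W>(1) T(3) unfolding decomposable_over_def by blast
      have TT: "T = T0 \<union> T1" using T01(1) T(2) by auto
      then have "T0 \<subseteq> T" "T1 \<subseteq> T" by auto
      then have "separated_union_over M r (preimage_family X Y S f \<W>) (S \<inter> f -` T0)"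
          "separated_union_over M r (preimage_family X Y S f \<W>) (S \<inter> f -` T1)"
        unfolding T(1) using separated_union_over_preimage[OF S T(2) _ s(2) less_imp_le[OF r]] T01 by blast+
      moreover have "mspace M = (S \<inter> f -` T0) \<union> (S \<inter> f -` T1)" using S TT by (auto simp: T(1))
      ultimately show "\<exists>X0 X1. mspace M = X0 \<union> X1 \<and> separated_union_over M r (preimage_family X Y S f \<W>) X0
          \<and> separated_union_over M r (preimage_family X Y S f \<W>) X1" by blast
    qed
    then show "\<exists>\<W>. decomposable_over r (preimage_family X Y S f \<Z>) \<W> \<and> FDC_family \<W>" using \<W>(2) by blast
  qed
qed

lemma FDC_transfer:
  assumes pw: "piecewise_coarse_finite_to_one X Y" and ulf: "ulf Y" and Y: "FDC Y"
  shows "FDC X"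
proof -
  have "FDC (submetric X (mspace X))"
  proof (rule piecewise_induct[OF pw, where P = "\<lambda>S. FDC (submetric X S)"])
    have "bounded_family {submetric X {}}"
      unfolding bounded_family_def by (rule set_diameter_finiteI[where D = 0]) auto
    then show "FDC (submetric X {})" unfolding FDC_def by (rule FDC_family.bounded)
  next
    fix S f assume f: "coarse_finite_to_one X Y S f"
    then have S: "f ` S \<subseteq> mspace Y" unfolding coarse_finite_to_one_def by blast
    have S_pre: "S \<inter> f -` mspace Y = S" using S by auto
    have "preimage_family X Y S f {Y} = {submetric X S}"
    proof (intro equalityI subsetI)
      fix M assume "M \<in> preimage_family X Y S f {Y}"
      then obtain T where T: "M = submetric X (S \<inter> f -` T)" "T \<subseteq> mspace Y" "submetric Y T = Y"
        unfolding preimage_family_def by blast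
      have "T = mspace Y" using T(2) mspace_submetric[of Y T] unfolding T(3) by blast
      then show "M \<in> {submetric X S}" using T(1) S_pre by simp
    next
      fix M assume "M \<in> {submetric X S}"
      then have "M = submetric X (S \<inter> f -` mspace Y)" using S_pre by simp
      moreover have "submetric Y (mspace Y) \<in> {Y}" by simp
      ultimately show "M \<in> preimage_family X Y S f {Y}"
        unfolding preimage_family_def by blast
    qed
    then show "FDC (submetric X S)"
      using FDC_family_preimage[OF f ulf, of "{Y}"] Y by (simp add: FDC_def)
  qed (rule FDC_submetric_Un)
  then show ?thesis by simp
qed

section \<open>Property A\<close>

definition density_at :: "'a metric \<Rightarrow> real \<Rightarrow> 'a \<Rightarrow> 'a set \<Rightarrow> ('a \<Rightarrow> real) \<Rightarrow> bool" where
  "density_at X D x W h \<longleftrightarrow> finite W \<and> W \<subseteq> mspace X \<and> (\<forall>z\<in>W. mdist X x z \<le> D) \<and> (\<forall>z. 0 \<le> h z) \<and>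
     (\<forall>z. z \<notin> W \<longrightarrow> h z = 0) \<and> sum h W = 1"

definition l1_close :: "real \<Rightarrow> ('a \<Rightarrow> real) \<Rightarrow> ('a \<Rightarrow> real) \<Rightarrow> bool" where
  "l1_close \<epsilon> g h \<longleftrightarrow> (\<forall>F. finite F \<longrightarrow> (\<Sum>z\<in>F. \<bar>g z - h z\<bar>) \<le> \<epsilon>)"

text \<open>
  Property A in terms of probability densities in place of finite sets. Densities, unlike sets, can be
  interpolated, which is what the union of two subspaces requires.
\<close>
definition almost_invariant_densities :: "'a metric \<Rightarrow> 'a set \<Rightarrow> bool" where
  "almost_invariant_densities X T \<longleftrightarrow> (\<forall>r>0. \<forall>\<epsilon>>0. \<exists>D>0. \<exists>(W :: 'a \<Rightarrow> 'a set) (h :: 'a \<Rightarrow> 'a \<Rightarrow> real).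
     (\<forall>x\<in>T. density_at X D x (W x) (h x)) \<and>
     (\<forall>x\<in>T. \<forall>y\<in>T. mdist X x y \<le> r \<longrightarrow> l1_close \<epsilon> (h x) (h y)))"

lemma almost_invariant_densitiesD:
  assumes "almost_invariant_densities X T" "r > 0" "\<epsilon> > 0"
  shows "\<exists>D>0. \<exists>(W :: 'a \<Rightarrow> 'a set) (h :: 'a \<Rightarrow> 'a \<Rightarrow> real).
     (\<forall>x\<in>T. density_at X D x (W x) (h x)) \<and>
     (\<forall>x\<in>T. \<forall>y\<in>T. mdist X x y \<le> r \<longrightarrow> l1_close \<epsilon> (h x) (h y))"
  using assms(1)[unfolded almost_invariant_densities_def, THEN spec, THEN mp, OF assms(2), THEN spec, THEN mp, OF assms(3)] .

lemma sum_card_slices: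
  assumes "finite C" "finite F"
  shows "(\<Sum>z\<in>F. card {n. (z, n) \<in> C}) \<le> card C"
    and "fst ` C \<subseteq> F \<Longrightarrow> (\<Sum>z\<in>F. card {n. (z, n) \<in> C}) = card C"
proof -
  have fin: "finite {n. (z, n) \<in> C}" for z
    by (rule finite_subset[of _ "snd ` C"]) (use assms(1) in force)+
  have eq: "(\<Sum>z\<in>F. card {n. (z, n) \<in> C}) = card (Sigma F (\<lambda>z. {n. (z, n) \<in> C}))"
    using assms(2) fin by (subst card_SigmaI) auto
  show "(\<Sum>z\<in>F. card {n. (z, n) \<in> C}) \<le> card C"
    unfolding eq using assms(1) by (intro card_mono) auto
  show "fst ` C \<subseteq> F \<Longrightarrow> (\<Sum>z\<in>F. card {n. (z, n) \<in> C}) = card C"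
    unfolding eq by (intro arg_cong[where f = card]) force
qed

text \<open>Normalise the set above every point; the normalising factors of neighbours almost agree.\<close>
lemma property_A_densities:
  assumes A: "property_A X"
  shows "almost_invariant_densities X (mspace X)"
  unfolding almost_invariant_densities_def
proof (intro allI impI)
  fix r \<epsilon> :: real assume r: "r > 0" and \<epsilon>: "\<epsilon> > 0"
  then have \<epsilon>2: "\<epsilon> / 2 > 0" by simp
  obtain D and A :: "'a \<Rightarrow> ('a \<times> nat) set" where D: "D > 0"
    and A: "\<forall>x\<in>mspace X. finite (A x) \<and> A x \<subseteq> mspace X \<times> UNIV \<and> (x, 1) \<in> A x"
    and AA: "\<forall>x\<in>mspace X. \<forall>y\<in>mspace X. mdist X x y \<le> r \<longrightarrow>
        A x \<inter> A y \<noteq> {} \<and> real (card (sym_diff (A x) (A y))) / real (card (A x \<inter> A y)) < \<epsilon> / 2"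
    and AS: "\<forall>x\<in>mspace X. \<forall>(y, m)\<in>A x. \<forall>(z, n)\<in>A x. mdist X y z \<le> D"
    using A[unfolded property_A_def, THEN spec, THEN mp, OF r, THEN spec, THEN mp, OF \<epsilon>2] by blast
  define W where "W x = fst ` A x" for x
  define c where "c x z = real (card {n. (z, n) \<in> A x})" for x z
  define k where "k x = real (card (A x))" for x
  have k: "k x > 0" if "x \<in> mspace X" for x
  proof -
    have "finite (A x)" "A x \<noteq> {}" using A that by auto
    then show ?thesis by (simp add: k_def card_gt_0_iff)
  qed
  have c0: "c x z \<ge> 0" for x z by (simp add: c_def)
  have csum: "sum (c x) (W x) = k x" if "x \<in> mspace X" for x
  proof -
    have "finite (A x)" using A that by auto
    then have "(\<Sum>z\<in>W x. card {n. (z, n) \<in> A x}) = card (A x)"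
      by (intro sum_card_slices(2)) (auto simp: W_def)
    then show ?thesis unfolding c_def k_def by (simp flip: of_nat_sum)
  qed
  have cle: "sum (c x) F \<le> k x" if "x \<in> mspace X" "finite F" for x F
  proof -
    have "finite (A x)" using A that by auto
    from sum_card_slices(1)[OF this that(2)] show ?thesis unfolding c_def k_def by (simp flip: of_nat_sum)
  qed
  show "\<exists>D>0. \<exists>(W :: 'a \<Rightarrow> 'a set) (h :: 'a \<Rightarrow> 'a \<Rightarrow> real).
     (\<forall>x\<in>mspace X. density_at X D x (W x) (h x)) \<and>
     (\<forall>x\<in>mspace X. \<forall>y\<in>mspace X. mdist X x y \<le> r \<longrightarrow> l1_close \<epsilon> (h x) (h y))"
  proof (rule exI[of _ D], intro conjI D, rule exI[of _ W], rule exI[of _ "\<lambda>x z. c x z / k x"],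
      unfold density_at_def l1_close_def, intro conjI ballI allI impI)
    fix x assume x: "x \<in> mspace X"
    have "finite (A x)" "A x \<subseteq> mspace X \<times> UNIV" using A x by blast+
    then show "finite (W x)" "W x \<subseteq> mspace X" by (auto simp: W_def)
    show "0 \<le> c x z / k x" for z using c0 k[OF x] by simp
    show "c x z / k x = 0" if "z \<notin> W x" for z
    proof -
      have "{n. (z, n) \<in> A x} = {}" using that by (force simp: W_def)
      then show ?thesis by (simp add: c_def)
    qed
    show "(\<Sum>z\<in>W x. c x z / k x) = 1" using csum[OF x] k[OF x] by (simp flip: sum_divide_distrib)
    fix z assume "z \<in> W x"
    then obtain n where "(z, n) \<in> A x" by (auto simp: W_def)
    moreover have "(x, 1) \<in> A x" using A x by blast
    ultimately show "mdist X x z \<le> D" using AS x by blast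
  next
    fix x y F assume x: "x \<in> mspace X" and y: "y \<in> mspace X" and xy: "mdist X x y \<le> r" and F: "finite (F :: 'a set)"
    define s where "s = real (card (sym_diff (A x) (A y)))"
    have fin: "finite (A x)" "finite (A y)" using A x y by auto
    have quot: "s / real (card (A x \<inter> A y)) < \<epsilon> / 2" "A x \<inter> A y \<noteq> {}" using AA x y xy unfolding s_def by blast+
    then have "s \<le> \<epsilon> / 2 * real (card (A x \<inter> A y))"
      using fin by (simp add: pos_divide_less_eq card_gt_0_iff less_imp_le)
    also have "\<dots> \<le> \<epsilon> / 2 * k x"
      unfolding k_def using fin \<epsilon> by (intro mult_left_mono of_nat_mono card_mono) auto
    finally have s: "s \<le> \<epsilon> / 2 * k x" .
    have fin': "finite {n. (z, n) \<in> A x}" "finite {n. (z, n) \<in> A y}" for z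
      by (rule finite_subset[of _ "snd ` A x"] finite_subset[of _ "snd ` A y"]; use fin in force)+
    have diff1: "\<bar>c x z - c y z\<bar> \<le> real (card {n. (z, n) \<in> sym_diff (A x) (A y)})" for z
    proof -
      let ?P = "{n. (z, n) \<in> A x}" and ?Q = "{n. (z, n) \<in> A y}" and ?R = "{n. (z, n) \<in> sym_diff (A x) (A y)}"
      have finR: "finite ?R" by (rule finite_subset[of _ "?P \<union> ?Q"]) (use fin'[of z] in auto)
      have "card ?P \<le> card (?Q \<union> ?R)" "card ?Q \<le> card (?P \<union> ?R)"
        using fin'[of z] finR by (auto intro!: card_mono)
      moreover have "card (?Q \<union> ?R) \<le> card ?Q + card ?R" "card (?P \<union> ?R) \<le> card ?P + card ?R"
        by (rule card_Un_le)+
      ultimately show ?thesis unfolding c_def by linarith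
    qed
    have "(\<Sum>z\<in>F. \<bar>c x z - c y z\<bar>) \<le> (\<Sum>z\<in>F. real (card {n. (z, n) \<in> sym_diff (A x) (A y)}))"
      by (intro sum_mono diff1)
    also have "\<dots> \<le> s"
      using sum_card_slices(1)[of "sym_diff (A x) (A y)" F] fin F unfolding s_def by (simp flip: of_nat_sum)
    finally have sum1: "(\<Sum>z\<in>F. \<bar>c x z - c y z\<bar>) \<le> s" .
    have ks: "\<bar>k x - k y\<bar> \<le> s"
    proof -
      have "card (A x) \<le> card (A y \<union> sym_diff (A x) (A y))" "card (A y) \<le> card (A x \<union> sym_diff (A x) (A y))"
        using fin by (auto intro!: card_mono)
      moreover have "card (A y \<union> sym_diff (A x) (A y)) \<le> card (A y) + card (sym_diff (A x) (A y))"
          "card (A x \<union> sym_diff (A x) (A y)) \<le> card (A x) + card (sym_diff (A x) (A y))"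
        by (rule card_Un_le)+
      ultimately show ?thesis unfolding k_def s_def by linarith
    qed
    have "\<bar>c x z / k x - c y z / k y\<bar> \<le> \<bar>c x z - c y z\<bar> / k x + c y z * (s / (k x * k y))" for z
    proof -
      have "c x z / k x - c y z / k y = (c x z - c y z) / k x + c y z * ((k y - k x) / (k x * k y))"
        using k[OF x] k[OF y] by (simp add: field_simps)
      also have "\<bar>\<dots>\<bar> \<le> \<bar>(c x z - c y z) / k x\<bar> + \<bar>c y z * ((k y - k x) / (k x * k y))\<bar>" by (rule abs_triangle_ineq)
      also have "\<bar>(c x z - c y z) / k x\<bar> = \<bar>c x z - c y z\<bar> / k x" using k[OF x] by simp
      also have "\<bar>c y z * ((k y - k x) / (k x * k y))\<bar> = c y z * (\<bar>k x - k y\<bar> / (k x * k y))"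
        using k[OF x] k[OF y] c0[of y z] by (simp add: abs_mult abs_minus_commute)
      also have "\<dots> \<le> c y z * (s / (k x * k y))"
        using ks k[OF x] k[OF y] c0[of y z] by (intro mult_left_mono divide_right_mono) auto
      finally show ?thesis by simp
    qed
    then have "(\<Sum>z\<in>F. \<bar>c x z / k x - c y z / k y\<bar>) \<le> (\<Sum>z\<in>F. \<bar>c x z - c y z\<bar> / k x + c y z * (s / (k x * k y)))"
      by (rule sum_mono)
    also have "\<dots> = (\<Sum>z\<in>F. \<bar>c x z - c y z\<bar>) / k x + sum (c y) F * (s / (k x * k y))"
      by (simp add: sum.distrib sum_divide_distrib sum_distrib_right)
    also have "\<dots> \<le> s / k x + k y * (s / (k x * k y))"
      using sum1 cle[OF y F] k[OF x] k[OF y]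
      by (intro add_mono divide_right_mono mult_right_mono) (auto simp: s_def)
    also have "\<dots> = 2 * (s / k x)" using k[OF x] k[OF y] by simp
    also have "\<dots> \<le> \<epsilon>" using s k[OF x] by (simp add: pos_divide_le_eq)
    finally show "(\<Sum>z\<in>F. \<bar>c x z / k x - c y z / k y\<bar>) \<le> \<epsilon>" .
  qed
qed

text \<open>
  The point \<open>z\<close> of \<open>Y\<close> is replaced by a representative of the \<open>r\<close>-chain component of \<open>x\<close> in the
  preimage of a ball around \<open>z\<close>. Components have bounded diameter, so the representative is near
  \<open>x\<close>; points of the preimage at distance at most \<open>r\<close> lie in the same component, so they get
  the same one.
\<close>
lemma almost_invariant_densities_preimage:
  assumes f: "coarse_finite_to_one X Y S f" and ulf: "ulf Y"
    and Y: "almost_invariant_densities Y (mspace Y)"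
  shows "almost_invariant_densities X S"
  unfolding almost_invariant_densities_def
proof (intro allI impI)
  fix r \<epsilon> :: real assume r: "r > 0" and \<epsilon>: "\<epsilon> > 0"
  have S: "S \<subseteq> mspace X" "f ` S \<subseteq> mspace Y" using f unfolding coarse_finite_to_one_def by blast+
  obtain s where s: "s > 0" "\<forall>x\<in>S. \<forall>y\<in>S. mdist X x y \<le> r \<longrightarrow> mdist Y (f x) (f y) \<le> s"
    using f r unfolding coarse_finite_to_one_def by blast
  obtain D and W :: "'b \<Rightarrow> 'b set" and g :: "'b \<Rightarrow> 'b \<Rightarrow> real" where D: "D > 0"
    and W: "\<forall>u\<in>mspace Y. density_at Y D u (W u) (g u)"
    and g: "\<forall>u\<in>mspace Y. \<forall>v\<in>mspace Y. mdist Y u v \<le> s \<longrightarrow> l1_close \<epsilon> (g u) (g v)"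
    using almost_invariant_densitiesD[OF Y s(1) \<epsilon>] by (elim exE conjE)
  note W = W[unfolded density_at_def] and g = g[unfolded l1_close_def]
  have "0 \<le> 2 * D" using D by simp
  from coarse_finite_to_one_chain_bounded[OF f ulf this less_imp_le[OF r]]
  obtain D' where D': "D' > 0" "\<forall>P\<subseteq>S. (\<forall>x\<in>P. \<forall>y. (x, y) \<in> chained X r P \<longrightarrow> mdist Y (f x) (f y) \<le> 2 * D)
      \<longrightarrow> chain_bounded X r D' P" by (elim exE conjE)
  define P where "P z = {x \<in> S. mdist Y (f x) z \<le> D}" for z
  define rep where "rep z x = (SOME p. p \<in> chained X r (P z) `` {x})" for z x
  have rep_in: "(x, rep z x) \<in> chained X r (P z)" for x z
  proof -
    have "rep z x \<in> chained X r (P z) `` {x}" unfolding rep_def by (rule someI[of _ x]) simp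
    then show ?thesis by simp
  qed
  have P: "f x \<in> mspace Y \<and> (z \<in> W (f x) \<longrightarrow> z \<in> mspace Y \<and> x \<in> P z)" if x: "x \<in> S" for x z
  proof -
    have fx: "f x \<in> mspace Y" using S x by auto
    then have "W (f x) \<subseteq> mspace Y" "\<forall>z\<in>W (f x). mdist Y (f x) z \<le> D" using W by blast+
    then show ?thesis using fx x by (auto simp: P_def)
  qed
  have cb: "chain_bounded X r D' (P z)" if z: "z \<in> mspace Y" for z
  proof -
    have "mdist Y (f x) (f y) \<le> 2 * D" if x: "x \<in> P z" and xy: "(x, y) \<in> chained X r (P z)" for x y
    proof -
      have y: "y \<in> P z" using chained_in[OF xy x] .
      have "mdist Y (f x) (f y) \<le> mdist Y (f x) z + mdist Y z (f y)"
        using x y z S by (intro mdist_triangle) (auto simp: P_def)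
      then show ?thesis using x y by (simp add: P_def mdist_commute)
    qed
    moreover have "P z \<subseteq> S" by (auto simp: P_def)
    ultimately show ?thesis using D'(2) by blast
  qed
  have rep_near: "rep z x \<in> mspace X \<and> mdist X x (rep z x) \<le> D'" if x: "x \<in> S" and z: "z \<in> W (f x)" for x z
  proof -
    have zx: "z \<in> mspace Y" "x \<in> P z" using P[OF x, of z] z by auto
    have "rep z x \<in> P z" using chained_in[OF rep_in zx(2)] .
    then show ?thesis using chain_boundedD[OF cb[OF zx(1)] zx(2) rep_in] S by (auto simp: P_def)
  qed
  have rep_eq: "rep z x = rep z y"
    if "x \<in> S" "y \<in> S" "mdist X x y \<le> r" "z \<in> W (f x)" "z \<in> W (f y)" for x y z
  proof -
    have "x \<in> P z" "y \<in> P z" using P that by blast+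
    then have "(x, y) \<in> chained X r (P z)" using that(3) by (rule chained_step)
    then show ?thesis unfolding rep_def by (simp add: chained_class_eq)
  qed
  define W' where "W' x = (\<lambda>z. rep z x) ` W (f x)" for x
  define h where "h x p = (\<Sum>z\<in>W (f x). if rep z x = p then g (f x) z else 0)" for x p
  have g0: "0 \<le> g (f x) z" if "x \<in> S" for x z using W P[OF that] by blast
  show "\<exists>D>0. \<exists>(W :: 'a \<Rightarrow> 'a set) (h :: 'a \<Rightarrow> 'a \<Rightarrow> real).
     (\<forall>x\<in>S. density_at X D x (W x) (h x)) \<and>
     (\<forall>x\<in>S. \<forall>y\<in>S. mdist X x y \<le> r \<longrightarrow> l1_close \<epsilon> (h x) (h y))"
  proof (rule exI[of _ D'], intro conjI D'(1), rule exI[of _ W'], rule exI[of _ h],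
      unfold density_at_def l1_close_def, intro conjI ballI allI impI)
    fix x assume x: "x \<in> S"
    have fW: "finite (W (f x))" using W P[OF x] by blast
    show "finite (W' x)" using fW by (simp add: W'_def)
    show "W' x \<subseteq> mspace X" using rep_near[OF x] by (auto simp: W'_def)
    show "0 \<le> h x p" for p unfolding h_def using g0[OF x] by (intro sum_nonneg) auto
    show "h x p = 0" if "p \<notin> W' x" for p
      unfolding h_def using that by (intro sum.neutral) (auto simp: W'_def)
    have "sum (h x) (W' x) = (\<Sum>z\<in>W (f x). \<Sum>p\<in>W' x. if rep z x = p then g (f x) z else 0)"
      unfolding h_def by (rule sum.swap)
    also have "\<dots> = sum (g (f x)) (W (f x))"
      using fW by (intro sum.cong) (auto simp: W'_def)
    finally show "sum (h x) (W' x) = 1" using W P[OF x] by simp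
    fix p assume "p \<in> W' x"
    then show "mdist X x p \<le> D'" using rep_near[OF x] by (auto simp: W'_def)
  next
    fix x y F assume x: "x \<in> S" and y: "y \<in> S" and xy: "mdist X x y \<le> r" and F: "finite (F :: 'a set)"
    have fx: "f x \<in> mspace Y" and fy: "f y \<in> mspace Y" using P x y by blast+
    define V where "V = W (f x) \<union> W (f y)"
    have V: "finite V" "W (f x) \<subseteq> V" "W (f y) \<subseteq> V" using W fx fy by (auto simp: V_def)
    have out: "g (f x) z = 0" if "z \<notin> W (f x)" for z using W fx that by blast
    have out': "g (f y) z = 0" if "z \<notin> W (f y)" for z using W fy that by blast
    have hx: "h x p = (\<Sum>z\<in>V. if rep z x = p then g (f x) z else 0)" for p
      unfolding h_def using V out by (intro sum.mono_neutral_left) auto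
    have hy: "h y p = (\<Sum>z\<in>V. if rep z y = p then g (f y) z else 0)" for p
      unfolding h_def using V out' by (intro sum.mono_neutral_left) auto
    have "(\<Sum>p\<in>F. \<bar>h x p - h y p\<bar>)
        \<le> (\<Sum>p\<in>F. \<Sum>z\<in>V. \<bar>(if rep z x = p then g (f x) z else 0) - (if rep z y = p then g (f y) z else 0)\<bar>)"
      unfolding hx hy sum_subtractf[symmetric] by (intro sum_mono sum_abs)
    also have "\<dots> = (\<Sum>z\<in>V. \<Sum>p\<in>F. \<bar>(if rep z x = p then g (f x) z else 0) - (if rep z y = p then g (f y) z else 0)\<bar>)"
      by (rule sum.swap)
    also have "\<dots> \<le> (\<Sum>z\<in>V. \<bar>g (f x) z - g (f y) z\<bar>)"
    proof (intro sum_mono)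
      fix z
      show "(\<Sum>p\<in>F. \<bar>(if rep z x = p then g (f x) z else 0) - (if rep z y = p then g (f y) z else 0)\<bar>)
          \<le> \<bar>g (f x) z - g (f y) z\<bar>"
      proof (cases "z \<in> W (f x) \<and> z \<in> W (f y)")
        case True
        then have "rep z x = rep z y" using rep_eq x y xy by blast
        then have "(\<Sum>p\<in>F. \<bar>(if rep z x = p then g (f x) z else 0) - (if rep z y = p then g (f y) z else 0)\<bar>)
            = (\<Sum>p\<in>F. if rep z x = p then \<bar>g (f x) z - g (f y) z\<bar> else 0)"
          by (intro sum.cong) auto
        then show ?thesis using F by simp
      next
        case False
        then consider "g (f x) z = 0" | "g (f y) z = 0" using out out' by blast
        then show ?thesis
        proof cases
          case 1
          then have "(\<Sum>p\<in>F. \<bar>(if rep z x = p then g (f x) z else 0) - (if rep z y = p then g (f y) z else 0)\<bar>)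
              = (\<Sum>p\<in>F. if rep z y = p then \<bar>g (f x) z - g (f y) z\<bar> else 0)"
            by (intro sum.cong) auto
          then show ?thesis using F by simp
        next
          case 2
          then have "(\<Sum>p\<in>F. \<bar>(if rep z x = p then g (f x) z else 0) - (if rep z y = p then g (f y) z else 0)\<bar>)
              = (\<Sum>p\<in>F. if rep z x = p then \<bar>g (f x) z - g (f y) z\<bar> else 0)"
            by (intro sum.cong) auto
          then show ?thesis using F by simp
        qed
      qed
    qed
    also have "\<dots> \<le> \<epsilon>" using g fx fy s(2) x y xy V(1) by blast
    finally show "(\<Sum>p\<in>F. \<bar>h x p - h y p\<bar>) \<le> \<epsilon>" .
  qed
qed

lemma sum_abs_weighted_diff:
  fixes a b :: "'a \<Rightarrow> real"
  assumes st: "0 \<le> s" "0 \<le> t" and F: "finite F" and \<delta>: "0 \<le> \<delta>"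
    and a: "s > 0 \<Longrightarrow> sum a F \<le> 1" "\<And>z. s > 0 \<Longrightarrow> 0 \<le> a z"
    and b: "t > 0 \<Longrightarrow> sum b F \<le> 1" "\<And>z. t > 0 \<Longrightarrow> 0 \<le> b z"
    and t1: "t \<le> 1"
    and ab: "s > 0 \<Longrightarrow> t > 0 \<Longrightarrow> (\<Sum>z\<in>F. \<bar>a z - b z\<bar>) \<le> \<delta>"
  shows "(\<Sum>z\<in>F. \<bar>s * a z - t * b z\<bar>) \<le> \<bar>s - t\<bar> + \<delta>"
proof -
  consider "s = 0" "t = 0" | "s = 0" "t > 0" | "s > 0" "t = 0" | "s > 0" "t > 0" using st by linarith
  then show ?thesis
  proof cases
    case 1 then show ?thesis using \<delta> by simp
  next
    case 2
    then have "(\<Sum>z\<in>F. \<bar>s * a z - t * b z\<bar>) = t * sum b F"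
      using b by (simp add: abs_mult sum_distrib_left)
    also have "\<dots> \<le> t" using b(1) 2 by (simp add: mult_left_le)
    finally show ?thesis using 2 \<delta> by simp
  next
    case 3
    then have "(\<Sum>z\<in>F. \<bar>s * a z - t * b z\<bar>) = s * sum a F"
      using a by (simp add: abs_mult sum_distrib_left)
    also have "\<dots> \<le> s" using a(1) 3 by (simp add: mult_left_le)
    finally show ?thesis using 3 \<delta> by simp
  next
    case 4
    have "\<bar>s * a z - t * b z\<bar> \<le> \<bar>s - t\<bar> * a z + t * \<bar>a z - b z\<bar>" for z
    proof -
      have "s * a z - t * b z = (s - t) * a z + t * (a z - b z)" by (simp add: algebra_simps)
      also have "\<bar>\<dots>\<bar> \<le> \<bar>(s - t) * a z\<bar> + \<bar>t * (a z - b z)\<bar>" by (rule abs_triangle_ineq)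
      also have "\<dots> = \<bar>s - t\<bar> * a z + t * \<bar>a z - b z\<bar>" using a(2)[of z] 4 by (simp add: abs_mult)
      finally show ?thesis .
    qed
    then have "(\<Sum>z\<in>F. \<bar>s * a z - t * b z\<bar>) \<le> (\<Sum>z\<in>F. \<bar>s - t\<bar> * a z + t * \<bar>a z - b z\<bar>)" by (rule sum_mono)
    also have "\<dots> = \<bar>s - t\<bar> * sum a F + t * (\<Sum>z\<in>F. \<bar>a z - b z\<bar>)" by (simp add: sum.distrib sum_distrib_left)
    also have "\<dots> \<le> \<bar>s - t\<bar> * 1 + 1 * \<delta>"
      using a(1) ab 4 t1 \<delta> by (intro add_mono mult_left_mono mult_mono) (auto intro: sum_nonneg)
    finally show ?thesis by simp
  qed
qed

lemma sum_le_of_support: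
  fixes h :: "'a \<Rightarrow> real"
  assumes "finite W" "finite F" "\<And>z. 0 \<le> h z" "\<And>z. z \<notin> W \<Longrightarrow> h z = 0"
  shows "sum h F \<le> sum h W"
proof -
  have "sum h F = sum h (F \<inter> W)" using assms by (intro sum.mono_neutral_right) auto
  also have "\<dots> \<le> sum h W" using assms by (intro sum_mono2) auto
  finally show ?thesis .
qed

text \<open>
  Interpolate between the two densities with a weight \<open>\<phi>\<close> that is \<open>1\<close> on \<open>S\<close> and falls to \<open>0\<close> in
  \<open>L\<close> steps of size \<open>1 / L\<close> as the distance from \<open>S\<close> grows to \<open>L * r\<close>.
\<close>
lemma almost_invariant_densities_Un:
  assumes sub: "S \<subseteq> mspace X" "T \<subseteq> mspace X"
    and S: "almost_invariant_densities X S" and T: "almost_invariant_densities X T"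
  shows "almost_invariant_densities X (S \<union> T)"
  unfolding almost_invariant_densities_def
proof (intro allI impI)
  fix r \<epsilon> :: real assume r: "r > 0" and \<epsilon>: "\<epsilon> > 0"
  then have \<epsilon>4: "\<epsilon> / 4 > 0" by simp
  obtain L :: nat where L: "L > 0" "1 / real L \<le> \<epsilon> / 4"
  proof -
    obtain n where "inverse (real (Suc n)) < \<epsilon> / 4" using reals_Archimedean[OF \<epsilon>4] by blast
    then show thesis using that[of "Suc n"] by (simp add: inverse_eq_divide)
  qed
  define r' where "r' = (2 * real L + 1) * r"
  have r': "r' > 0" unfolding r'_def using r by (intro mult_pos_pos) auto
  obtain D1 and W1 :: "'a \<Rightarrow> 'a set" and g1 :: "'a \<Rightarrow> 'a \<Rightarrow> real" where D1: "D1 > 0"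
    and W1: "\<forall>x\<in>S. density_at X D1 x (W1 x) (g1 x)"
    and g1: "\<forall>x\<in>S. \<forall>y\<in>S. mdist X x y \<le> r' \<longrightarrow> l1_close (\<epsilon> / 4) (g1 x) (g1 y)"
    using almost_invariant_densitiesD[OF S r' \<epsilon>4] by (elim exE conjE)
  note W1 = W1[unfolded density_at_def] and g1 = g1[unfolded l1_close_def]
  obtain D2 and W2 :: "'a \<Rightarrow> 'a set" and g2 :: "'a \<Rightarrow> 'a \<Rightarrow> real" where D2: "D2 > 0"
    and W2: "\<forall>x\<in>T. density_at X D2 x (W2 x) (g2 x)"
    and g2: "\<forall>x\<in>T. \<forall>y\<in>T. mdist X x y \<le> r \<longrightarrow> l1_close (\<epsilon> / 4) (g2 x) (g2 y)"
    using almost_invariant_densitiesD[OF T r \<epsilon>4] by (elim exE conjE)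
  note W2 = W2[unfolded density_at_def] and g2 = g2[unfolded l1_close_def]
  define I where "I x = {l. l < L \<and> (\<exists>a\<in>S. mdist X x a \<le> real l * r)}" for x
  define \<phi> where "\<phi> x = real (card (I x)) / real L" for x
  have I: "finite (I x)" "I x \<subseteq> {..<L}" for x by (auto simp: I_def)
  have \<phi>01: "0 \<le> \<phi> x" "\<phi> x \<le> 1" for x
    using card_mono[OF finite_lessThan I(2)[of x]] L(1) by (auto simp: \<phi>_def)
  have "\<exists>a\<in>S. mdist X x a \<le> real L * r" if "\<phi> x > 0" for x
  proof -
    have "I x \<noteq> {}" using that by (auto simp: \<phi>_def)
    then obtain l a where la: "l < L" "a \<in> S" "mdist X x a \<le> real l * r" by (auto simp: I_def)
    have "real l * r \<le> real L * r" using la(1) r by (intro mult_right_mono) auto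
    then show ?thesis using la by force
  qed
  then obtain \<pi> where \<pi>: "\<And>x. \<phi> x > 0 \<Longrightarrow> \<pi> x \<in> S" "\<And>x. \<phi> x > 0 \<Longrightarrow> mdist X x (\<pi> x) \<le> real L * r" by metis
  have inT: "x \<in> T" if "x \<in> S \<union> T" "\<phi> x < 1" for x
  proof (rule ccontr)
    assume "x \<notin> T"
    then have x: "x \<in> S" using that by blast
    then have "mdist X x x = 0" using sub by (intro mdist_self) auto
    then have "I x = {..<L}" using x r by (auto simp: I_def intro!: bexI[of _ x])
    then show False using that(2) L(1) by (simp add: \<phi>_def)
  qed
  have \<phi>_le: "\<phi> x \<le> \<phi> y + 1 / real L"
    if x: "x \<in> mspace X" and y: "y \<in> mspace X" and xy: "mdist X x y \<le> r" for x y
  proof -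
    have "Suc ` I x \<subseteq> insert L (I y)"
    proof
      fix k assume "k \<in> Suc ` I x"
      then obtain l a where la: "k = Suc l" "l < L" "a \<in> S" "mdist X x a \<le> real l * r" by (auto simp: I_def)
      have "mdist X y a \<le> mdist X y x + mdist X x a" using x y la(3) sub by (intro mdist_triangle) auto
      also have "\<dots> \<le> real k * r" using xy la by (simp add: mdist_commute algebra_simps)
      finally show "k \<in> insert L (I y)" using la by (auto simp: I_def)
    qed
    then have "card (Suc ` I x) \<le> card (insert L (I y))" using I by (intro card_mono) auto
    also have "\<dots> \<le> card (I y) + 1" using I(1) by (simp add: card_insert_if)
    finally have "card (I x) \<le> card (I y) + 1" by (simp add: card_image)
    then have "real (card (I x)) \<le> real (card (I y)) + 1" by linarith
    then show ?thesis using L(1) by (simp add: \<phi>_def field_simps)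
  qed
  define W where "W x = (if \<phi> x > 0 then W1 (\<pi> x) else {}) \<union> (if \<phi> x < 1 then W2 x else {})" for x
  define h where "h x z = \<phi> x * g1 (\<pi> x) z + (1 - \<phi> x) * g2 x z" for x z
  define D where "D = D1 + D2 + real L * r"
  have D: "D > 0" using D1 D2 r by (simp add: D_def add_pos_nonneg)
  show "\<exists>D>0. \<exists>(W :: 'a \<Rightarrow> 'a set) (h :: 'a \<Rightarrow> 'a \<Rightarrow> real).
     (\<forall>x\<in>S \<union> T. density_at X D x (W x) (h x)) \<and>
     (\<forall>x\<in>S \<union> T. \<forall>y\<in>S \<union> T. mdist X x y \<le> r \<longrightarrow> l1_close \<epsilon> (h x) (h y))"
  proof (rule exI[of _ D], intro conjI D, rule exI[of _ W], rule exI[of _ h],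
      unfold density_at_def l1_close_def, intro conjI ballI allI impI)
    fix x assume x: "x \<in> S \<union> T"
    have 1: "finite (W1 (\<pi> x))" "W1 (\<pi> x) \<subseteq> mspace X" "\<forall>z\<in>W1 (\<pi> x). mdist X (\<pi> x) z \<le> D1" "\<forall>z. 0 \<le> g1 (\<pi> x) z"
        "\<forall>z. z \<notin> W1 (\<pi> x) \<longrightarrow> g1 (\<pi> x) z = 0" "sum (g1 (\<pi> x)) (W1 (\<pi> x)) = 1" if "\<phi> x > 0"
      using W1[THEN bspec, OF \<pi>(1)[OF that]] by blast+
    have 2: "finite (W2 x)" "W2 x \<subseteq> mspace X" "\<forall>z\<in>W2 x. mdist X x z \<le> D2" "\<forall>z. 0 \<le> g2 x z"
        "\<forall>z. z \<notin> W2 x \<longrightarrow> g2 x z = 0" "sum (g2 x) (W2 x) = 1" if "\<phi> x < 1"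
      using W2[THEN bspec, OF inT[OF x that]] by blast+
    show fW: "finite (W x)" using 1 2 by (simp add: W_def)
    show "W x \<subseteq> mspace X" using 1 2 by (simp add: W_def)
    show "0 \<le> h x z" for z
    proof -
      have "0 \<le> \<phi> x * g1 (\<pi> x) z" using 1(4) \<phi>01[of x] by (cases "\<phi> x = 0") auto
      moreover have "0 \<le> (1 - \<phi> x) * g2 x z" using 2(4) \<phi>01[of x] by (cases "\<phi> x = 1") auto
      ultimately show ?thesis by (simp add: h_def)
    qed
    show "h x z = 0" if z: "z \<notin> W x" for z
    proof -
      have "\<phi> x * g1 (\<pi> x) z = 0" using 1(5) \<phi>01[of x] z by (cases "\<phi> x = 0") (auto simp: W_def)
      moreover have "(1 - \<phi> x) * g2 x z = 0" using 2(5) \<phi>01[of x] z by (cases "\<phi> x = 1") (auto simp: W_def)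
      ultimately show ?thesis unfolding h_def by linarith
    qed
    have "\<phi> x * sum (g1 (\<pi> x)) (W x) = \<phi> x"
    proof (cases "\<phi> x = 0")
      case False
      then have p: "\<phi> x > 0" using \<phi>01[of x] by simp
      have "sum (g1 (\<pi> x)) (W x) = sum (g1 (\<pi> x)) (W1 (\<pi> x))"
        using fW p 1(5)[OF p] by (intro sum.mono_neutral_right) (auto simp: W_def)
      then show ?thesis using 1(6)[OF p] by simp
    qed simp
    moreover have "(1 - \<phi> x) * sum (g2 x) (W x) = 1 - \<phi> x"
    proof (cases "\<phi> x = 1")
      case False
      then have p: "\<phi> x < 1" using \<phi>01[of x] by simp
      have "sum (g2 x) (W x) = sum (g2 x) (W2 x)"
        using fW p 2(5)[OF p] by (intro sum.mono_neutral_right) (auto simp: W_def)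
      then show ?thesis using 2(6)[OF p] by simp
    qed simp
    moreover have "sum (h x) (W x) = \<phi> x * sum (g1 (\<pi> x)) (W x) + (1 - \<phi> x) * sum (g2 x) (W x)"
      by (simp add: h_def sum.distrib sum_distrib_left)
    ultimately show "sum (h x) (W x) = 1" by linarith
    fix z assume z: "z \<in> W x"
    have Lr: "0 \<le> real L * r" using r by simp
    from z consider (left) "\<phi> x > 0" "z \<in> W1 (\<pi> x)" | (right) "\<phi> x < 1" "z \<in> W2 x" by (auto simp: W_def split: if_splits)
    then show "mdist X x z \<le> D"
    proof cases
      case left
      have "mdist X x z \<le> mdist X x (\<pi> x) + mdist X (\<pi> x) z"
        using x sub \<pi>(1)[OF left(1)] 1(2)[OF left(1)] left(2) by (intro mdist_triangle) auto
      also have "\<dots> \<le> real L * r + D1" using \<pi>(2)[OF left(1)] 1(3)[OF left(1)] left(2) by (intro add_mono) auto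
      finally show ?thesis using D2 by (simp add: D_def)
    next
      case right
      have "mdist X x z \<le> D2" using 2(3)[OF right(1)] right(2) by blast
      then show ?thesis using D1 Lr by (simp add: D_def)
    qed
  next
    fix x y F assume x: "x \<in> S \<union> T" and y: "y \<in> S \<union> T" and xy: "mdist X x y \<le> r" and F: "finite (F :: 'a set)"
    have xyM: "x \<in> mspace X" "y \<in> mspace X" using x y sub by auto
    have yx: "mdist X y x \<le> r" using xy by (simp add: mdist_commute)
    have \<phi>d: "\<bar>\<phi> x - \<phi> y\<bar> \<le> \<epsilon> / 4" using \<phi>_le[OF xyM xy] \<phi>_le[OF xyM(2,1) yx] L(2) by linarith
    have mass1: "sum (g1 (\<pi> x)) F \<le> 1" "0 \<le> g1 (\<pi> x) z" if "\<phi> x > 0" for x z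
    proof -
      have *: "finite (W1 (\<pi> x))" "\<forall>z. 0 \<le> g1 (\<pi> x) z" "\<forall>z. z \<notin> W1 (\<pi> x) \<longrightarrow> g1 (\<pi> x) z = 0"
          "sum (g1 (\<pi> x)) (W1 (\<pi> x)) = 1"
        using W1[THEN bspec, OF \<pi>(1)[OF that]] by blast+
      show "sum (g1 (\<pi> x)) F \<le> 1" using sum_le_of_support[OF *(1) F, of "g1 (\<pi> x)"] * by simp
      show "0 \<le> g1 (\<pi> x) z" using * by simp
    qed
    have mass2: "sum (g2 x) F \<le> 1" "0 \<le> g2 x z" if "x \<in> S \<union> T" "\<phi> x < 1" for x z
    proof -
      have *: "finite (W2 x)" "\<forall>z. 0 \<le> g2 x z" "\<forall>z. z \<notin> W2 x \<longrightarrow> g2 x z = 0" "sum (g2 x) (W2 x) = 1"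
        using W2[THEN bspec, OF inT[OF that]] by blast+
      show "sum (g2 x) F \<le> 1" using sum_le_of_support[OF *(1) F, of "g2 x"] * by simp
      show "0 \<le> g2 x z" using * by simp
    qed
    have "(\<Sum>z\<in>F. \<bar>\<phi> x * g1 (\<pi> x) z - \<phi> y * g1 (\<pi> y) z\<bar>) \<le> \<bar>\<phi> x - \<phi> y\<bar> + \<epsilon> / 4"
    proof (rule sum_abs_weighted_diff)
      assume p: "\<phi> x > 0" "\<phi> y > 0"
      have m: "\<pi> x \<in> mspace X" "\<pi> y \<in> mspace X" using \<pi>(1) p sub by auto
      have "mdist X (\<pi> x) (\<pi> y) \<le> mdist X (\<pi> x) x + mdist X x (\<pi> y)" using m xyM by (intro mdist_triangle) auto
      also have "mdist X x (\<pi> y) \<le> mdist X x y + mdist X y (\<pi> y)" using m xyM by (intro mdist_triangle) auto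
      finally have "mdist X (\<pi> x) (\<pi> y) \<le> r'"
        using \<pi>(2)[OF p(1)] \<pi>(2)[OF p(2)] xy by (simp add: r'_def mdist_commute algebra_simps)
      then show "(\<Sum>z\<in>F. \<bar>g1 (\<pi> x) z - g1 (\<pi> y) z\<bar>) \<le> \<epsilon> / 4" using g1 \<pi>(1) p F by blast
    qed (use \<phi>01 mass1 F \<epsilon> in auto)
    moreover have "(\<Sum>z\<in>F. \<bar>(1 - \<phi> x) * g2 x z - (1 - \<phi> y) * g2 y z\<bar>) \<le> \<bar>(1 - \<phi> x) - (1 - \<phi> y)\<bar> + \<epsilon> / 4"
    proof (rule sum_abs_weighted_diff)
      assume "1 - \<phi> x > 0" "1 - \<phi> y > 0"
      then have "x \<in> T" "y \<in> T" using inT x y by auto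
      then show "(\<Sum>z\<in>F. \<bar>g2 x z - g2 y z\<bar>) \<le> \<epsilon> / 4" using g2 xy F by blast
    qed (use \<phi>01 mass2[OF x] mass2[OF y] F \<epsilon> in auto)
    moreover have "(\<Sum>z\<in>F. \<bar>h x z - h y z\<bar>) \<le> (\<Sum>z\<in>F. \<bar>\<phi> x * g1 (\<pi> x) z - \<phi> y * g1 (\<pi> y) z\<bar>
        + \<bar>(1 - \<phi> x) * g2 x z - (1 - \<phi> y) * g2 y z\<bar>)"
    proof (rule sum_mono)
      fix z
      have "h x z - h y z = (\<phi> x * g1 (\<pi> x) z - \<phi> y * g1 (\<pi> y) z) + ((1 - \<phi> x) * g2 x z - (1 - \<phi> y) * g2 y z)"
        by (simp add: h_def)
      then show "\<bar>h x z - h y z\<bar> \<le> \<bar>\<phi> x * g1 (\<pi> x) z - \<phi> y * g1 (\<pi> y) z\<bar>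
          + \<bar>(1 - \<phi> x) * g2 x z - (1 - \<phi> y) * g2 y z\<bar>" by (simp only: abs_triangle_ineq)
    qed
    ultimately show "(\<Sum>z\<in>F. \<bar>h x z - h y z\<bar>) \<le> \<epsilon>" using \<phi>d by (simp add: sum.distrib abs_minus_commute)
  qed
qed

text \<open>
  Replace the density \<open>h x\<close> by \<open>\<lfloor>Q * h x z\<rfloor>\<close> points above every \<open>z\<close>. Rounding errs by at most one
  point for each of the boundedly many \<open>z\<close>, which is negligible for large \<open>Q\<close>. The required point
  \<open>(x, 1)\<close> is put below the others, which start at height \<open>2\<close>.
\<close>
lemma densities_property_A:
  assumes ulf: "ulf X" and X: "almost_invariant_densities X (mspace X)"
  shows "property_A X"
  unfolding property_A_def
proof (intro allI impI)
  fix r \<epsilon> :: real assume r: "r > 0" and \<epsilon>: "\<epsilon> > 0"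
  define \<delta> where "\<delta> = min (1 / 4) (\<epsilon> / 16)"
  have \<delta>: "\<delta> > 0" "\<delta> \<le> 1 / 4" "\<delta> \<le> \<epsilon> / 16" using \<epsilon> by (auto simp: \<delta>_def)
  obtain D and W :: "'a \<Rightarrow> 'a set" and h :: "'a \<Rightarrow> 'a \<Rightarrow> real" where D: "D > 0"
    and W: "\<forall>x\<in>mspace X. density_at X D x (W x) (h x)"
    and h: "\<forall>x\<in>mspace X. \<forall>y\<in>mspace X. mdist X x y \<le> r \<longrightarrow> l1_close \<delta> (h x) (h y)"
    using almost_invariant_densitiesD[OF X r \<delta>(1)] by (elim exE conjE)
  note W = W[unfolded density_at_def] and h = h[unfolded l1_close_def]
  obtain N where N: "\<forall>x\<in>mspace X. finite {y \<in> mspace X. mdist X x y \<le> D} \<and> card {y \<in> mspace X. mdist X x y \<le> D} \<le> N"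
    using ulf_ball_card[OF ulf less_imp_le[OF D]] by (elim exE)
  have cW: "card (W x) \<le> N" if x: "x \<in> mspace X" for x
  proof -
    have "W x \<subseteq> {y \<in> mspace X. mdist X x y \<le> D}" using W[THEN bspec, OF x] by blast
    then have "card (W x) \<le> card {y \<in> mspace X. mdist X x y \<le> D}" using N x by (intro card_mono) blast+
    then show ?thesis using N x le_trans by blast
  qed
  (* Q / 2 bounds the intersections from below, and the rounding error 2 * (N + 1) is at most \<epsilon> * Q / 8 *)
  define Q where "Q = max (4 * (2 * real N + 1)) (16 * (real N + 1) / \<epsilon>)"
  have Q: "Q \<ge> 4 * (2 * real N + 1)" "Q \<ge> 16 * (real N + 1) / \<epsilon>" by (auto simp: Q_def)
  then have Q0: "Q > 0" and Q\<epsilon>: "16 * (real N + 1) \<le> \<epsilon> * Q"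
    using \<epsilon> by (auto simp: field_simps)
  define n where "n x z = nat \<lfloor>Q * h x z\<rfloor>" for x z
  define A where "A x = insert (x, 1) (Sigma (W x) (\<lambda>z. {2..<n x z + 2}))" for x
  have W0: "finite (W x)" "\<And>z. 0 \<le> h x z" "\<And>z. z \<notin> W x \<Longrightarrow> h x z = 0" "sum (h x) (W x) = 1"
    if "x \<in> mspace X" for x using W[THEN bspec, OF that] by blast+
  have n: "real (n x z) \<le> Q * h x z" "Q * h x z \<le> real (n x z) + 1" if "x \<in> mspace X" for x z
  proof -
    have "0 \<le> Q * h x z" using Q0 W0(2)[OF that] by simp
    then show "real (n x z) \<le> Q * h x z" "Q * h x z \<le> real (n x z) + 1" unfolding n_def by linarith+
  qed
  have finA: "finite (A x)" if "x \<in> mspace X" for x using W0(1)[OF that] by (simp add: A_def)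
  have cardA: "Q - real N \<le> real (card (A x))" if x: "x \<in> mspace X" for x
  proof -
    have "Q = (\<Sum>z\<in>W x. Q * h x z)" using W0(4)[OF x] by (simp flip: sum_distrib_left)
    also have "\<dots> \<le> (\<Sum>z\<in>W x. real (n x z) + 1)" using n(2)[OF x] by (rule sum_mono)
    also have "\<dots> = real (\<Sum>z\<in>W x. n x z) + real (card (W x))" by (simp add: sum.distrib)
    also have "(\<Sum>z\<in>W x. n x z) = card (Sigma (W x) (\<lambda>z. {2..<n x z + 2}))"
      using W0(1)[OF x] by (simp add: card_SigmaI)
    also have "real \<dots> \<le> real (card (A x))"
      using finA[OF x] by (intro of_nat_mono card_mono) (auto simp: A_def)
    finally show ?thesis using cW[OF x] by linarith
  qed
  have diff: "real (card (A x - A y)) \<le> Q * \<delta> + real N + 1"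
    if x: "x \<in> mspace X" and y: "y \<in> mspace X" and xy: "mdist X x y \<le> r" for x y
  proof -
    let ?B = "Sigma (W x) (\<lambda>z. {n y z + 2..<n x z + 2})"
    have "A x - A y \<subseteq> insert (x, 1) ?B"
    proof
      fix p assume p: "p \<in> A x - A y"
      show "p \<in> insert (x, 1) ?B"
      proof (cases "p = (x, 1)")
        case False
        then obtain z k where zk: "p = (z, k)" "z \<in> W x" "2 \<le> k" "k < n x z + 2" using p by (auto simp: A_def)
        have "n y z + 2 \<le> k"
        proof (cases "z \<in> W y")
          case True
          then show ?thesis using p zk by (auto simp: A_def)
        next
          case False
          then have "n y z = 0" using W0(3)[OF y] by (simp add: n_def)
          then show ?thesis using zk by simp
        qed
        then show ?thesis using zk by auto
      qed simp
    qed
    then have "card (A x - A y) \<le> card (insert (x, 1) ?B)" using W0(1)[OF x] by (intro card_mono) auto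
    also have "\<dots> \<le> card ?B + 1" using W0(1)[OF x] by (simp add: card_insert_if)
    also have "card ?B = (\<Sum>z\<in>W x. n x z - n y z)" using W0(1)[OF x] by (simp add: card_SigmaI)
    finally have "real (card (A x - A y)) \<le> (\<Sum>z\<in>W x. real (n x z - n y z)) + 1"
      by (simp flip: of_nat_sum)
    also have "(\<Sum>z\<in>W x. real (n x z - n y z)) \<le> (\<Sum>z\<in>W x. Q * \<bar>h x z - h y z\<bar> + 1)"
    proof (rule sum_mono)
      fix z
      have "Q * (h x z - h y z) \<le> Q * \<bar>h x z - h y z\<bar>" using Q0 by (intro mult_left_mono) auto
      moreover have "0 \<le> Q * \<bar>h x z - h y z\<bar>" using Q0 by simp
      ultimately show "real (n x z - n y z) \<le> Q * \<bar>h x z - h y z\<bar> + 1"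
        using n(1)[OF x, of z] n(2)[OF y, of z] by (simp add: right_diff_distrib of_nat_diff_if)
    qed
    also have "\<dots> = Q * (\<Sum>z\<in>W x. \<bar>h x z - h y z\<bar>) + real (card (W x))"
      by (simp add: sum.distrib sum_distrib_left)
    also have "\<dots> \<le> Q * \<delta> + real N"
      using h x y xy W0(1)[OF x] cW[OF x] Q0 by (intro add_mono mult_left_mono) auto
    finally show ?thesis by simp
  qed
  show "\<exists>R>0. \<exists>A :: 'a \<Rightarrow> ('a \<times> nat) set.
     (\<forall>x\<in>mspace X. finite (A x) \<and> A x \<subseteq> mspace X \<times> UNIV \<and> (x, 1) \<in> A x) \<and>
     (\<forall>x\<in>mspace X. \<forall>y\<in>mspace X. mdist X x y \<le> r \<longrightarrow>
        A x \<inter> A y \<noteq> {} \<and> real (card (sym_diff (A x) (A y))) / real (card (A x \<inter> A y)) < \<epsilon>) \<and>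
     (\<forall>x\<in>mspace X. \<forall>(y, m)\<in>A x. \<forall>(z, n)\<in>A x. mdist X y z \<le> R)"
  proof (rule exI[of _ "2 * D"], intro conjI, simp add: D, rule exI[of _ A], intro conjI ballI impI)
    fix x assume x: "x \<in> mspace X"
    show "finite (A x)" using finA[OF x] .
    have WX: "W x \<subseteq> mspace X" "\<forall>z\<in>W x. mdist X x z \<le> D" using W[THEN bspec, OF x] by blast+
    show "A x \<subseteq> mspace X \<times> UNIV" using WX(1) x by (auto simp: A_def)
    show "(x, 1) \<in> A x" by (simp add: A_def)
    fix p assume p: "p \<in> A x"
    have near: "fst q \<in> mspace X \<and> mdist X x (fst q) \<le> D" if "q \<in> A x" for q
    proof (cases "q = (x, 1)")
      case True
      then show ?thesis using x D by (simp add: mdist_self)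
    next
      case False
      then have "fst q \<in> W x" using that by (auto simp: A_def)
      then show ?thesis using WX by blast
    qed
    show "case p of (y, m) \<Rightarrow> \<forall>(z, n)\<in>A x. mdist X y z \<le> 2 * D"
    proof (clarify, cases p)
      fix y m z k a b assume "p = (y, m)" and zk: "(z, k) \<in> A x"
      have y: "y \<in> mspace X" "mdist X x y \<le> D" using near[OF p] \<open>p = (y, m)\<close> by auto
      have z: "z \<in> mspace X" "mdist X x z \<le> D" using near[OF zk] by auto
      show "mdist X y z \<le> 2 * D" using mdist_triangle[OF y(1) x z(1)] y(2) z(2) by (simp add: mdist_commute)
    qed
  next
    fix x y assume x: "x \<in> mspace X" and y: "y \<in> mspace X" and xy: "mdist X x y \<le> r"
    have yx: "mdist X y x \<le> r" using xy by (simp add: mdist_commute)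
    have "card (A x) = card (A x \<inter> A y) + card (A x - A y)"
      using finA[OF x] card_Un_disjoint[of "A x \<inter> A y" "A x - A y"] by (simp add: Int_Diff_disjoint Int_Diff_Un)
    then have inter: "real (card (A x \<inter> A y)) \<ge> Q - real N - (Q * \<delta> + real N + 1)"
      using cardA[OF x] diff[OF x y xy] by linarith
    have "Q * \<delta> \<le> Q / 4" using \<delta>(2) Q0 by (simp add: field_simps)
    then have inter2: "real (card (A x \<inter> A y)) \<ge> Q / 2"
    proof -
      have "2 * real N + 1 \<le> Q / 4" using Q(1) by simp
      then have "Q / 2 \<le> Q - real N - (Q * \<delta> + real N + 1)" using \<open>Q * \<delta> \<le> Q / 4\<close> by argo
      then show ?thesis using inter by (rule order_trans)
    qed
    then have pos: "real (card (A x \<inter> A y)) > 0" using Q0 by linarith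
    then show "A x \<inter> A y \<noteq> {}" by auto
    have "real (card (sym_diff (A x) (A y))) \<le> real (card (A x - A y)) + real (card (A y - A x))"
      unfolding of_nat_add[symmetric] of_nat_le_iff by (rule card_Un_le)
    also have "\<dots> \<le> (Q * \<delta> + real N + 1) + (Q * \<delta> + real N + 1)"
      by (rule add_mono[OF diff[OF x y xy] diff[OF y x yx]])
    also have "\<dots> = 2 * (Q * \<delta> + real N + 1)" by (rule mult_2[symmetric])
    finally have "real (card (sym_diff (A x) (A y))) \<le> 2 * (Q * \<delta> + real N + 1)" .
    also have "\<dots> < \<epsilon> * (Q / 2)"
    proof -
      have "Q * \<delta> \<le> \<epsilon> * Q / 16" using mult_left_mono[OF \<delta>(3), of Q] Q0 by (simp add: mult.commute)
      moreover have "\<epsilon> * Q > 0" using \<epsilon> Q0 by simp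
      ultimately show ?thesis using Q\<epsilon> by (simp add: field_simps)
    qed
    also have "\<dots> \<le> \<epsilon> * real (card (A x \<inter> A y))" using inter2 \<epsilon> by (intro mult_left_mono) auto
    finally show "real (card (sym_diff (A x) (A y))) / real (card (A x \<inter> A y)) < \<epsilon>"
      using pos by (simp add: pos_divide_less_eq)
  qed
qed

lemma almost_invariant_densities_empty: "almost_invariant_densities X {}"
  unfolding almost_invariant_densities_def by (auto intro!: exI[of _ 1])

lemma property_A_transfer:
  assumes pw: "piecewise_coarse_finite_to_one X Y" and ulf: "ulf X" "ulf Y" and Y: "property_A Y"
  shows "property_A X"
proof (rule densities_property_A[OF ulf(1)], rule piecewise_induct[OF pw])
  show "almost_invariant_densities X S" if "coarse_finite_to_one X Y S f" for S f
    using almost_invariant_densities_preimage[OF that ulf(2) property_A_densities[OF Y]] .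
qed (auto intro: almost_invariant_densities_Un almost_invariant_densities_empty)

section \<open>Operators on square-summable functions\<close>

lemma ell2_eqI: "(\<And>x. ell2_fun f x = ell2_fun g x) \<Longrightarrow> f = g"
  by (simp add: ell2_fun_inject[symmetric] fun_eq_iff)

lemma ell2_fun_minus: "ell2_fun (f - g) x = ell2_fun f x - ell2_fun g x"
  by (simp only: minus_ell2_def plus_ell2.rep_eq uminus_ell2.rep_eq) simp

lemma cinner_self: "cinner f f = of_real ((norm f)\<^sup>2)"
proof -
  have "cinner f f = of_real (\<Sum>\<^sub>\<infinity>x. (cmod (ell2_fun f x))\<^sup>2)"
    by transfer (rule infsum_mult_cnj_self)
  then show ?thesis by (simp add: norm_ell2 infsum_nonneg)
qed

lemma norm_delta: "norm (delta x) = 1"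
proof -
  have "cinner (delta x) (delta x) = 1" by (simp add: cinner_delta_right delta.rep_eq)
  then show ?thesis by (simp add: norm_ell2_def)
qed

lemma cmod_ell2_fun_le: "cmod (ell2_fun f x) \<le> norm f"
  using norm_cinner_le[of f "delta x"] by (simp add: cinner_delta_right norm_delta)

definition complex_linear :: "'a op2 \<Rightarrow> bool" where
  "complex_linear a \<longleftrightarrow> (\<forall>c f. blinfun_apply a (cscale c f) = cscale c (blinfun_apply a f))"

lemma bounded_ops_complex_linear: "a \<in> bounded_ops S \<Longrightarrow> complex_linear a"
  by (simp add: bounded_ops_def complex_linear_def)

lemma op_adj_eqI:
  assumes "\<And>f g. cinner (blinfun_apply a f) g = cinner f (blinfun_apply b g)"
  shows "op_adj a = b"
  unfolding op_adj_def
proof (rule the_equality)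
  show "\<forall>f g. cinner (blinfun_apply a f) g = cinner f (blinfun_apply b g)" using assms by blast
  fix b' assume b': "\<forall>f g. cinner (blinfun_apply a f) g = cinner f (blinfun_apply b' g)"
  show "b' = b"
  proof (intro blinfun_eqI ell2_eqI)
    fix g x
    have "cinner (delta x) (blinfun_apply b' g) = cinner (delta x) (blinfun_apply b g)"
      using assms b' by metis
    then show "ell2_fun (blinfun_apply b' g) x = ell2_fun (blinfun_apply b g) x"
      by (simp add: cinner_delta_left)
  qed
qed

lemma cinner_op_adj:
  assumes "complex_linear a"
  shows "cinner (blinfun_apply a f) g = cinner f (blinfun_apply (op_adj a) g)"
proof -
  have "\<forall>f g. cinner (blinfun_apply a f) g = cinner f (blinfun_apply (op_adj a) g)"
    unfolding op_adj_def
    by (rule theI') (rule op_adj_ex1, use assms in \<open>simp add: complex_linear_def\<close>)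
  then show ?thesis by blast
qed

subsection \<open>The uniform Roe algebra\<close>

lemma closed_bounded_ops: "closed (bounded_ops S)"
proof -
  have 1: "continuous_on UNIV (\<lambda>a :: 'a op2. blinfun_apply a f)" for f
    by (intro continuous_intros)
  have 2: "continuous_on UNIV (\<lambda>a :: 'a op2. cscale c (blinfun_apply a f))" for c f
    using 1 by (rule bounded_linear.continuous_on[OF bounded_linear_cscale])
  have 3: "continuous_on UNIV (\<lambda>a :: 'a op2. cinner (blinfun_apply a f) g)" for f g
    using 1 by (rule bounded_linear.continuous_on[OF bounded_linear_cinner_left])
  have eq: "bounded_ops S = (\<Inter>c. \<Inter>f. {a. blinfun_apply a (cscale c f) = cscale c (blinfun_apply a f)})
      \<inter> (\<Inter>f\<in>{f. \<forall>x\<in>S. ell2_fun f x = 0}. {a. blinfun_apply a f = 0})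
      \<inter> (\<Inter>f. \<Inter>y\<in>- S. {a. cinner (blinfun_apply a f) (delta y) = 0})"
    by (auto simp: bounded_ops_def cinner_delta_right)
  show ?thesis
    unfolding eq by (intro closed_Int closed_INT ballI closed_Collect_eq 1 2 3 continuous_on_const)
qed

lemma uniform_roe_bounded_ops: "uniform_roe X \<subseteq> bounded_ops (mspace X)"
  unfolding uniform_roe_def by (rule closure_minimal[OF _ closed_bounded_ops]) auto

lemma uniform_roe_complex_linear: "a \<in> uniform_roe X \<Longrightarrow> complex_linear a"
  using uniform_roe_bounded_ops bounded_ops_complex_linear by blast

definition has_propagation :: "'a metric \<Rightarrow> real \<Rightarrow> 'a op2 \<Rightarrow> bool" where
  "has_propagation X s b \<longleftrightarrow> b \<in> bounded_ops (mspace X) \<and> (\<forall>x\<in>mspace X. \<forall>y\<in>mspace X.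
     mdist X x y > s \<longrightarrow> ell2_fun (blinfun_apply b (delta x)) y = 0)"

definition approximable :: "'a metric \<Rightarrow> real \<Rightarrow> real \<Rightarrow> 'a op2 \<Rightarrow> bool" where
  "approximable X s \<epsilon> a \<longleftrightarrow> (\<exists>b. has_propagation X s b \<and> norm (a - b) \<le> \<epsilon>)"

lemma has_propagation_mono: "has_propagation X s b \<Longrightarrow> s \<le> t \<Longrightarrow> has_propagation X t b"
  unfolding has_propagation_def by force

lemma approximable_mono: "approximable X s \<epsilon> a \<Longrightarrow> s \<le> t \<Longrightarrow> approximable X t \<epsilon> a"
  unfolding approximable_def using has_propagation_mono by blast

lemma uniform_roe_approximable:
  assumes "a \<in> uniform_roe X" "\<epsilon> > 0"
  shows "\<exists>s>0. approximable X s \<epsilon> a"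
proof -
  obtain b where b: "b \<in> bounded_ops (mspace X)" "finite_propagation X b" "dist b a < \<epsilon>"
    using assms unfolding uniform_roe_def closure_approachable by blast
  obtain s where s: "s > 0" "\<forall>x\<in>mspace X. \<forall>y\<in>mspace X.
     mdist X x y > s \<longrightarrow> cinner (blinfun_apply b (delta x)) (delta y) = 0"
    using b(2) unfolding finite_propagation_def by blast
  then have "has_propagation X s b" using b(1) by (simp add: has_propagation_def cinner_delta_right)
  moreover have "norm (a - b) \<le> \<epsilon>" using b(3) by (simp add: dist_norm norm_minus_commute)
  ultimately show ?thesis using s(1) unfolding approximable_def by blast
qed

subsection \<open>Partial translations\<close>

lemma square_summable_partial:
  fixes f :: "'a \<Rightarrow> complex"
  assumes f: "(\<lambda>x. (cmod (f x))\<^sup>2) summable_on UNIV" and inj: "inj_on \<tau> S"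
  shows "(\<lambda>z. (cmod (if z \<in> S then f (\<tau> z) else 0))\<^sup>2) summable_on UNIV"
    and "(\<Sum>\<^sub>\<infinity>z. (cmod (if z \<in> S then f (\<tau> z) else 0))\<^sup>2) \<le> (\<Sum>\<^sub>\<infinity>x. (cmod (f x))\<^sup>2)"
proof -
  let ?g = "\<lambda>x. (cmod (f x))\<^sup>2"
  have im: "?g summable_on (\<tau> ` S)" using f by (rule summable_on_subset_banach) simp
  then have "(?g \<circ> \<tau>) summable_on S" by (rule summable_on_reindex[OF inj, THEN iffD1])
  then show "(\<lambda>z. (cmod (if z \<in> S then f (\<tau> z) else 0))\<^sup>2) summable_on UNIV"
    by (rule summable_on_cong_neutral[THEN iffD1, rotated -1]) auto
  have "(\<Sum>\<^sub>\<infinity>z. (cmod (if z \<in> S then f (\<tau> z) else 0))\<^sup>2) = infsum (?g \<circ> \<tau>) S"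
    by (rule infsum_cong_neutral) auto
  also have "\<dots> = infsum ?g (\<tau> ` S)" by (rule infsum_reindex[OF inj, symmetric])
  also have "\<dots> \<le> infsum ?g UNIV" using im f by (rule infsum_mono_neutral) auto
  finally show "(\<Sum>\<^sub>\<infinity>z. (cmod (if z \<in> S then f (\<tau> z) else 0))\<^sup>2) \<le> infsum ?g UNIV" .
qed

text \<open>
  The operator sends \<open>\<delta>\<close> at \<open>\<tau> z\<close> to \<open>\<delta>\<close> at \<open>z\<close>, for \<open>z \<in> S\<close>. It is set to \<open>0\<close> when \<open>\<tau>\<close> is not
  injective on \<open>S\<close>, so that it is bounded for all arguments.
\<close>
lift_definition partial_pullback :: "'a set \<Rightarrow> ('a \<Rightarrow> 'a) \<Rightarrow> 'a ell2 \<Rightarrow> 'a ell2" is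
  "\<lambda>S \<tau> f z. if inj_on \<tau> S \<and> z \<in> S then f (\<tau> z) else 0"
proof -
  fix S :: "'a set" and \<tau> :: "'a \<Rightarrow> 'a" and f :: "'a \<Rightarrow> complex"
  assume "(\<lambda>x. (cmod (f x))\<^sup>2) summable_on UNIV"
  then show "(\<lambda>z. (cmod (if inj_on \<tau> S \<and> z \<in> S then f (\<tau> z) else 0))\<^sup>2) summable_on UNIV"
    using square_summable_partial(1) by (cases "inj_on \<tau> S") auto
qed

lemma norm_partial_pullback_le: "norm (partial_pullback S \<tau> f) \<le> norm f"
proof (cases "inj_on \<tau> S")
  case True
  have "(\<Sum>\<^sub>\<infinity>z. (cmod (if z \<in> S then ell2_fun f (\<tau> z) else 0))\<^sup>2) \<le> (\<Sum>\<^sub>\<infinity>x. (cmod (ell2_fun f x))\<^sup>2)"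
    by (rule square_summable_partial(2)[OF square_summable_ell2_fun True])
  then show ?thesis by (simp add: norm_ell2 partial_pullback.rep_eq True)
next
  case False
  then have "partial_pullback S \<tau> f = 0"
    by (intro ell2_eqI) (simp add: partial_pullback.rep_eq zero_ell2.rep_eq)
  then show ?thesis by simp
qed

definition partial_translation :: "'a set \<Rightarrow> ('a \<Rightarrow> 'a) \<Rightarrow> 'a op2" where
  "partial_translation S \<tau> = Blinfun (partial_pullback S \<tau>)"

lemma partial_translation_apply: "blinfun_apply (partial_translation S \<tau>) = partial_pullback S \<tau>"
  unfolding partial_translation_def
proof (rule bounded_linear_Blinfun_apply, rule bounded_linear_intro[where K = 1])
  show "partial_pullback S \<tau> (f + g) = partial_pullback S \<tau> f + partial_pullback S \<tau> g" for f g
    by (intro ell2_eqI) (simp add: partial_pullback.rep_eq plus_ell2.rep_eq)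
  show "partial_pullback S \<tau> (r *\<^sub>R f) = r *\<^sub>R partial_pullback S \<tau> f" for r f
    by (intro ell2_eqI) (simp add: partial_pullback.rep_eq scaleR_ell2_def cscale.rep_eq)
  show "norm (partial_pullback S \<tau> f) \<le> norm f * 1" for f using norm_partial_pullback_le by simp
qed

lemma ell2_fun_partial_translation:
  "inj_on \<tau> S \<Longrightarrow> ell2_fun (blinfun_apply (partial_translation S \<tau>) f) z = (if z \<in> S then ell2_fun f (\<tau> z) else 0)"
  by (simp add: partial_translation_apply partial_pullback.rep_eq)

lemma op_eqI: "(\<And>f z. ell2_fun (blinfun_apply a f) z = ell2_fun (blinfun_apply b f) z) \<Longrightarrow> a = b"
  by (intro blinfun_eqI ell2_eqI)

lemma partial_translation_compose:
  assumes "inj_on \<tau> S" "inj_on \<rho> T"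
  shows "partial_translation S \<tau> o\<^sub>L partial_translation T \<rho> = partial_translation {z \<in> S. \<tau> z \<in> T} (\<rho> \<circ> \<tau>)"
proof (rule op_eqI)
  fix f z
  have inj: "inj_on (\<rho> \<circ> \<tau>) {z \<in> S. \<tau> z \<in> T}"
  proof (rule inj_onI)
    fix x y assume *: "x \<in> {z \<in> S. \<tau> z \<in> T}" "y \<in> {z \<in> S. \<tau> z \<in> T}" "(\<rho> \<circ> \<tau>) x = (\<rho> \<circ> \<tau>) y"
    then have "\<tau> x = \<tau> y" using inj_onD[OF assms(2)] by simp
    then show "x = y" using * inj_onD[OF assms(1)] by simp
  qed
  show "ell2_fun (blinfun_apply (partial_translation S \<tau> o\<^sub>L partial_translation T \<rho>) f) z
      = ell2_fun (blinfun_apply (partial_translation {z \<in> S. \<tau> z \<in> T} (\<rho> \<circ> \<tau>)) f) z"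
    by (simp add: ell2_fun_partial_translation assms inj)
qed

lemma partial_translation_cong:
  assumes "S = T" "\<And>z. z \<in> S \<Longrightarrow> \<tau> z = \<rho> z"
  shows "partial_translation S \<tau> = partial_translation T \<rho>"
proof -
  have "inj_on \<tau> S = inj_on \<rho> T" using assms inj_on_cong[of S \<tau> \<rho>] by simp
  then show ?thesis
    using assms by (intro op_eqI) (simp add: partial_translation_apply partial_pullback.rep_eq)
qed

lemma partial_translation_Un:
  assumes "inj_on \<tau> (S \<union> T)" "S \<inter> T = {}"
  shows "partial_translation (S \<union> T) \<tau> = partial_translation S \<tau> + partial_translation T \<tau>"
proof -
  have "inj_on \<tau> S" "inj_on \<tau> T" using assms(1) by (auto intro: inj_on_subset)
  then show ?thesis
    using assms by (intro op_eqI) (auto simp: ell2_fun_partial_translation blinfun.add_left plus_ell2.rep_eq)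
qed

lemma op_adj_partial_translation:
  assumes inj: "inj_on \<tau> S"
  shows "op_adj (partial_translation S \<tau>) = partial_translation (\<tau> ` S) (inv_into S \<tau>)"
proof (rule op_adj_eqI)
  fix f g :: "'a ell2"
  have inj': "inj_on (inv_into S \<tau>) (\<tau> ` S)" by (rule inj_on_inv_into) simp
  have "cinner (blinfun_apply (partial_translation S \<tau>) f) g
      = (\<Sum>\<^sub>\<infinity>z. (if z \<in> S then ell2_fun f (\<tau> z) else 0) * cnj (ell2_fun g z))"
    by (simp add: cinner.rep_eq ell2_fun_partial_translation inj)
  also have "\<dots> = infsum ((\<lambda>w. ell2_fun f w * cnj (ell2_fun g (inv_into S \<tau> w))) \<circ> \<tau>) S"
    by (rule infsum_cong_neutral) (auto simp: inj)
  also have "\<dots> = infsum (\<lambda>w. ell2_fun f w * cnj (ell2_fun g (inv_into S \<tau> w))) (\<tau> ` S)"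
    by (rule infsum_reindex[OF inj, symmetric])
  also have "\<dots> = (\<Sum>\<^sub>\<infinity>w. ell2_fun f w * cnj (if w \<in> \<tau> ` S then ell2_fun g (inv_into S \<tau> w) else 0))"
    by (rule infsum_cong_neutral) auto
  also have "\<dots> = cinner f (blinfun_apply (partial_translation (\<tau> ` S) (inv_into S \<tau>)) g)"
    by (simp only: cinner.rep_eq ell2_fun_partial_translation[OF inj'])
  finally show "cinner (blinfun_apply (partial_translation S \<tau>) f) g
      = cinner f (blinfun_apply (partial_translation (\<tau> ` S) (inv_into S \<tau>)) g)" .
qed

lemma partial_translation_uniform_roe:
  assumes S: "S \<subseteq> mspace X" "\<tau> ` S \<subseteq> mspace X" and inj: "inj_on \<tau> S"
    and r: "\<And>z. z \<in> S \<Longrightarrow> mdist X (\<tau> z) z \<le> r"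
  shows "partial_translation S \<tau> \<in> uniform_roe X"
proof -
  have "partial_translation S \<tau> \<in> bounded_ops (mspace X)"
    unfolding bounded_ops_def
  proof (intro CollectI conjI allI impI)
    fix c f
    show "blinfun_apply (partial_translation S \<tau>) (cscale c f) = cscale c (blinfun_apply (partial_translation S \<tau>) f)"
      by (intro ell2_eqI) (simp add: ell2_fun_partial_translation inj cscale.rep_eq)
  next
    fix f assume "\<forall>x\<in>mspace X. ell2_fun f x = 0"
    then show "blinfun_apply (partial_translation S \<tau>) f = 0"
      using S by (intro ell2_eqI) (auto simp: ell2_fun_partial_translation inj zero_ell2.rep_eq)
  next
    fix f y assume "y \<notin> mspace X"
    then show "ell2_fun (blinfun_apply (partial_translation S \<tau>) f) y = 0"
      using S by (auto simp: ell2_fun_partial_translation inj)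
  qed
  moreover have "finite_propagation X (partial_translation S \<tau>)"
    unfolding finite_propagation_def
  proof (intro exI[of _ "\<bar>r\<bar> + 1"] conjI ballI impI)
    fix x y assume "mdist X x y > \<bar>r\<bar> + 1"
    then have "\<not> (y \<in> S \<and> \<tau> y = x)" using r by force
    then show "cinner (blinfun_apply (partial_translation S \<tau>) (delta x)) (delta y) = 0"
      by (auto simp: cinner_delta_right ell2_fun_partial_translation inj delta.rep_eq)
  qed simp
  ultimately show ?thesis unfolding uniform_roe_def by (intro closure_subset[THEN subsetD]) simp
qed

definition coord_projection :: "'a set \<Rightarrow> 'a op2" where
  "coord_projection A = partial_translation A (\<lambda>z. z)"

lemma ell2_fun_coord_projection:
  "ell2_fun (blinfun_apply (coord_projection A) f) z = (if z \<in> A then ell2_fun f z else 0)"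
  unfolding coord_projection_def by (rule ell2_fun_partial_translation) simp

lemma coord_projection_uniform_roe: "A \<subseteq> mspace X \<Longrightarrow> coord_projection A \<in> uniform_roe X"
  unfolding coord_projection_def
  by (rule partial_translation_uniform_roe[where r = 0]) (auto simp: mdist_self)

lemma norm_coord_projection_le: "norm (blinfun_apply (coord_projection A) f) \<le> norm f"
  unfolding coord_projection_def partial_translation_apply by (rule norm_partial_pullback_le)

lemma coord_projection_finite:
  "finite F \<Longrightarrow> blinfun_apply (coord_projection F) f = (\<Sum>x\<in>F. cscale (ell2_fun f x) (delta x))"
  by (intro ell2_eqI) (simp add: ell2_fun_coord_projection ell2_fun_sum_delta)

definition matrix_unit :: "'a \<Rightarrow> 'a \<Rightarrow> 'a op2" where
  "matrix_unit y x = partial_translation {y} (\<lambda>_. x)"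

lemma matrix_unit_uniform_roe: "x \<in> mspace X \<Longrightarrow> y \<in> mspace X \<Longrightarrow> matrix_unit y x \<in> uniform_roe X"
  unfolding matrix_unit_def by (rule partial_translation_uniform_roe[where r = "mdist X x y"]) auto

lemma matrix_unit_self: "matrix_unit x x = coord_projection {x}"
  unfolding matrix_unit_def coord_projection_def by (rule partial_translation_cong) auto

lemma matrix_unit_compose: "matrix_unit z y o\<^sub>L matrix_unit y x = matrix_unit z x"
  unfolding matrix_unit_def
  by (subst partial_translation_compose) (auto intro: partial_translation_cong)

lemma op_adj_matrix_unit: "op_adj (matrix_unit y x) = matrix_unit x y"
proof -
  have "inv_into {y} (\<lambda>_. x) x \<in> {y}" by (rule inv_into_into) simp
  then show ?thesis
    unfolding matrix_unit_def
    by (subst op_adj_partial_translation) (auto intro!: partial_translation_cong)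
qed

lemma matrix_unit_apply: "blinfun_apply (matrix_unit y x) f = cscale (ell2_fun f x) (delta y)"
  by (intro ell2_eqI) (simp add: matrix_unit_def ell2_fun_partial_translation cscale.rep_eq delta.rep_eq)

lemma bounded_linear_cscale_left: "bounded_linear (\<lambda>c. cscale c g)"
proof (rule bounded_linear_intro[where K = "norm g"])
  show "cscale (c + d) g = cscale c g + cscale d g" for c d
    by (intro ell2_eqI) (simp add: cscale.rep_eq plus_ell2.rep_eq distrib_right)
  show "cscale (r *\<^sub>R c) g = r *\<^sub>R cscale c g" for r c
    by (intro ell2_eqI) (simp add: cscale.rep_eq scaleR_ell2_def scaleR_conv_of_real mult.assoc)
  show "norm (cscale c g) \<le> norm c * norm g" for c by (simp add: norm_cscale)
qed

lemma compact_matrix_unit: "compact_op (matrix_unit y x)"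
proof -
  define K where "K = (\<lambda>c. cscale c (delta y)) ` cball 0 1"
  have "compact K"
    unfolding K_def
    by (intro compact_continuous_image bounded_linear.continuous_on[OF bounded_linear_cscale_left])
      (auto intro: continuous_on_id)
  have "blinfun_apply (matrix_unit y x) ` cball 0 1 \<subseteq> K"
  proof
    fix g assume "g \<in> blinfun_apply (matrix_unit y x) ` cball 0 1"
    then obtain f where f: "norm f \<le> 1" "g = cscale (ell2_fun f x) (delta y)"
      by (auto simp: matrix_unit_apply)
    then have "ell2_fun f x \<in> cball 0 1" using cmod_ell2_fun_le[of f x] by simp
    then show "g \<in> K" using f(2) by (simp add: K_def)
  qed
  then have "closure (blinfun_apply (matrix_unit y x) ` cball 0 1) \<subseteq> K"
    using \<open>compact K\<close> by (intro closure_minimal compact_imp_closed)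
  then have "closure (blinfun_apply (matrix_unit y x) ` cball 0 1)
      = K \<inter> closure (blinfun_apply (matrix_unit y x) ` cball 0 1)" by blast
  also have "compact \<dots>" using \<open>compact K\<close> by (rule compact_Int_closed) simp
  finally show ?thesis by (simp add: compact_op_def)
qed

lemma coord_projection_complement: "f - blinfun_apply (coord_projection A) f = blinfun_apply (coord_projection (- A)) f"
  by (intro ell2_eqI) (simp add: ell2_fun_minus ell2_fun_coord_projection)

text \<open>The unit ball is mapped into a totally bounded set, so finitely many coordinates suffice.\<close>
lemma compact_op_coord_approx:
  fixes a :: "'a op2"
  assumes a: "compact_op a" and e: "e > 0"
  shows "\<exists>G. finite G \<and> (\<forall>f. norm f \<le> 1 \<longrightarrow>
    norm (blinfun_apply (coord_projection (- G)) (blinfun_apply a f)) \<le> e)"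
proof -
  define K where "K = closure (blinfun_apply a ` cball 0 1)"
  have K: "compact K" using a by (simp add: K_def compact_op_def)
  have "K \<subseteq> (\<Union>v\<in>K. ball v (e / 2))" using e by auto
  then obtain k where k: "k \<subseteq> K" "finite k" "K \<subseteq> (\<Union>v\<in>k. ball v (e / 2))"
    using compactE_image[OF K, of K "\<lambda>v. ball v (e / 2)"] by auto
  have "\<exists>F. finite F \<and> (\<forall>G. finite G \<and> F \<subseteq> G \<longrightarrow> norm (blinfun_apply (coord_projection (- G)) v) \<le> e / 2)"
    for v :: "'a ell2"
  proof -
    have "\<forall>\<^sub>F F in finite_subsets_at_top UNIV. dist (\<Sum>x\<in>F. cscale (ell2_fun v x) (delta x)) v < e / 2"
      using e by (intro tendstoD[OF finite_support_approx]) simp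
    then obtain F where F: "finite F"
        "\<And>G. finite G \<Longrightarrow> F \<subseteq> G \<Longrightarrow> dist (\<Sum>x\<in>G. cscale (ell2_fun v x) (delta x)) v < e / 2"
      unfolding eventually_finite_subsets_at_top by auto
    have "norm (blinfun_apply (coord_projection (- G)) v) \<le> e / 2" if G: "finite G" "F \<subseteq> G" for G
      using F(2)[OF G] coord_projection_finite[OF G(1), of v]
      by (simp add: dist_norm norm_minus_commute flip: coord_projection_complement)
    then show ?thesis using F(1) by blast
  qed
  then obtain F :: "'a ell2 \<Rightarrow> 'a set" where F: "\<And>v. finite (F v)"
      "\<And>v G. finite G \<Longrightarrow> F v \<subseteq> G \<Longrightarrow> norm (blinfun_apply (coord_projection (- G)) v) \<le> e / 2" by metis
  define G where "G = (\<Union>v\<in>k. F v)"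
  have G: "finite G" using k(2) F(1) by (simp add: G_def)
  have "norm (blinfun_apply (coord_projection (- G)) (blinfun_apply a f)) \<le> e" if f: "norm f \<le> 1" for f
  proof -
    have "blinfun_apply a f \<in> K" unfolding K_def using f by (intro closure_subset[THEN subsetD]) auto
    then obtain v where v: "v \<in> k" "dist v (blinfun_apply a f) < e / 2" using k(3) by auto
    let ?p = "blinfun_apply (coord_projection (- G))"
    have "?p (blinfun_apply a f) = ?p (blinfun_apply a f - v) + ?p v" by (simp add: blinfun.diff_right)
    also have "norm \<dots> \<le> norm (?p (blinfun_apply a f - v)) + norm (?p v)" by (rule norm_triangle_ineq)
    also have "norm (?p (blinfun_apply a f - v)) \<le> norm (blinfun_apply a f - v)" by (rule norm_coord_projection_le)
    also have "\<dots> \<le> e / 2" using v(2) by (simp add: dist_norm norm_minus_commute)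
    also have "norm (?p v) \<le> e / 2" using v(1) G by (intro F(2)) (auto simp: G_def)
    finally show ?thesis by simp
  qed
  then show ?thesis using G by blast
qed

lemma cscale_diff: "cscale c (f - g) = cscale c f - cscale c g"
  by (intro ell2_eqI) (simp add: cscale.rep_eq ell2_fun_minus right_diff_distrib)

lemma has_propagation_diff:
  assumes "has_propagation X s a" "has_propagation X s b"
  shows "has_propagation X s (a - b)"
proof -
  have "a \<in> bounded_ops (mspace X)" "b \<in> bounded_ops (mspace X)"
    using assms by (auto simp: has_propagation_def)
  then have "a - b \<in> bounded_ops (mspace X)"
    by (simp add: bounded_ops_def blinfun.diff_left ell2_fun_minus cscale_diff)
  then show ?thesis using assms by (simp add: has_propagation_def blinfun.diff_left ell2_fun_minus)
qed

lemma has_propagation_coord_projection: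
  assumes "has_propagation X s b"
  shows "has_propagation X s (b o\<^sub>L coord_projection G)"
proof -
  have b: "b \<in> bounded_ops (mspace X)" using assms by (auto simp: has_propagation_def)
  have lin: "blinfun_apply (coord_projection G) (cscale c f) = cscale c (blinfun_apply (coord_projection G) f)" for c f
    by (intro ell2_eqI) (simp add: ell2_fun_coord_projection cscale.rep_eq)
  have "b o\<^sub>L coord_projection G \<in> bounded_ops (mspace X)"
    using b by (simp add: bounded_ops_def lin ell2_fun_coord_projection)
  moreover have "blinfun_apply (coord_projection G) (delta x) = (if x \<in> G then delta x else 0)" for x
    by (intro ell2_eqI) (simp add: ell2_fun_coord_projection delta.rep_eq zero_ell2.rep_eq)
  ultimately show ?thesis
    using assms by (simp add: has_propagation_def blinfun.zero_right zero_ell2.rep_eq)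
qed

section \<open>Embeddings of uniform Roe algebras\<close>

locale embedded_roe_algebra =
  fixes X :: "'a metric" and Y :: "'b metric" and \<Phi> :: "'a op2 \<Rightarrow> 'b op2"
  assumes embedding: "roe_embedding X Y \<Phi>"
begin

lemma image_uniform_roe: "a \<in> uniform_roe X \<Longrightarrow> \<Phi> a \<in> uniform_roe Y"
  using embedding by (auto simp: roe_embedding_def)

lemma hom_add: "a \<in> uniform_roe X \<Longrightarrow> b \<in> uniform_roe X \<Longrightarrow> \<Phi> (a + b) = \<Phi> a + \<Phi> b"
  using embedding by (simp add: roe_embedding_def)

lemma hom_compose: "a \<in> uniform_roe X \<Longrightarrow> b \<in> uniform_roe X \<Longrightarrow> \<Phi> (a o\<^sub>L b) = \<Phi> a o\<^sub>L \<Phi> b"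
  using embedding by (simp add: roe_embedding_def)

lemma hom_adj: "a \<in> uniform_roe X \<Longrightarrow> \<Phi> (op_adj a) = op_adj (\<Phi> a)"
  using embedding by (simp add: roe_embedding_def)

lemma hom_inj: "inj_on \<Phi> (uniform_roe X)"
  using embedding by (simp add: roe_embedding_def)

lemma cinner_hom:
  assumes "a \<in> uniform_roe X"
  shows "cinner (blinfun_apply (\<Phi> a) f) g = cinner f (blinfun_apply (\<Phi> (op_adj a)) g)"
  using cinner_op_adj[OF uniform_roe_complex_linear[OF image_uniform_roe[OF assms]]] hom_adj[OF assms] by simp

definition proj :: "'a set \<Rightarrow> 'b ell2 \<Rightarrow> 'b ell2" where
  "proj A = blinfun_apply (\<Phi> (coord_projection A))"

lemma proj_cscale:
  assumes "A \<subseteq> mspace X" shows "proj A (cscale c f) = cscale c (proj A f)"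
  using uniform_roe_complex_linear[OF image_uniform_roe[OF coord_projection_uniform_roe[OF assms]]]
  by (simp add: proj_def complex_linear_def)

lemma proj_sum: "proj A (\<Sum>x\<in>F. f x) = (\<Sum>x\<in>F. proj A (f x))"
  by (simp add: proj_def blinfun.sum_right)

lemma proj_compose:
  assumes "A \<subseteq> mspace X" "B \<subseteq> mspace X"
  shows "proj A (proj B f) = proj (A \<inter> B) f"
proof -
  have "coord_projection A o\<^sub>L coord_projection B = coord_projection (A \<inter> B)"
    by (rule op_eqI) (simp add: ell2_fun_coord_projection)
  then have "\<Phi> (coord_projection (A \<inter> B)) = \<Phi> (coord_projection A) o\<^sub>L \<Phi> (coord_projection B)"
    using hom_compose[OF coord_projection_uniform_roe[OF assms(1)] coord_projection_uniform_roe[OF assms(2)]]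
    by simp
  then show ?thesis by (simp add: proj_def)
qed

lemma op_adj_coord_projection: "op_adj (coord_projection A) = coord_projection A"
  unfolding coord_projection_def
  by (subst op_adj_partial_translation) (auto intro!: partial_translation_cong inv_into_f_eq)

lemma proj_adj:
  assumes "A \<subseteq> mspace X" shows "cinner (proj A f) g = cinner f (proj A g)"
  using cinner_hom[OF coord_projection_uniform_roe[OF assms], of f g]
  by (simp add: proj_def op_adj_coord_projection)

lemma D_Un:
  assumes "A \<subseteq> mspace X" "B \<subseteq> mspace X" "A \<inter> B = {}"
  shows "proj (A \<union> B) f = proj A f + proj B f"
proof -
  have "coord_projection (A \<union> B) = coord_projection A + coord_projection B"
    unfolding coord_projection_def using assms(3) by (intro partial_translation_Un) auto
  then have "\<Phi> (coord_projection (A \<union> B)) = \<Phi> (coord_projection A) + \<Phi> (coord_projection B)"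
    using hom_add[OF coord_projection_uniform_roe[OF assms(1)] coord_projection_uniform_roe[OF assms(2)]]
    by simp
  then show ?thesis by (simp add: proj_def blinfun.add_left)
qed

lemma norm_proj_square:
  assumes "A \<subseteq> mspace X" shows "(norm (proj A f))\<^sup>2 = Re (cinner (proj A f) f)"
proof -
  have "cinner (proj A f) (proj A f) = cinner (proj A (proj A f)) f" by (rule proj_adj[OF assms, symmetric])
  also have "proj A (proj A f) = proj A f" using proj_compose[OF assms assms] by simp
  finally have "of_real ((norm (proj A f))\<^sup>2) = cinner (proj A f) f" by (simp only: cinner_self)
  then show ?thesis by (metis Re_complex_of_real)
qed

lemma norm_proj_le:
  assumes "A \<subseteq> mspace X" shows "norm (proj A f) \<le> norm f"
proof -
  have "norm (proj A f) * norm (proj A f) \<le> norm (proj A f) * norm f"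
    using norm_proj_square[OF assms, of f] norm_cinner_le[of "proj A f" f] complex_Re_le_cmod[of "cinner (proj A f) f"]
    by (simp add: power2_eq_square)
  then show ?thesis by (cases "proj A f = 0") (auto simp: mult_le_cancel_left)
qed

lemma norm_proj_mono:
  assumes "A \<subseteq> B" "B \<subseteq> mspace X" shows "norm (proj A f) \<le> norm (proj B f)"
proof -
  have A: "A \<subseteq> mspace X" using assms by blast
  have "proj A f = proj A (proj B f)" using proj_compose[OF A assms(2)] assms(1) by (simp add: Int_absorb2)
  then show ?thesis using norm_proj_le[OF A, of "proj B f"] by simp
qed

lemma norm_proj_square_Un:
  assumes "A \<subseteq> mspace X" "B \<subseteq> mspace X" "A \<inter> B = {}"
  shows "(norm (proj (A \<union> B) f))\<^sup>2 = (norm (proj A f))\<^sup>2 + (norm (proj B f))\<^sup>2"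
proof -
  have "(norm (proj (A \<union> B) f))\<^sup>2 = Re (cinner (proj (A \<union> B) f) f)"
    by (rule norm_proj_square[OF Un_least[OF assms(1,2)]])
  also have "\<dots> = (norm (proj A f))\<^sup>2 + (norm (proj B f))\<^sup>2"
    by (simp add: D_Un[OF assms] cinner_add_left norm_proj_square assms(1,2))
  finally show ?thesis .
qed

lemma sum_norm_proj_square_le:
  assumes "finite F" "F \<subseteq> mspace X"
  shows "(\<Sum>x\<in>F. (norm (proj {x} f))\<^sup>2) \<le> (norm f)\<^sup>2"
proof -
  have "(\<Sum>x\<in>F. (norm (proj {x} f))\<^sup>2) \<le> (norm (proj F f))\<^sup>2"
    using assms
  proof (induction F rule: finite_induct)
    case (insert x F)
    then show ?case using norm_proj_square_Un[of "{x}" F f] by simp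
  qed simp
  also have "\<dots> \<le> (norm f)\<^sup>2" using norm_proj_le[OF assms(2)] by (intro power_mono) auto
  finally show ?thesis .
qed

text \<open>The square of the norm depends only on \<open>v\<^sup>* v\<close>, and \<open>v\<^sup>* v\<close> is a coordinate projection.\<close>
lemma norm_hom_partial_translation:
  assumes S: "S \<subseteq> mspace X" "\<tau> ` S \<subseteq> mspace X" and inj: "inj_on \<tau> S"
    and r: "\<And>z. z \<in> S \<Longrightarrow> mdist X (\<tau> z) z \<le> r"
  shows "norm (blinfun_apply (\<Phi> (partial_translation S \<tau>)) f) = norm (proj (\<tau> ` S) f)"
proof -
  define v where "v = partial_translation S \<tau>"
  have v: "v \<in> uniform_roe X" unfolding v_def by (rule partial_translation_uniform_roe[OF S inj r])
  have inj': "inj_on (inv_into S \<tau>) (\<tau> ` S)" by (rule inj_on_inv_into) simp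
  have adj: "op_adj v = partial_translation (\<tau> ` S) (inv_into S \<tau>)"
    unfolding v_def by (rule op_adj_partial_translation[OF inj])
  have adj_in: "op_adj v \<in> uniform_roe X"
    unfolding adj
  proof (rule partial_translation_uniform_roe[where r = r])
    show "inv_into S \<tau> ` \<tau> ` S \<subseteq> mspace X" using S inj by auto
    fix z assume "z \<in> \<tau> ` S"
    then show "mdist X (inv_into S \<tau> z) z \<le> r" using r inj by (auto simp: mdist_commute)
  qed (use S inj' in auto)
  have "op_adj v o\<^sub>L v = partial_translation (\<tau> ` S) (inv_into S \<tau>) o\<^sub>L partial_translation S \<tau>"
    unfolding adj by (simp only: v_def)
  also have "\<dots> = coord_projection (\<tau> ` S)"
    unfolding partial_translation_compose[OF inj' inj] coord_projection_def
    using inj by (intro partial_translation_cong) (auto simp: f_inv_into_f)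
  finally have comp0: "op_adj v o\<^sub>L v = coord_projection (\<tau> ` S)" .
  then have comp: "\<Phi> (op_adj v) o\<^sub>L \<Phi> v = \<Phi> (coord_projection (\<tau> ` S))"
    using hom_compose[OF adj_in v] by simp
  let ?T = "blinfun_apply (\<Phi> v)"
  have "of_real ((norm (?T f))\<^sup>2) = cinner (?T f) (?T f)" by (rule cinner_self[symmetric])
  also have "\<dots> = cinner f (blinfun_apply (\<Phi> (op_adj v)) (?T f))" by (rule cinner_hom[OF v])
  also have "blinfun_apply (\<Phi> (op_adj v)) (?T f) = proj (\<tau> ` S) f"
    using comp by (metis proj_def blinfun_apply_blinfun_compose)
  also have "cinner f (proj (\<tau> ` S) f) = cinner (proj (\<tau> ` S) f) f" by (rule proj_adj[OF S(2), symmetric])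
  finally have "(norm (?T f))\<^sup>2 = (norm (proj (\<tau> ` S) f))\<^sup>2"
    using norm_proj_square[OF S(2), of f] by (metis Re_complex_of_real)
  then show ?thesis by (simp add: v_def)
qed

text \<open>
  Infinitely many orthogonal projections cannot all be large on a finite set: of two disjoint halves
  of an index set one has at most half of the mass.
\<close>
lemma exists_subset_small_on_finite:
  fixes x :: "nat \<Rightarrow> 'a"
  assumes x: "inj x" "range x \<subseteq> mspace X" and A: "infinite A" and G: "finite (G :: 'b set)" and e: "e > 0"
  shows "\<exists>B\<subseteq>A. infinite B \<and> (\<forall>f. norm (proj (x ` B) (blinfun_apply (coord_projection G) f)) \<le> e * norm f)"
proof -
  define val where "val B = (\<Sum>y\<in>G. (norm (proj (x ` B) (delta y)))\<^sup>2)" for B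
  have xM: "x ` B \<subseteq> mspace X" for B using x(2) by auto
  have "\<exists>B\<subseteq>A. infinite B \<and> val B \<le> real (card G) / 2 ^ n" for n
  proof (induction n)
    case 0
    have "val A \<le> (\<Sum>y\<in>G. 1)"
      unfolding val_def using norm_proj_le[OF xM] by (intro sum_mono) (metis norm_delta norm_ge_zero power_le_one)
    then show ?case using A by auto
  next
    case (Suc n)
    then obtain B where B: "B \<subseteq> A" "infinite B" "val B \<le> real (card G) / 2 ^ n" by blast
    obtain B1 B2 where B12: "B1 \<subseteq> B" "B2 \<subseteq> B" "infinite B1" "infinite B2" "B1 \<inter> B2 = {}"
      using infinite_split[OF B(2)] .
    have "val B1 + val B2 = val (B1 \<union> B2)"
    proof -
      have "x ` B1 \<inter> x ` B2 = {}" using B12(5) x(1) by (simp add: image_Int[symmetric])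
      then show ?thesis
        unfolding val_def image_Un by (simp add: norm_proj_square_Un[OF xM xM] sum.distrib)
    qed
    also have "\<dots> \<le> val B"
      unfolding val_def using B12 by (intro sum_mono power_mono norm_proj_mono[OF _ xM]) auto
    finally have "val B1 \<le> real (card G) / 2 ^ Suc n \<or> val B2 \<le> real (card G) / 2 ^ Suc n"
      using B(3) by auto
    then show ?case using B12 B(1) by (meson order_trans)
  qed
  note halving = this
  define c where "c = e / (real (card G) + 1)"
  have c: "c > 0" using e by (simp add: c_def)
  obtain n where n: "(1 / 2) ^ n < c\<^sup>2 / (real (card G) + 1)"
    using real_arch_pow_inv[of "c\<^sup>2 / (real (card G) + 1)" "1 / 2"] c by auto
  obtain B where B: "B \<subseteq> A" "infinite B" "val B \<le> real (card G) / 2 ^ n" using halving by blast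
  have "real (card G) / 2 ^ n = real (card G) * (1 / 2) ^ n" by (simp add: power_divide)
  also have "\<dots> \<le> (real (card G) + 1) * (c\<^sup>2 / (real (card G) + 1))" using n by (intro mult_mono) auto
  also have "\<dots> = c\<^sup>2" by simp
  finally have valB: "val B \<le> c\<^sup>2" using B(3) by simp
  have small: "norm (proj (x ` B) (delta y)) \<le> c" if "y \<in> G" for y
  proof -
    have "(norm (proj (x ` B) (delta y)))\<^sup>2 \<le> val B"
      unfolding val_def using G that by (intro member_le_sum) auto
    then have "(norm (proj (x ` B) (delta y)))\<^sup>2 \<le> c\<^sup>2" using valB by simp
    then show ?thesis using c by (simp add: power2_le_iff_abs_le)
  qed
  have "norm (proj (x ` B) (blinfun_apply (coord_projection G) f)) \<le> e * norm f" for f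
  proof -
    have "proj (x ` B) (blinfun_apply (coord_projection G) f) = (\<Sum>y\<in>G. cscale (ell2_fun f y) (proj (x ` B) (delta y)))"
      by (simp add: coord_projection_finite[OF G] proj_sum proj_cscale[OF xM])
    also have "norm \<dots> \<le> (\<Sum>y\<in>G. norm f * c)"
      using small cmod_ell2_fun_le[of f] by (intro sum_norm_le) (auto simp: norm_cscale intro: mult_mono)
    also have "\<dots> = (real (card G) * c) * norm f" by simp
    also have "\<dots> \<le> e * norm f"
      using e by (intro mult_right_mono) (auto simp: c_def field_simps)
    finally show ?thesis .
  qed
  then show ?thesis using B by blast
qed

end

locale compactly_embedded_roe_algebra = embedded_roe_algebra +
  assumes compact: "compact_preserving X \<Phi>"
begin

lemma norm_matrix_unit:
  assumes "x \<in> mspace X" "y \<in> mspace X"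
  shows "norm (blinfun_apply (\<Phi> (matrix_unit y x)) f) = norm (proj {x} f)"
  using norm_hom_partial_translation[of "{y}" "\<lambda>_. x" "mdist X x y" f] assms by (simp add: matrix_unit_def)

text \<open>
  Compactness gives this on the left of the projection; the projection property moves it to the right.
\<close>
lemma proj_singleton_coord_approx:
  assumes x: "x \<in> mspace X" and e: "e > 0"
  shows "\<exists>G. finite G \<and> (\<forall>f. norm (proj {x} (blinfun_apply (coord_projection (- G)) f)) \<le> e * norm f)"
proof -
  have x': "{x} \<subseteq> mspace X" using x by simp
  have "compact_op (\<Phi> (coord_projection {x}))"
    using compact compact_matrix_unit[of x x] coord_projection_uniform_roe[OF x']
    by (simp add: compact_preserving_def matrix_unit_self)
  moreover have "e\<^sup>2 > 0" using e by simp
  ultimately obtain G where G: "finite G"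
      "\<forall>f. norm f \<le> 1 \<longrightarrow> norm (blinfun_apply (coord_projection (- G)) (proj {x} f)) \<le> e\<^sup>2"
    using compact_op_coord_approx[of "\<Phi> (coord_projection {x})" "e\<^sup>2"] unfolding proj_def by blast
  let ?p = "blinfun_apply (coord_projection (- G))"
  have pp: "cinner g (?p f) = cinner (?p g) f" for f g :: "'b ell2"
  proof -
    have "complex_linear (coord_projection (- G))"
      by (simp add: complex_linear_def) (intro allI ell2_eqI, simp add: ell2_fun_coord_projection cscale.rep_eq)
    from cinner_op_adj[OF this] show ?thesis by (simp add: op_adj_coord_projection)
  qed
  have unit: "norm (proj {x} (?p f)) \<le> e" if f: "norm f \<le> 1" for f
  proof -
    have pf: "norm (?p f) \<le> 1" using norm_coord_projection_le[of "- G" f] f by linarith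
    have "(norm (proj {x} (?p f)))\<^sup>2 = Re (cinner (proj {x} (?p f)) (?p f))" by (rule norm_proj_square[OF x'])
    also have "\<dots> \<le> cmod (cinner (?p (proj {x} (?p f))) f)" unfolding pp by (rule complex_Re_le_cmod)
    also have "\<dots> \<le> norm (?p (proj {x} (?p f))) * norm f" by (rule norm_cinner_le)
    also have "\<dots> \<le> e\<^sup>2 * 1" using G(2) pf f by (intro mult_mono) auto
    finally show ?thesis using e by (simp add: power2_le_iff_abs_le)
  qed
  have "norm (proj {x} (?p f)) \<le> e * norm f" for f
  proof (cases "f = 0")
    case False
    define g where "g = (1 / norm f) *\<^sub>R f"
    have "norm g \<le> 1" using False by (simp add: g_def)
    from unit[OF this] have "norm (proj {x} (?p f)) / norm f \<le> e"
      by (simp add: g_def proj_def blinfun.scaleR_right)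
    then show ?thesis using False by (simp add: pos_divide_le_eq)
  qed (simp add: proj_def blinfun.zero_right)
  then show ?thesis using G(1) by blast
qed

end

subsection \<open>Uniform approximability of the images of matrix units\<close>

context compactly_embedded_roe_algebra
begin

text \<open>
  A gliding hump. If the claim fails, there are matrix units \<open>a\<^sub>n\<close> with distinct sources and distinct
  ranges whose images are approximable only at scales tending to infinity. A subsequence is chosen
  such that the tail of its sum is small on a finite set \<open>G\<close> that carries almost all of the current
  term, while the part of the sum before this term is approximable at a scale at which the
  current term is not. The whole sum lies in the algebra and is approximable at some scale; on \<open>G\<close>, beyond
  this scale, the current term is then a difference of approximable operators.
\<close>
lemma matrix_units_uniformly_approximable:
  assumes ulf: "ulf X" and \<epsilon>: "\<epsilon> > 0"
  shows "\<exists>s>0. \<forall>x\<in>mspace X. \<forall>y\<in>mspace X. mdist X x y \<le> r \<longrightarrow> approximable Y s \<epsilon> (\<Phi> (matrix_unit y x))"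
proof (rule ccontr)
  assume neg: "\<not> ?thesis"
  define bad where "bad s p \<longleftrightarrow> fst p \<in> mspace X \<and> snd p \<in> mspace X \<and> mdist X (fst p) (snd p) \<le> r
      \<and> \<not> approximable Y s \<epsilon> (\<Phi> (matrix_unit (snd p) (fst p)))" for s p
  have ex_bad: "\<exists>p. bad s p" if s: "s > 0" for s
  proof -
    obtain x y where "x \<in> mspace X" "y \<in> mspace X" "mdist X x y \<le> r" "\<not> approximable Y s \<epsilon> (\<Phi> (matrix_unit y x))"
      using neg s by blast
    then have "bad s (x, y)" by (simp add: bad_def)
    then show ?thesis by blast
  qed
  have bad_mono: "bad s p" if "bad t p" "s \<le> t" for s t p
    using that approximable_mono unfolding bad_def by blast
  (* only finitely many pairs of points at distance at most r share a point with the earlier pairs *)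
  have step: "\<exists>p. bad (real n) p \<and> (\<forall>m<n. fst (P m) \<noteq> fst p \<and> snd (P m) \<noteq> snd p)"
    if P: "\<And>m. m < n \<Longrightarrow> bad (real m) (P m)" for n P
  proof -
    define E where "E = (\<Union>m\<in>{..<n}. {fst (P m)} \<times> {y \<in> mspace X. mdist X (fst (P m)) y \<le> \<bar>r\<bar>})
        \<union> (\<Union>m\<in>{..<n}. {x \<in> mspace X. mdist X (snd (P m)) x \<le> \<bar>r\<bar>} \<times> {snd (P m)})"
    have ball: "finite {y \<in> mspace X. mdist X x y \<le> \<bar>r\<bar>}" if "x \<in> mspace X" for x
      using ulf_ball_card[OF ulf, of "\<bar>r\<bar>"] that by auto
    have finE: "finite E"
    proof -
      have PM: "fst (P m) \<in> mspace X \<and> snd (P m) \<in> mspace X" if "m < n" for m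
        using P[OF that] by (simp add: bad_def)
      show ?thesis
        unfolding E_def
        by (intro finite_UnI finite_UN_I finite_lessThan finite_cartesian_product finite.emptyI finite.insertI ball)
          (simp_all add: PM)
    qed
    have "\<exists>s>0. \<not> bad s q" for q
    proof (cases "fst q \<in> mspace X \<and> snd q \<in> mspace X")
      case True
      then have "\<Phi> (matrix_unit (snd q) (fst q)) \<in> uniform_roe Y"
        by (intro image_uniform_roe matrix_unit_uniform_roe) auto
      from uniform_roe_approximable[OF this \<epsilon>] show ?thesis by (auto simp: bad_def)
    next
      case False
      then have "\<not> bad 1 q" unfolding bad_def by blast
      then show ?thesis using zero_less_one by blast
    qed
    then obtain s where s: "\<And>q. s q > 0" "\<And>q. \<not> bad (s q) q" by metis
    define t where "t = real n + sum s E + 1"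
    have sE: "0 \<le> sum s E" using s(1) by (intro sum_nonneg) (simp add: less_imp_le)
    then obtain p where p: "bad t p" using ex_bad[of t] by (auto simp: t_def)
    have "p \<notin> E"
    proof
      assume "p \<in> E"
      then have "s p \<le> sum s E" using finE s(1) by (intro member_le_sum) (auto simp: less_imp_le)
      then have "s p \<le> t" by (simp add: t_def)
      then show False using bad_mono[OF p] s(2) by blast
    qed
    moreover have "fst p \<in> mspace X" "snd p \<in> mspace X" "mdist X (fst p) (snd p) \<le> \<bar>r\<bar>" "mdist X (snd p) (fst p) \<le> \<bar>r\<bar>"
      using p by (auto simp: bad_def mdist_commute)
    ultimately have "\<forall>m<n. fst (P m) \<noteq> fst p \<and> snd (P m) \<noteq> snd p"
      by (cases p) (auto simp: E_def)
    moreover have "bad (real n) p" using bad_mono[OF p] sE by (simp add: t_def)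
    ultimately show ?thesis by blast
  qed
  obtain P :: "nat \<Rightarrow> 'a \<times> 'a" where P: "\<And>n. bad (real n) (P n)"
      "\<And>m n. m < n \<Longrightarrow> fst (P m) \<noteq> fst (P n) \<and> snd (P m) \<noteq> snd (P n)"
  proof -
    have "\<exists>P. \<forall>n. bad (real n) (P n) \<and> (\<forall>m<n. fst (P m) \<noteq> fst (P n) \<and> snd (P m) \<noteq> snd (P n))"
    proof (rule dependent_wf_choice[OF wf_less, where
          P = "\<lambda>P n p. bad (real n) p \<and> (\<forall>m<n. fst (P m) \<noteq> fst p \<and> snd (P m) \<noteq> snd p)"])
      fix n :: nat and P :: "nat \<Rightarrow> 'a \<times> 'a"
      assume "\<And>m. (m, n) \<in> {(x, y). x < y} \<Longrightarrow> bad (real m) (P m) \<and> (\<forall>k<m. fst (P k) \<noteq> fst (P m) \<and> snd (P k) \<noteq> snd (P m))"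
      then show "\<exists>p. bad (real n) p \<and> (\<forall>m<n. fst (P m) \<noteq> fst p \<and> snd (P m) \<noteq> snd p)" by (intro step) auto
    qed auto
    then show thesis using that by blast
  qed
  define x where "x n = fst (P n)" for n
  define y where "y n = snd (P n)" for n
  have inj_x: "inj x" and inj_y: "inj y"
    unfolding inj_def x_def y_def using P(2) by (metis linorder_neqE_nat)+
  have x: "x n \<in> mspace X" and y: "y n \<in> mspace X" and xy: "mdist X (x n) (y n) \<le> r" for n
    using P(1)[of n] by (auto simp: bad_def x_def y_def)
  have xK: "x ` K \<subseteq> mspace X" and yK: "y ` K \<subseteq> mspace X" for K using x y by auto
  define \<tau> where "\<tau> z = x (inv y z)" for z
  have \<tau>y: "\<tau> (y n) = x n" for n by (simp add: \<tau>_def inj_y)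
  have \<tau>_image: "\<tau> ` y ` K = x ` K" for K by (auto simp: \<tau>y image_image)
  have inj_\<tau>: "inj_on \<tau> (y ` K)" for K by (rule inj_onI) (auto simp: \<tau>y inj_eq[OF inj_x])
  define v where "v K = partial_translation (y ` K) \<tau>" for K
  define T where "T K = \<Phi> (v K)" for K
  have dist_\<tau>: "mdist X (\<tau> z) z \<le> r" if "z \<in> y ` K" for z K using that xy by (auto simp: \<tau>y)
  have v: "v K \<in> uniform_roe X" for K
    unfolding v_def by (rule partial_translation_uniform_roe[OF yK _ inj_\<tau> dist_\<tau>]) (simp_all add: \<tau>_image xK)
  have T: "T K \<in> uniform_roe Y" for K unfolding T_def by (rule image_uniform_roe[OF v])
  have T_Un: "T (K \<union> L) = T K + T L" if "K \<inter> L = {}" for K L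
  proof -
    have "y ` K \<inter> y ` L = {}" using that inj_y by (simp add: image_Int[symmetric])
    then have "v (K \<union> L) = v K + v L"
      unfolding v_def image_Un using inj_\<tau>[of "K \<union> L"] by (intro partial_translation_Un) (simp_all add: image_Un)
    then show ?thesis unfolding T_def using hom_add[OF v v] by simp
  qed
  have norm_T: "norm (blinfun_apply (T K) f) = norm (proj (x ` K) f)" for K f
  proof -
    have "\<tau> ` y ` K \<subseteq> mspace X" by (simp add: \<tau>_image xK)
    then have "norm (blinfun_apply (\<Phi> (partial_translation (y ` K) \<tau>)) f) = norm (proj (\<tau> ` y ` K) f)"
      by (rule norm_hom_partial_translation[OF yK _ inj_\<tau> dist_\<tau>])
    then show ?thesis by (simp add: T_def v_def \<tau>_image)
  qed
  have "v {n} = matrix_unit (y n) (x n)" for n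
    unfolding v_def matrix_unit_def by (rule partial_translation_cong) (auto simp: \<tau>y)
  then have T_bad: "\<not> approximable Y (real n) \<epsilon> (T {n})" for n
    using P(1)[of n] by (simp add: bad_def T_def x_def y_def)
  let ?G = "\<lambda>G. blinfun_apply (coord_projection (G :: 'b set))"
  (* a state: indices C already used, current index m, admissible later indices A, scale s *)
  define good :: "nat \<Rightarrow> nat set \<times> nat \<times> nat set \<times> real \<Rightarrow> bool" where
    "good n = (\<lambda>(C, m, A, s). m \<notin> C \<and> infinite A \<and> A \<inter> insert m C = {} \<and> real n \<le> s
       \<and> approximable Y s (\<epsilon> / 8) (T C) \<and> \<not> approximable Y s \<epsilon> (T {m})
       \<and> (\<exists>G. (\<forall>f. norm (proj (x ` {m}) (?G (- G) f)) \<le> \<epsilon> / 8 * norm f)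
            \<and> (\<forall>f. norm (proj (x ` A) (?G G f)) \<le> \<epsilon> / 8 * norm f)))" for n
  have \<epsilon>8: "\<epsilon> / 8 > 0" using \<epsilon> by simp
  have exists_good: "\<exists>m A s. good n (C, m, A, s) \<and> m \<in> A0 \<and> A \<subseteq> A0 - {m}"
    if A0: "infinite A0" "A0 \<inter> C = {}" for n C A0
  proof -
    obtain s1 where s1: "approximable Y s1 (\<epsilon> / 8) (T C)" using uniform_roe_approximable[OF T \<epsilon>8] by blast
    define s where "s = max s1 (real n)"
    have s: "approximable Y s (\<epsilon> / 8) (T C)" "real n \<le> s"
      using approximable_mono[OF s1, of s] by (auto simp: s_def)
    obtain k :: nat where k: "s \<le> real k" using real_arch_simple by blast
    obtain m where m: "m \<ge> k" "m \<in> A0" using A0(1) unfolding infinite_nat_iff_unbounded_le by blast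
    have "s \<le> real m" using k m(1) by linarith
    then have nm: "\<not> approximable Y s \<epsilon> (T {m})" using T_bad[of m] approximable_mono by blast
    obtain G where G: "finite G" "\<forall>f. norm (proj {x m} (?G (- G) f)) \<le> \<epsilon> / 8 * norm f"
      using proj_singleton_coord_approx[OF x \<epsilon>8] by blast
    have inf: "infinite (A0 - {m})" using A0(1) by simp
    obtain A where A: "A \<subseteq> A0 - {m}" "infinite A" "\<forall>f. norm (proj (x ` A) (?G G f)) \<le> \<epsilon> / 8 * norm f"
      using exists_subset_small_on_finite[OF inj_x xK[of UNIV] inf G(1) \<epsilon>8] by blast
    have disj: "m \<notin> C" "A \<inter> insert m C = {}" using A(1) A0(2) m(2) by auto
    have G': "\<forall>f. norm (proj (x ` {m}) (?G (- G) f)) \<le> \<epsilon> / 8 * norm f" using G(2) by simp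
    have "good n (C, m, A, s)"
      unfolding good_def prod.case by (intro conjI exI[of _ G] disj A(2,3) s nm G')
    then show ?thesis using m(2) A(1) by blast
  qed
  have "\<exists>S. \<forall>n. good n (S n) \<and> (case (S n, S (Suc n)) of ((C, m, A, s), (C', m', A', s')) \<Rightarrow>
      C' = insert m C \<and> m' \<in> A \<and> A' \<subseteq> A - {m'})"
  proof (rule dependent_nat_choice)
    show "\<exists>S. good 0 S" using exists_good[of UNIV "{}" 0] by blast
  next
    fix S n assume S: "good n S"
    obtain C m A s where S': "S = (C, m, A, s)" by (metis prod.collapse)
    have inf: "infinite A" "A \<inter> insert m C = {}" using S unfolding S' good_def by simp_all
    from exists_good[OF inf, of "Suc n"]
    obtain m' A' s' where "good (Suc n) (insert m C, m', A', s')" "m' \<in> A" "A' \<subseteq> A - {m'}"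
      by (elim exE conjE)
    then show "\<exists>S'. good (Suc n) S' \<and> (case (S, S') of ((C, m, A, s), (C', m', A', s')) \<Rightarrow>
      C' = insert m C \<and> m' \<in> A \<and> A' \<subseteq> A - {m'})"
      unfolding S' by (intro exI[of _ "(insert m C, m', A', s')"]) simp
  qed
  then obtain S where S: "\<forall>n. good n (S n) \<and> (case (S n, S (Suc n)) of ((C, m, A, s), (C', m', A', s')) \<Rightarrow>
      C' = insert m C \<and> m' \<in> A \<and> A' \<subseteq> A - {m'})" by (elim exE)
  define C where "C n = fst (S n)" for n
  define m where "m n = fst (snd (S n))" for n
  define A where "A n = fst (snd (snd (S n)))" for n
  define s where "s n = snd (snd (snd (S n)))" for n
  have S_eq: "S n = (C n, m n, A n, s n)" for n by (simp add: C_def m_def A_def s_def)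
  have good: "m n \<notin> C n" "A n \<inter> insert (m n) (C n) = {}" "real n \<le> s n"
      "approximable Y (s n) (\<epsilon> / 8) (T (C n))" "\<not> approximable Y (s n) \<epsilon> (T {m n})"
      "\<exists>G. (\<forall>f. norm (proj (x ` {m n}) (?G (- G) f)) \<le> \<epsilon> / 8 * norm f)
            \<and> (\<forall>f. norm (proj (x ` A n) (?G G f)) \<le> \<epsilon> / 8 * norm f)" for n
    using S[THEN spec, THEN conjunct1, of n] unfolding S_eq good_def prod.case by simp_all
  have next_state: "C (Suc n) = insert (m n) (C n)" "m (Suc n) \<in> A n" "A (Suc n) \<subseteq> A n" for n
    using S[THEN spec, THEN conjunct2, of n] unfolding S_eq prod.case by (simp, simp, blast)
  have C_eq: "C n = C 0 \<union> m ` {..<n}" for n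
    by (induction n) (auto simp: next_state lessThan_Suc)
  have A_mono: "A j \<subseteq> A n" if "n \<le> j" for n j
    by (rule lift_Suc_antimono_le[where f = A, OF next_state(3) that])
  have m_in: "m j \<in> A n" if nj: "n < j" for n j
  proof -
    obtain i where i: "j = Suc i" using nj by (cases j) auto
    then have "A i \<subseteq> A n" using nj by (intro A_mono) simp
    then show ?thesis using next_state(2)[of i] unfolding i by (rule subsetD)
  qed
  define K where "K = C 0 \<union> range m"
  obtain t b where tb: "has_propagation Y t b" "norm (T K - b) \<le> \<epsilon> / 8"
    using uniform_roe_approximable[OF T \<epsilon>8, of K] unfolding approximable_def by blast
  obtain n :: nat where n: "t \<le> real n" using real_arch_simple by blast
  obtain b' where b': "has_propagation Y (s n) b'" "norm (T (C n) - b') \<le> \<epsilon> / 8"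
    using good(4)[of n] unfolding approximable_def by blast
  have b: "has_propagation Y (s n) b" using has_propagation_mono[OF tb(1)] n good(3)[of n] by simp
  obtain G where G: "\<And>f. norm (proj (x ` {m n}) (?G (- G) f)) \<le> \<epsilon> / 8 * norm f"
      "\<And>f. norm (proj (x ` A n) (?G G f)) \<le> \<epsilon> / 8 * norm f"
    using good(6)[of n] by blast
  define L where "L = m ` {n<..}"
  have LA: "L \<subseteq> A n" using m_in by (auto simp: L_def)
  have "range m = m ` ({..<n} \<union> {n} \<union> {n<..})" by (intro arg_cong[where f = "image m"]) auto
  then have K_eq: "K = (C n \<union> {m n}) \<union> L" unfolding K_def C_eq[of n] L_def by (simp only: image_Un) auto
  have TK: "T K = T (C n) + T {m n} + T L"
  proof -
    have "(C n \<union> {m n}) \<inter> L = {}" "C n \<inter> {m n} = {}" using LA good(1,2)[of n] by auto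
    then show ?thesis unfolding K_eq by (simp only: T_Un)
  qed
  define c where "c = (b - b') o\<^sub>L coord_projection G"
  have "has_propagation Y (s n) c"
    unfolding c_def by (intro has_propagation_coord_projection has_propagation_diff b b'(1))
  moreover have "norm (T {m n} - c) \<le> \<epsilon>"
  proof (rule norm_blinfun_bound)
    show "0 \<le> \<epsilon>" using \<epsilon> by simp
    fix f
    let ?g = "?G G f"
    have g: "norm ?g \<le> norm f" by (rule norm_coord_projection_le)
    have "f = ?G (- G) f + ?g" using coord_projection_complement[of f G] by (simp add: algebra_simps)
    then have "blinfun_apply (T {m n}) f = blinfun_apply (T {m n}) (?G (- G) f) + blinfun_apply (T {m n}) ?g"
      by (metis blinfun.add_right)
    moreover have "blinfun_apply (T {m n}) ?g
        = blinfun_apply (T K) ?g - blinfun_apply (T (C n)) ?g - blinfun_apply (T L) ?g"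
      unfolding TK by (simp add: blinfun.add_left)
    ultimately have "blinfun_apply (T {m n} - c) f = blinfun_apply (T {m n}) (?G (- G) f)
        + blinfun_apply (T K - b) ?g - blinfun_apply (T (C n) - b') ?g - blinfun_apply (T L) ?g"
      by (simp add: c_def blinfun.diff_left)
    also have "norm \<dots> \<le> norm (blinfun_apply (T {m n}) (?G (- G) f)) + norm (blinfun_apply (T K - b) ?g)
        + norm (blinfun_apply (T (C n) - b') ?g) + norm (blinfun_apply (T L) ?g)"
      by (rule order_trans[OF norm_triangle_ineq4], rule add_right_mono,
          rule order_trans[OF norm_triangle_ineq4], rule add_right_mono, rule norm_triangle_ineq)
    also have "\<dots> \<le> \<epsilon> / 8 * norm f + \<epsilon> / 8 * norm f + \<epsilon> / 8 * norm f + \<epsilon> / 8 * norm f"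
    proof (intro add_mono)
      show "norm (blinfun_apply (T {m n}) (?G (- G) f)) \<le> \<epsilon> / 8 * norm f" unfolding norm_T by (rule G(1))
      have "norm (blinfun_apply (T K - b) ?g) \<le> norm (T K - b) * norm ?g" by (rule norm_blinfun)
      also have "\<dots> \<le> \<epsilon> / 8 * norm f" using tb(2) g \<epsilon> by (intro mult_mono) auto
      finally show "norm (blinfun_apply (T K - b) ?g) \<le> \<epsilon> / 8 * norm f" .
      have "norm (blinfun_apply (T (C n) - b') ?g) \<le> norm (T (C n) - b') * norm ?g" by (rule norm_blinfun)
      also have "\<dots> \<le> \<epsilon> / 8 * norm f" using b'(2) g \<epsilon> by (intro mult_mono) auto
      finally show "norm (blinfun_apply (T (C n) - b') ?g) \<le> \<epsilon> / 8 * norm f" .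
      have "norm (blinfun_apply (T L) ?g) \<le> norm (proj (x ` A n) ?g)"
        unfolding norm_T using LA by (intro norm_proj_mono xK) auto
      also have "\<dots> \<le> \<epsilon> / 8 * norm f" by (rule G(2))
      finally show "norm (blinfun_apply (T L) ?g) \<le> \<epsilon> / 8 * norm f" .
    qed
    also have "\<dots> \<le> \<epsilon> * norm f" using \<epsilon> by simp
    finally show "norm (blinfun_apply (T {m n} - c) f) \<le> \<epsilon> * norm f" .
  qed
  ultimately show False using good(5)[of n] unfolding approximable_def by blast
qed

end

subsection \<open>From an embedding to maps between the spaces\<close>

context compactly_embedded_roe_algebra
begin

lemma proj_singleton_nonzero:
  assumes x: "x \<in> mspace X"
  obtains \<xi> where "proj {x} \<xi> = \<xi>" "norm \<xi> = 1"
proof -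
  have x': "{x} \<subseteq> mspace X" using x by simp
  have empty: "proj {} f = 0" for f using D_Un[of "{}" "{}" f] by simp
  have "\<exists>g. proj {x} g \<noteq> 0"
  proof (rule ccontr)
    assume "\<nexists>g. proj {x} g \<noteq> 0"
    then have "\<Phi> (coord_projection {x}) = \<Phi> (coord_projection {})"
      using empty by (intro blinfun_eqI) (simp add: proj_def)
    then have "coord_projection {x} = coord_projection {}"
      using inj_onD[OF hom_inj] coord_projection_uniform_roe[OF x'] coord_projection_uniform_roe[of "{}" X] by simp
    then have "ell2_fun (blinfun_apply (coord_projection {x}) (delta x)) x
        = ell2_fun (blinfun_apply (coord_projection {}) (delta x)) x" by simp
    then show False by (simp add: ell2_fun_coord_projection delta.rep_eq)
  qed
  then obtain g where g: "proj {x} g \<noteq> 0" by blast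
  define \<xi> where "\<xi> = (1 / norm (proj {x} g)) *\<^sub>R proj {x} g"
  have "proj {x} (proj {x} g) = proj {x} g" using proj_compose[OF x' x'] by simp
  then have "proj {x} \<xi> = \<xi>" by (simp add: \<xi>_def proj_def blinfun.scaleR_right)
  moreover have "norm \<xi> = 1" using g by (simp add: \<xi>_def)
  ultimately show thesis using that by blast
qed

lemma proj_support:
  assumes "x \<in> mspace X" "y \<notin> mspace Y" shows "ell2_fun (proj {x} f) y = 0"
proof -
  have "\<Phi> (coord_projection {x}) \<in> bounded_ops (mspace Y)"
    using image_uniform_roe[OF coord_projection_uniform_roe] assms(1) uniform_roe_bounded_ops by blast
  then show ?thesis using assms(2) by (simp add: bounded_ops_def proj_def)
qed

text \<open>
  Sparsify a unit vector \<open>\<xi>\<close> in the range of the projection \<open>q\<close> into far apart pieces \<open>\<eta>\<^sub>W\<close> of bounded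
  support. An approximation of \<open>q\<close> of finite propagation maps the pieces to orthogonal vectors. If
  \<open>q\<close> were small on every piece, then \<open>q\<close> would be small on the sum \<open>\<eta>\<close> of the pieces; but \<open>\<eta>\<close>
  has a large component along \<open>\<xi> = q \<xi>\<close>.
\<close>
lemma proj_delta_lower_bound:
  assumes ulfX: "ulf X" and ulfY: "ulf Y" and sp: "metric_sparsification Y"
  shows "\<exists>\<delta>>0. \<forall>x\<in>mspace X. \<exists>y\<in>mspace Y. \<delta> \<le> norm (proj {x} (delta y))"
proof -
  obtain c where c: "c > 0" "\<forall>R>0. \<exists>S>0. sparsifiable Y R S c (mspace Y)"
    using sp unfolding metric_sparsification_def by blast
  (* truncating a unit vector to a finite set keeps half of its mass, sparsification the proportion c of that *)
  define t0 where "t0 = sqrt (c / 2)"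
  have t0: "t0 > 0" "t0\<^sup>2 = c / 2" using c(1) by (auto simp: t0_def)
  define \<epsilon> where "\<epsilon> = t0 / 4"
  have \<epsilon>: "\<epsilon> > 0" using t0 by (simp add: \<epsilon>_def)
  obtain s where s: "s > 0" "\<forall>x\<in>mspace X. \<forall>y\<in>mspace X. mdist X x y \<le> 0 \<longrightarrow> approximable Y s \<epsilon> (\<Phi> (matrix_unit y x))"
    using matrix_units_uniformly_approximable[OF ulfX \<epsilon>, of 0] by blast
  have "2 * s > 0" using s(1) by simp
  then obtain S where S: "S > 0" "sparsifiable Y (2 * s) S c (mspace Y)" using c(2) by blast
  obtain N where N: "\<forall>T\<subseteq>mspace Y. (\<forall>u\<in>T. \<forall>v\<in>T. mdist Y u v \<le> S) \<longrightarrow> finite T \<and> card T \<le> N"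
    using ulf_bounded_card[OF ulfY less_imp_le[OF S(1)]] by blast
  define \<delta> where "\<delta> = t0 / (4 * (real N + 1))"
  have \<delta>: "\<delta> > 0" "real N * \<delta> \<le> t0 / 4" using t0 by (auto simp: \<delta>_def field_simps)
  have "\<exists>y\<in>mspace Y. \<delta> \<le> norm (proj {x} (delta y))" if x: "x \<in> mspace X" for x
  proof (rule ccontr)
    assume "\<not> ?thesis"
    then have small: "norm (proj {x} (delta y)) \<le> \<delta>" if "y \<in> mspace Y" for y using that by force
    have x': "{x} \<subseteq> mspace X" using x by simp
    obtain a where a: "has_propagation Y s a" "norm (\<Phi> (coord_projection {x}) - a) \<le> \<epsilon>"
    proof -
      have "mdist X x x \<le> 0" using x by (simp add: mdist_self)
      then have "approximable Y s \<epsilon> (\<Phi> (coord_projection {x}))" using s(2) x by (simp flip: matrix_unit_self)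
      then show thesis using that unfolding approximable_def by blast
    qed
    have a_lin: "blinfun_apply a (cscale k f) = cscale k (blinfun_apply a f)" for k f
      using a(1) by (simp add: has_propagation_def bounded_ops_def)
    have near: "norm (proj {x} f - blinfun_apply a f) \<le> \<epsilon> * norm f" for f
    proof -
      have "proj {x} f - blinfun_apply a f = blinfun_apply (\<Phi> (coord_projection {x}) - a) f"
        by (simp add: proj_def blinfun.diff_left)
      also have "norm \<dots> \<le> norm (\<Phi> (coord_projection {x}) - a) * norm f" by (rule norm_blinfun)
      also have "\<dots> \<le> \<epsilon> * norm f" using a(2) by (intro mult_right_mono) auto
      finally show ?thesis .
    qed
    obtain \<xi> where \<xi>: "proj {x} \<xi> = \<xi>" "norm \<xi> = 1" using proj_singleton_nonzero[OF x] .
    have supp: "ell2_fun \<xi> y = 0" if "y \<notin> mspace Y" for y using proj_support[OF x that, of \<xi>] \<xi>(1) by simp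
    define \<mu> where "\<mu> y = (cmod (ell2_fun \<xi> y))\<^sup>2" for y
    define part where "part A = (\<Sum>y\<in>A. cscale (ell2_fun \<xi> y) (delta y))" for A
    have norm_part: "(norm (part A))\<^sup>2 = sum \<mu> A" if "finite A" for A
      unfolding part_def \<mu>_def by (rule norm_sum_delta[OF that])
    obtain F where F: "finite F" "F \<subseteq> mspace Y" "sum \<mu> F \<ge> 1 / 2"
    proof -
      have "\<forall>\<^sub>F F in finite_subsets_at_top UNIV. dist (part F) \<xi> < 1 / 4"
        unfolding part_def by (intro tendstoD[OF finite_support_approx]) simp
      then obtain F where F: "finite F" "dist (part F) \<xi> < 1 / 4"
        unfolding eventually_finite_subsets_at_top by blast
      have "norm \<xi> \<le> norm (part F) + norm (part F - \<xi>)" by (metis norm_triangle_sub norm_minus_commute)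
      then have "3 / 4 \<le> norm (part F)" using F(2) \<xi>(2) by (simp add: dist_norm)
      then have "(3 / 4)\<^sup>2 \<le> (norm (part F))\<^sup>2" by (intro power_mono) auto
      then have "1 / 2 \<le> sum \<mu> F" unfolding norm_part[OF F(1)] by (simp add: power2_eq_square)
      also have "sum \<mu> F = sum \<mu> (F \<inter> mspace Y)"
        using F(1) supp by (intro sum.mono_neutral_right) (auto simp: \<mu>_def)
      finally show thesis using that[of "F \<inter> mspace Y"] F(1) by simp
    qed
    have "\<forall>y. 0 \<le> \<mu> y" by (simp add: \<mu>_def)
    from sparsifiableD[OF S(2) F(1,2) this]
    obtain \<Omega> where \<Omega>: "\<Omega> \<subseteq> F" "chain_bounded Y (2 * s) S \<Omega>" "c * sum \<mu> F \<le> sum \<mu> \<Omega>"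
      by (elim exE conjE)
    have fin\<Omega>: "finite \<Omega>" using \<Omega>(1) F(1) by (rule finite_subset)
    have \<Omega>Y: "\<Omega> \<subseteq> mspace Y" using \<Omega>(1) F(2) by blast
    define t where "t = sum \<mu> \<Omega>"
    have "c * (1 / 2) \<le> c * sum \<mu> F" using F(3) c(1) by (intro mult_left_mono) auto
    then have t: "t0\<^sup>2 \<le> t" using \<Omega>(3) by (simp add: t_def t0(2))
    then have tpos: "t > 0" using t0(1) by (meson less_le_trans zero_less_power)
    define \<W> where "\<W> = chain_components Y (2 * s) \<Omega>"
    have \<W>: "\<Union>\<W> = \<Omega>" unfolding \<W>_def by (rule Union_chain_components)
    have fin\<W>: "finite \<W>" unfolding \<W>_def chain_components_def using fin\<Omega> by simp
    have W\<Omega>: "W \<subseteq> \<Omega>" if "W \<in> \<W>" for W using that \<W> by blast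
    have finW: "finite W" if "W \<in> \<W>" for W using finite_subset[OF W\<Omega>[OF that] fin\<Omega>] .
    have cardW: "card W \<le> N" if "W \<in> \<W>" for W
      using N W\<Omega>[OF that] \<Omega>Y chain_components_diameter[OF \<Omega>(2) that[unfolded \<W>_def]] by (meson subset_trans)
    have disjW: "U \<inter> V = {}" if "U \<in> \<W>" "V \<in> \<W>" "U \<noteq> V" for U V
      using chain_components_disjoint[of Y "2 * s" \<Omega>] that unfolding \<W>_def by (rule disjointD)
    have part_Un: "part \<Omega> = (\<Sum>W\<in>\<W>. part W)"
      unfolding part_def \<W>[symmetric] using finW disjW by (subst sum.Union_disjoint) auto
    have t_sum: "t = (\<Sum>W\<in>\<W>. sum \<mu> W)"
      unfolding t_def \<W>[symmetric] using finW disjW by (subst sum.Union_disjoint) auto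
    have coord_part: "cmod (ell2_fun \<xi> y) \<le> norm (part W)" if "W \<in> \<W>" "y \<in> W" for W y
      using cmod_ell2_fun_le[of "part W" y] ell2_fun_sum_delta[OF finW[OF that(1)], of "ell2_fun \<xi>" y] that(2)
      by (simp add: part_def)
    have proj_part: "norm (proj {x} (part W)) \<le> t0 / 4 * norm (part W)" if W: "W \<in> \<W>" for W
    proof -
      have "proj {x} (part W) = (\<Sum>y\<in>W. cscale (ell2_fun \<xi> y) (proj {x} (delta y)))"
        by (simp add: part_def proj_sum proj_cscale[OF x'])
      also have "norm \<dots> \<le> (\<Sum>y\<in>W. norm (part W) * \<delta>)"
      proof (rule sum_norm_le)
        fix y assume y: "y \<in> W"
        then have "norm (proj {x} (delta y)) \<le> \<delta>" using small W\<Omega>[OF W] \<Omega>Y by blast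
        then show "norm (cscale (ell2_fun \<xi> y) (proj {x} (delta y))) \<le> norm (part W) * \<delta>"
          unfolding norm_cscale using coord_part[OF W y] by (intro mult_mono) auto
      qed
      also have "\<dots> = real (card W) * \<delta> * norm (part W)" by simp
      also have "\<dots> \<le> real N * \<delta> * norm (part W)" using cardW[OF W] \<delta>(1) by (intro mult_right_mono) auto
      also have "\<dots> \<le> t0 / 4 * norm (part W)" using \<delta>(2) by (intro mult_right_mono) auto
      finally show ?thesis .
    qed
    have a_part: "norm (blinfun_apply a (part W)) \<le> t0 / 2 * norm (part W)" if W: "W \<in> \<W>" for W
    proof -
      have "blinfun_apply a (part W) = proj {x} (part W) - (proj {x} (part W) - blinfun_apply a (part W))" by simp
      also have "norm \<dots> \<le> norm (proj {x} (part W)) + norm (proj {x} (part W) - blinfun_apply a (part W))"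
        by (rule norm_triangle_ineq4)
      also have "\<dots> \<le> t0 / 4 * norm (part W) + \<epsilon> * norm (part W)" by (rule add_mono[OF proj_part[OF W] near])
      finally show ?thesis by (simp add: \<epsilon>_def)
    qed
    have a_supp: "z \<in> mspace Y \<and> (\<exists>y\<in>W. mdist Y y z \<le> s)"
      if W: "W \<in> \<W>" and z: "ell2_fun (blinfun_apply a (part W)) z \<noteq> 0" for W z
    proof -
      have zY: "z \<in> mspace Y" using z a(1) unfolding has_propagation_def bounded_ops_def by blast
      have "ell2_fun (blinfun_apply a (part W)) z
          = (\<Sum>y\<in>W. ell2_fun \<xi> y * ell2_fun (blinfun_apply a (delta y)) z)"
        by (simp add: part_def blinfun.sum_right a_lin cinner_sum_left cinner_cscale_left flip: cinner_delta_right)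
      then obtain y where y: "y \<in> W" "ell2_fun (blinfun_apply a (delta y)) z \<noteq> 0"
        using z by (metis (no_types, lifting) mult_zero_right sum.neutral)
      have "y \<in> mspace Y" using y(1) W\<Omega>[OF W] \<Omega>Y by blast
      then have "mdist Y y z \<le> s" using a(1) y(2) zY unfolding has_propagation_def by force
      then show ?thesis using zY y(1) by blast
    qed
    have orth: "orthogonal (blinfun_apply a (part U)) (blinfun_apply a (part V))"
      if UV: "U \<in> \<W>" "V \<in> \<W>" "U \<noteq> V" for U V
    proof -
      have "ell2_fun (blinfun_apply a (part U)) z * cnj (ell2_fun (blinfun_apply a (part V)) z) = 0" for z
      proof (rule ccontr)
        assume "\<not> ?thesis"
        then have nz: "ell2_fun (blinfun_apply a (part U)) z \<noteq> 0" "ell2_fun (blinfun_apply a (part V)) z \<noteq> 0" by auto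
        obtain u v where uv: "u \<in> U" "v \<in> V" "mdist Y u z \<le> s" "mdist Y v z \<le> s" "z \<in> mspace Y"
          using a_supp[OF UV(1) nz(1)] a_supp[OF UV(2) nz(2)] by blast
        have uvY: "u \<in> mspace Y" "v \<in> mspace Y" using uv(1,2) W\<Omega> UV \<Omega>Y by blast+
        have "mdist Y u v \<le> mdist Y u z + mdist Y z v" using uvY uv(5) by (intro mdist_triangle)
        then have "mdist Y u v \<le> 2 * s" using uv(3,4) by (simp add: mdist_commute)
        moreover have "mdist Y u v > 2 * s"
          using chain_components_separated[OF UV[unfolded \<W>_def] uv(1,2)] .
        ultimately show False by simp
      qed
      then have "cinner (blinfun_apply a (part U)) (blinfun_apply a (part V)) = 0"
        unfolding cinner.rep_eq by (intro infsum_0) blast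
      then show ?thesis by (simp add: orthogonal_def inner_ell2_def)
    qed
    have "(norm (blinfun_apply a (part \<Omega>)))\<^sup>2 = (\<Sum>W\<in>\<W>. (norm (blinfun_apply a (part W)))\<^sup>2)"
      unfolding part_Un blinfun.sum_right
      by (rule norm_sum_Pythagorean[OF fin\<W>]) (use orth in \<open>auto simp: pairwise_def\<close>)
    also have "\<dots> \<le> (\<Sum>W\<in>\<W>. (t0 / 2 * norm (part W))\<^sup>2)"
      using a_part by (intro sum_mono power_mono) auto
    also have "\<dots> = (t0 / 2)\<^sup>2 * t"
    proof -
      have "(\<Sum>W\<in>\<W>. (t0 / 2 * norm (part W))\<^sup>2) = (\<Sum>W\<in>\<W>. (t0 / 2)\<^sup>2 * sum \<mu> W)"
        using norm_part[OF finW] by (intro sum.cong refl) (simp only: power_mult_distrib)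
      then show ?thesis unfolding t_sum by (simp only: sum_distrib_left[of "(t0 / 2)\<^sup>2" "\<lambda>W. sum \<mu> W"])
    qed
    also have "\<dots> = (t0 / 2 * sqrt t)\<^sup>2" using tpos by (simp only: power_mult_distrib real_sqrt_pow2 less_imp_le)
    finally have a_norm: "norm (blinfun_apply a (part \<Omega>)) \<le> t0 / 2 * sqrt t"
      using t0(1) tpos by (meson power2_le_imp_le mult_nonneg_nonneg real_sqrt_ge_zero less_imp_le half_gt_zero)
    have norm_\<Omega>: "norm (part \<Omega>) = sqrt t"
      using norm_part[OF fin\<Omega>] by (metis t_def norm_ge_zero real_sqrt_unique)
    have "cinner (proj {x} (part \<Omega>)) \<xi> = cinner (part \<Omega>) \<xi>" using proj_adj[OF x', of "part \<Omega>" \<xi>] \<xi>(1) by simp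
    also have "\<dots> = of_real t"
      by (simp add: part_def t_def \<mu>_def cinner_sum_left cinner_cscale_left cinner_delta_left flip: complex_norm_square)
    finally have "t = cmod (cinner (proj {x} (part \<Omega>)) \<xi>)" using tpos by simp
    also have "\<dots> \<le> norm (proj {x} (part \<Omega>))" using norm_cinner_le[of "proj {x} (part \<Omega>)" \<xi>] \<xi>(2) by simp
    also have "\<dots> \<le> norm (blinfun_apply a (part \<Omega>)) + norm (proj {x} (part \<Omega>) - blinfun_apply a (part \<Omega>))"
      by (metis norm_triangle_sub)
    also have "\<dots> \<le> t0 / 2 * sqrt t + \<epsilon> * sqrt t" using a_norm near[of "part \<Omega>"] norm_\<Omega> by simp
    also have "\<dots> = (3 / 4 * t0) * sqrt t" by (simp add: \<epsilon>_def algebra_simps)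
    finally have "sqrt t * sqrt t \<le> (3 / 4 * t0) * sqrt t" using tpos by simp
    then have "sqrt t \<le> 3 / 4 * t0" by (rule mult_right_le_imp_le) (simp add: tpos)
    moreover have "t0 \<le> sqrt t" using t t0(1) by (simp add: real_le_rsqrt)
    ultimately show False using t0(1) by simp
  qed
  then show ?thesis using \<delta>(1) by blast
qed

lemma cinner_matrix_unit:
  assumes "x \<in> mspace X" "y \<in> mspace X" "z \<in> mspace X"
  shows "cinner (blinfun_apply (\<Phi> (matrix_unit y x)) f) g
    = cinner (blinfun_apply (\<Phi> (matrix_unit z x)) f) (blinfun_apply (\<Phi> (matrix_unit z y)) g)"
proof -
  have "\<Phi> (matrix_unit y x) = \<Phi> (matrix_unit y z) o\<^sub>L \<Phi> (matrix_unit z x)"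
    using hom_compose[of "matrix_unit y z" "matrix_unit z x"] assms
    by (simp add: matrix_unit_uniform_roe matrix_unit_compose)
  then show ?thesis
    using cinner_hom[of "matrix_unit y z" "blinfun_apply (\<Phi> (matrix_unit z x)) f" g] assms
    by (simp add: matrix_unit_uniform_roe op_adj_matrix_unit)
qed

text \<open>
  Choose \<open>f x\<close> with \<open>q\<^sub>x \<delta>\<^bsub>f x\<^esub>\<close> not small. If \<open>q\<^sub>x\<close> has rank at least \<open>2\<close>, the choices need not be
  compatible, so the vectors are transported into the range of \<open>q\<^bsub>x0\<^esub>\<close> for one base point \<open>x0\<close>. There
  they lie in a compact set. On the set of all \<open>x\<close> whose vectors lie in one small ball,
  the matrix coefficient of the image of the matrix unit from \<open>x\<close> to \<open>x'\<close> at
  \<open>f x\<close> and \<open>f x'\<close> is bounded below, and so \<open>f x\<close> and \<open>f x'\<close> are close.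
\<close>
lemma piecewise_coarse:
  assumes ulfX: "ulf X" and ulfY: "ulf Y" and sp: "metric_sparsification Y"
  shows "piecewise_coarse_finite_to_one X Y"
proof (cases "mspace X = {}")
  case True
  then show ?thesis unfolding piecewise_coarse_finite_to_one_def by (intro exI[of _ 0]) simp
next
  case False
  then obtain x0 where x0: "x0 \<in> mspace X" by blast
  obtain \<delta> where \<delta>: "\<delta> > 0" "\<forall>x\<in>mspace X. \<exists>y\<in>mspace Y. \<delta> \<le> norm (proj {x} (delta y))"
    using proj_delta_lower_bound[OF assms] by blast
  then obtain f where f: "\<And>x. x \<in> mspace X \<Longrightarrow> f x \<in> mspace Y"
      "\<And>x. x \<in> mspace X \<Longrightarrow> \<delta> \<le> norm (proj {x} (delta (f x)))" by metis
  define w where "w x = blinfun_apply (\<Phi> (matrix_unit x0 x)) (delta (f x))" for x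
  have norm_w: "norm (w x) = norm (proj {x} (delta (f x)))" if "x \<in> mspace X" for x
    unfolding w_def by (rule norm_matrix_unit[OF that x0])
  define K where "K = closure (proj {x0} ` cball 0 1)"
  have K: "compact K"
    using compact compact_matrix_unit[of x0 x0] coord_projection_uniform_roe[of "{x0}" X] x0
    by (simp add: K_def compact_preserving_def matrix_unit_self compact_op_def proj_def)
  have w_K: "w x \<in> K" if x: "x \<in> mspace X" for x
  proof -
    have "\<Phi> (matrix_unit x0 x) = \<Phi> (coord_projection {x0}) o\<^sub>L \<Phi> (matrix_unit x0 x)"
      using hom_compose[of "matrix_unit x0 x0" "matrix_unit x0 x"] x x0
      by (simp add: matrix_unit_uniform_roe matrix_unit_compose flip: matrix_unit_self)
    then have "w x = proj {x0} (w x)" unfolding w_def proj_def by (metis blinfun_apply_blinfun_compose)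
    moreover have "norm (w x) \<le> 1" using norm_w[OF x] norm_proj_le[of "{x}" "delta (f x)"] x by (simp add: norm_delta)
    ultimately have "w x \<in> proj {x0} ` cball 0 1" by force
    then show ?thesis unfolding K_def by (rule closure_subset[THEN subsetD])
  qed
  have "K \<subseteq> (\<Union>v\<in>K. ball v (\<delta> / 2))" using \<delta>(1) by auto
  then obtain k where k: "k \<subseteq> K" "finite k" "K \<subseteq> (\<Union>v\<in>k. ball v (\<delta> / 2))"
    using compactE_image[OF K, of K "\<lambda>v. ball v (\<delta> / 2)"] by auto
  obtain m :: nat and e where e: "k = e ` {i. i < m}"
    using finite_imp_nat_seg_image_inj_on[OF k(2)] by blast
  define S where "S i = {x \<in> mspace X. dist (e i) (w x) < \<delta> / 2}" for i
  have cover: "mspace X = (\<Union>i<m. S i)"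
  proof
    show "mspace X \<subseteq> (\<Union>i<m. S i)"
    proof
      fix x assume x: "x \<in> mspace X"
      then obtain v where "v \<in> k" "w x \<in> ball v (\<delta> / 2)" using w_K[OF x] k(3) by blast
      then obtain i where "i < m" "v = e i" using e by blast
      then show "x \<in> (\<Union>i<m. S i)" using x \<open>w x \<in> ball v (\<delta> / 2)\<close> by (auto simp: S_def)
    qed
  qed (auto simp: S_def)
  have "coarse_finite_to_one X Y (S i) f" for i
    unfolding coarse_finite_to_one_def
  proof (intro conjI allI impI)
    show SX: "S i \<subseteq> mspace X" by (auto simp: S_def)
    show "f ` S i \<subseteq> mspace Y" using f(1) SX by auto
    have \<delta>4: "\<delta>\<^sup>2 / 4 > 0" using \<delta>(1) by simp
    fix r :: real assume "r > 0"
    obtain s where s: "s > 0" "\<forall>x\<in>mspace X. \<forall>y\<in>mspace X. mdist X x y \<le> r \<longrightarrow> approximable Y s (\<delta>\<^sup>2 / 4) (\<Phi> (matrix_unit y x))"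
      using matrix_units_uniformly_approximable[OF ulfX \<delta>4, of r] by blast
    have "mdist Y (f x) (f x') \<le> s" if x: "x \<in> S i" and x': "x' \<in> S i" and xx': "mdist X x x' \<le> r" for x x'
    proof (rule ccontr)
      assume far: "\<not> mdist Y (f x) (f x') \<le> s"
      have xX: "x \<in> mspace X" "x' \<in> mspace X" using x x' SX by auto
      obtain b where b: "has_propagation Y s b" "norm (\<Phi> (matrix_unit x' x) - b) \<le> \<delta>\<^sup>2 / 4"
        using s(2) xX xx' unfolding approximable_def by blast
      have b0: "ell2_fun (blinfun_apply b (delta (f x))) (f x') = 0"
        using b(1) far f(1)[OF xX(1)] f(1)[OF xX(2)] unfolding has_propagation_def by force
      have "cinner (w x) (w x') = cinner (blinfun_apply (\<Phi> (matrix_unit x' x)) (delta (f x))) (delta (f x'))"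
        unfolding w_def by (rule cinner_matrix_unit[OF xX x0, symmetric])
      also have "\<dots> = ell2_fun (blinfun_apply (\<Phi> (matrix_unit x' x) - b) (delta (f x))) (f x')"
        by (simp add: cinner_delta_right blinfun.diff_left ell2_fun_minus b0)
      finally have "cmod (cinner (w x) (w x')) \<le> norm (blinfun_apply (\<Phi> (matrix_unit x' x) - b) (delta (f x)))"
        by (simp add: cmod_ell2_fun_le)
      also have "\<dots> \<le> norm (\<Phi> (matrix_unit x' x) - b) * norm (delta (f x))" by (rule norm_blinfun)
      also have "\<dots> \<le> \<delta>\<^sup>2 / 4" using b(2) by (simp add: norm_delta)
      finally have upper: "w x \<bullet> w x' \<le> \<delta>\<^sup>2 / 4"
        using complex_Re_le_cmod[of "cinner (w x) (w x')"] by (simp add: inner_ell2_def)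
      have "dist (w x) (w x') \<le> dist (e i) (w x) + dist (e i) (w x')" by (rule dist_triangle3)
      also have "\<dots> \<le> \<delta>" using x x' by (simp add: S_def)
      finally have "norm (w x - w x') \<le> \<delta>" by (simp add: dist_norm)
      then have "(norm (w x - w x'))\<^sup>2 \<le> \<delta>\<^sup>2" by (intro power_mono) auto
      moreover have "\<delta>\<^sup>2 \<le> (norm (w x))\<^sup>2" "\<delta>\<^sup>2 \<le> (norm (w x'))\<^sup>2"
        using f(2) norm_w xX \<delta>(1) by (auto intro!: power_mono)
      moreover have "(norm (w x - w x'))\<^sup>2 = (norm (w x))\<^sup>2 + (norm (w x'))\<^sup>2 - 2 * (w x \<bullet> w x')"
        by (simp add: power2_norm_eq_inner inner_diff_left inner_diff_right inner_commute)
      ultimately show False using upper \<delta>4 by linarith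
    qed
    then show "\<exists>s>0. \<forall>x\<in>S i. \<forall>y\<in>S i. mdist X x y \<le> r \<longrightarrow> mdist Y (f x) (f y) \<le> s" using s(1) by blast
  next
    have SX: "S i \<subseteq> mspace X" by (auto simp: S_def)
    obtain L :: nat where L: "1 / \<delta>\<^sup>2 < real L" using reals_Archimedean2 by blast
    have fibre: "card F \<le> L" if F: "finite F" "F \<subseteq> {x \<in> S i. f x = z}" for F z
    proof -
      have "real (card F) * \<delta>\<^sup>2 = (\<Sum>x\<in>F. \<delta>\<^sup>2)" by simp
      also have "\<dots> \<le> (\<Sum>x\<in>F. (norm (proj {x} (delta z)))\<^sup>2)"
      proof (intro sum_mono power_mono)
        fix x assume "x \<in> F"
        then have "x \<in> mspace X" "f x = z" using F(2) SX by auto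
        then show "\<delta> \<le> norm (proj {x} (delta z))" using f(2) by blast
      qed (use \<delta>(1) in simp)
      also have "\<dots> \<le> (norm (delta z))\<^sup>2" using F SX by (intro sum_norm_proj_square_le) auto
      finally have "real (card F) \<le> 1 / \<delta>\<^sup>2" using \<delta>(1) by (simp add: norm_delta pos_le_divide_eq)
      then show ?thesis using L by linarith
    qed
    have "finite {x \<in> S i. f x = z} \<and> card {x \<in> S i. f x = z} \<le> L" for z
    proof -
      have "finite {x \<in> S i. f x = z}"
      proof (rule ccontr)
        assume "infinite {x \<in> S i. f x = z}"
        then obtain F where "F \<subseteq> {x \<in> S i. f x = z}" "finite F" "card F = Suc L"
          using infinite_arbitrarily_large by blast
        then show False using fibre[of F z] by simp
      qed
      then show ?thesis using fibre by blast
    qed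
    then show "\<exists>K. \<forall>z. finite {x \<in> S i. f x = z} \<and> card {x \<in> S i. f x = z} \<le> K" by blast
  qed
  then show ?thesis unfolding piecewise_coarse_finite_to_one_def using cover by blast
qed

end

section \<open>Large-scale properties pass to embedded algebras\<close>

theorem corollary1p3:
  fixes X :: "'a metric" and Y :: "'b metric"
  assumes "ulf X" and "ulf Y"
    and "\<exists>\<Phi>. roe_embedding X Y \<Phi> \<and> compact_preserving X \<Phi>"
  shows "asydim X \<le> asydim Y \<and> (property_A Y \<longrightarrow> property_A X) \<and> (FDC Y \<longrightarrow> FDC X)"
proof -
  obtain \<Phi> where \<Phi>: "roe_embedding X Y \<Phi>" "compact_preserving X \<Phi>" using assms(3) by blast
  interpret compactly_embedded_roe_algebra X Y \<Phi> by unfold_locales (rule \<Phi>)+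
  have maps: "piecewise_coarse_finite_to_one X Y" if "metric_sparsification Y"
    using piecewise_coarse[OF assms(1,2) that] .
  have "asydim X \<le> asydim Y"
    unfolding asydim_def[of Y]
  proof (rule Inf_greatest)
    fix e assume "e \<in> {enat n | n. asydim_le Y n}"
    then obtain n where n: "e = enat n" "asydim_le Y n" by blast
    have "asydim_le X n"
      using asydim_le_transfer[OF maps[OF asydim_le_sparsification[OF n(2)]] assms(2) n(2)] .
    then show "asydim X \<le> e" unfolding asydim_def n(1) by (intro Inf_lower) blast
  qed
  moreover have "property_A X" if "property_A Y"
    using property_A_transfer[OF maps[OF property_A_sparsification[OF that assms(2)]] assms(1,2) that] .
  moreover have "FDC X" if "FDC Y"
    using FDC_transfer[OF maps[OF FDC_sparsification[OF that]] assms(2) that] .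
  ultimately show ?thesis by blast
qed

end
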